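(* There exists an algorithm for distributed asynchronous collective tree exploration (DACTE) with $k$ robots that explores any tree with $n$ nodes and depth $D$ in at most $2n+\mathcal{O}(k^2 2^k D)$ moves, and a variant of this algorithm that explores any tree with $n$ nodes and depth $D$ in at most $\mathcal{O}(k/\log k)(n+kD)$ moves. (The constants in $\mathcal{O}(\cdot)$ are absolute, independent of $k,n,D$.)
   Context: DACTE model. An unknown finite rooted tree $T$ is to be explored by $k$ robots (agents), all initially located at the root. Nodes are identified by the sequence of port numbers leading from the root to them. Every node carries a whiteboard of unbounded size; each robot has unbounded internal memory and unbounded computational power; initially all whiteboards and memories are empty. Exploration proceeds in rounds $t=1,2,\dots$. At each round an omniscient adversary (knowing the algorithm, the tree, and all memories and positions) selects one robot, which performs the following consecutive instantaneous steps: (1) it reads the whiteboard at its current node; (2) it observes the list of nodes adjacent to its position; (3) it writes on the whiteboard at its position and updates its internal memory; (4) it moves along an edge to a neighbour of its choice (robots do not read or write at their destination). Each round counts as one move. A node is visited once the adversary has activated a robot located at it; exploration finishes at the first round at which every node of $T$ has been visited. An algorithm explores a tree in at most $M$ moves if, against every adversary, exploration finishes within $M$ rounds. The depth of $T$ is the maximum distance (number of edges) from the root to a node. *)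

theory Defs
  imports Complex_Main
begin

(* A node is the sequence of port numbers on the path from the root (the empty
   sequence) to it, so a finite rooted port-labelled tree is a finite
   prefix-closed set of such sequences. No constraint is put on which numbers
   serve as ports: every numbering of the ports is covered. *)

type_synonym node = "nat list"

definition rooted_tree :: "node set \<Rightarrow> bool" where
  "rooted_tree T \<longleftrightarrow> finite T \<and> [] \<in> T \<and> (\<forall>v p. v @ [p] \<in> T \<longrightarrow> v \<in> T)"

definition adjacent :: "node set \<Rightarrow> node \<Rightarrow> node set" where
  "adjacent T v = {u \<in> T. \<exists>p. u = v @ [p] \<or> v = u @ [p]}"

(* The distance of a node from the root is its length. *)
definition depth :: "node set \<Rightarrow> nat" where
  "depth T = Max (length ` T)"

(* Whiteboards and memories hold finite but unboundedly long data; the empty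
   list is the empty content. *)

type_synonym memory = "nat list"
type_synonym whiteboard = "nat list"

(* The arguments of an algorithm are all that an activated robot has access to:
   the whiteboard at its position, its own memory, and the nodes adjacent to
   its position. The result consists of the new whiteboard, the new memory and
   the neighbour to move to. All robots run the same function, with no built-in
   identity and no knowledge of the tree. Being an arbitrary function, an
   algorithm has unbounded computational power. *)

type_synonym algorithm =
  "whiteboard \<Rightarrow> memory \<Rightarrow> node set \<Rightarrow> whiteboard \<times> memory \<times> node"

definition is_algorithm :: "algorithm \<Rightarrow> bool" where
  "is_algorithm A \<longleftrightarrow>
     (\<forall>w m N. N \<noteq> {} \<longrightarrow> (case A w m N of (w', m', u) \<Rightarrow> u \<in> N))"

record config =
  pos :: "nat \<Rightarrow> node"
  mem :: "nat \<Rightarrow> memory"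
  board :: "node \<Rightarrow> whiteboard"

definition initial_config :: config where
  "initial_config = \<lparr>pos = (\<lambda>i. []), mem = (\<lambda>i. []), board = (\<lambda>v. [])\<rparr>"

(* In the one-node tree a robot has no neighbour and remains at the root. *)
definition activate :: "algorithm \<Rightarrow> node set \<Rightarrow> nat \<Rightarrow> config \<Rightarrow> config" where
  "activate A T i c =
     (let v = pos c i; N = adjacent T v in
      case A (board c v) (mem c i) N of (w', m', u) \<Rightarrow>
        \<lparr>pos = (pos c)(i := (if N = {} then v else u)),
         mem = (mem c)(i := m'),
         board = (board c)(v := w')\<rparr>)"

(* In every round the adversary picks a robot i < k from the round number and the
   complete current configuration. Dependence on the algorithm, the tree and
   the past is covered as well: algorithms are deterministic and the adversary
   is quantified after the algorithm and the tree. *)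

type_synonym adversary = "nat \<Rightarrow> config \<Rightarrow> nat"

definition is_adversary :: "nat \<Rightarrow> adversary \<Rightarrow> bool" where
  "is_adversary k adv \<longleftrightarrow> (\<forall>t c. adv t c < k)"

(* The configuration after t rounds; round t + 1 starts from it. *)
primrec run :: "algorithm \<Rightarrow> node set \<Rightarrow> adversary \<Rightarrow> nat \<Rightarrow> config" where
  "run A T adv 0 = initial_config"
| "run A T adv (Suc t) = activate A T (adv t (run A T adv t)) (run A T adv t)"

(* The nodes visited in the first M rounds: a node counts as visited when a robot
   located at it is activated, not when a robot arrives. *)
definition visited :: "algorithm \<Rightarrow> node set \<Rightarrow> adversary \<Rightarrow> nat \<Rightarrow> node set" where
  "visited A T adv M = {pos (run A T adv t) (adv t (run A T adv t)) | t. t < M}"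

definition explores_in_at_most ::
  "nat \<Rightarrow> algorithm \<Rightarrow> node set \<Rightarrow> real \<Rightarrow> bool" where
  "explores_in_at_most k A T M \<longleftrightarrow>
     (\<forall>adv. is_adversary k adv \<longrightarrow> (\<exists>m. real m \<le> M \<and> T \<subseteq> visited A T adv m))"

end

(* One virtual searcher moves through the tree. A robot located at the searcher's node takes an
   untaken edge there and explores depth first on its own, using only new edges downwards, until
   it is back on the searcher's path; a robot on the path follows the last departure recorded on
   each whiteboard and thus retraces the searcher. When the node of the searcher has no untaken
   edge, the searcher heads for a node below which another robot may still be exploring. Every
   downward move is therefore the first one along its edge or retraces a descent of the searcher,
   so n rounds need n <= 2 (number of edges + k * descents of the searcher).

   The descents of the searcher are kept below O(k 2^k D) as in deterministic layered graph
   traversal: the search tree, of at most k open leaves, is turned into a binary one in which a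
   branching has the value (a + b) / g of its subtrees, with g slightly above 2. The searcher
   leaves a subtree as soon as its value exceeds that of its sibling by a factor 1 + 1/k, and the
   excess pays for the way to the sibling. A subtree in which exploration is complete goes on
   growing in value, without any move, until it can be dropped without decreasing the total value.
   The value of the whole tree is at most D + 1, and each of its k levels of branchings costs a
   factor g.

   For the second bound, the robots form about log k groups. Each group simulates one robot, its
   members replaying the decisions of the foremost member from the whiteboards. *)

theory Submission
  imports Defs "HOL-Library.Sublist" "HOL-Library.Countable"
begin

section \<open>Counting downward moves, and the combinatorics of search trees\<close>

section \<open>Search trees\<close>

text \<open>Growth is discrete: one step multiplies a leaf by \<open>q\<close>, hence the value of
  any tree by at most \<open>q\<close>. Siblings are kept within a factor \<open>q\<close> wherever
  the searcher acts, so after one more step they are within \<open>q\<^sup>2\<close>. This tolerance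
  dictates \<open>g = 1 + q\<^sup>2\<close>: if \<open>val b \<le> q\<^sup>2 * val a\<close>, then
  \<open>(val a + val b) / g \<le> val a\<close>, so a fork with a dead side is worth at most its
  live side. The same inequality bounds the value by the depth and allows dead subtrees to be
  deleted. Compared with the ideal divisor 2 the loss is \<open>(g / 2) ^ k\<close>, which stays
  below e because \<open>q = 1 + 1 / k\<close>. On the side of the robots the obstacle is
  asynchrony: nobody can see whether a robot below an edge has stopped or has finished there.
  Liveness is therefore read off the recorded departures, which may list too many edges, and the
  search tree is changed only by the robot acting for the searcher at its node. Only descents have
  to be paid for, since every ascent undoes an earlier descent; hence the one-sided distance
  below.\<close>

fun descent :: "'a list \<Rightarrow> 'a list \<Rightarrow> nat" where
  "descent [] ys = length ys"
| "descent (x # xs) [] = 0"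
| "descent (x # xs) (y # ys) = (if x = y then descent xs ys else Suc (length ys))"

lemma descent_le_length: "descent xs ys \<le> length ys"
  by (induction xs ys rule: descent.induct) auto

lemma descent_refl [simp]: "descent xs xs = 0"
  by (induction xs) auto

lemma length_le_descent: "length ys \<le> length xs + descent xs ys"
  by (induction xs ys rule: descent.induct) auto

text \<open>Every edge descended on the direct way has to be descended on a detour as well. Thus
  \<open>descent\<close> is a distance for which climbing is free.\<close>

lemma descent_triangle: "descent xs zs \<le> descent xs ys + descent ys zs"
proof (induction xs zs arbitrary: ys rule: descent.induct)
  case (1 zs)
  then show ?case
    by (induction ys zs rule: descent.induct) auto
next
  case (2 x xs)
  then show ?case by simp
next
  case (3 x xs z zs)
  show ?case
  proof (cases ys)
    case Nil
    then show ?thesis using descent_le_length[of "x # xs" "z # zs"] by simp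
  next
    case (Cons y ys')
    then show ?thesis using 3[of ys'] descent_le_length[of xs zs] descent_le_length[of xs ys']
      descent_le_length[of ys' zs] length_le_descent[of zs ys']
      by auto
  qed
qed

lemma descent_common_prefix:
  assumes "prefix u xs" "prefix u ys"
  shows "descent xs ys \<le> length ys - length u"
proof -
  have "descent (u @ a) (u @ b) \<le> length b" for a b
    by (induction u) (auto simp: descent_le_length)
  then show ?thesis using assms by (auto simp: prefix_def)
qed

lemma descent_prefix: "prefix xs ys \<Longrightarrow> descent xs ys = length ys - length xs"
  by (induction xs ys rule: descent.induct) auto

text \<open>The removed entry lies beyond the common prefix: climbing towards a node outside the own
  subtree costs nothing and leaves the remaining way unchanged.\<close>

lemma descent_butlast:
  assumes "\<not> prefix xs ys"
  shows "descent (butlast xs) ys = descent xs ys"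
  using assms by (induction xs ys rule: descent.induct) (auto split: if_splits)

(* Leaf l j is an open edge into l of which the fraction q powi j counts as searched, Edge c t
   stands for the node c and its searched edge, and Branch forks without an edge. The searcher
   heads for the leftmost leaf; the spine is the path to it. *)
datatype vtree = Leaf node int | Edge node vtree | Branch vtree vtree

instance vtree :: countable
  by countable_datatype

fun labels :: "vtree \<Rightarrow> node set" where
  "labels (Leaf l j) = {l}"
| "labels (Edge c t) = labels t"
| "labels (Branch a b) = labels a \<union> labels b"

fun target :: "vtree \<Rightarrow> node" where
  "target (Leaf l j) = l"
| "target (Edge c t) = target t"
| "target (Branch a b) = target a"

fun level :: "vtree \<Rightarrow> int" where
  "level (Leaf l j) = j"
| "level (Edge c t) = level t"
| "level (Branch a b) = level a"

text \<open>The parameter \<open>n\<close> is the length required of the next nodes below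
  \<open>u\<close>. A \<open>Branch\<close> contains no edge and therefore does not increase
  it.\<close>

fun located :: "nat \<Rightarrow> node \<Rightarrow> vtree \<Rightarrow> bool" where
  "located n u (Leaf l j) \<longleftrightarrow> prefix u l \<and> length l = n"
| "located n u (Edge c t) \<longleftrightarrow> prefix u c \<and> length c = n \<and> located (Suc n) c t"
| "located n u (Branch a b) \<longleftrightarrow> located n u a \<and> located n u b"

text \<open>The position that the potential charges for. From level 0 on, the edge into the leaf
  counts as traversed; at a negative level the position is still its upper end.\<close>

fun vpos :: "node \<Rightarrow> vtree \<Rightarrow> node" where
  "vpos u (Leaf l j) = (if j \<ge> 0 then l else u)"
| "vpos u (Edge c t) = vpos c t"
| "vpos u (Branch a b) = vpos u a"

fun vdepth :: "vtree \<Rightarrow> nat" where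
  "vdepth (Leaf l j) = (if j \<ge> 0 then 1 else 0)"
| "vdepth (Edge c t) = Suc (vdepth t)"
| "vdepth (Branch a b) = vdepth a"

fun separated :: "vtree \<Rightarrow> bool" where
  "separated (Leaf l j) \<longleftrightarrow> True"
| "separated (Edge c t) \<longleftrightarrow> separated t"
| "separated (Branch a b) \<longleftrightarrow> separated a \<and> separated b \<and>
     (\<forall>x \<in> labels a. \<forall>y \<in> labels b. \<not> prefix x y \<and> \<not> prefix y x)"

fun forks :: "vtree \<Rightarrow> nat" where
  "forks (Leaf l j) = 0"
| "forks (Edge c t) = forks t"
| "forks (Branch a b) = Suc (max (forks a) (forks b))"

fun spine_forks :: "vtree \<Rightarrow> nat" where
  "spine_forks (Leaf l j) = 0"
| "spine_forks (Edge c t) = spine_forks t"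
| "spine_forks (Branch a b) = Suc (spine_forks a)"

text \<open>A live leaf is worth at most one full edge, \<open>q powi 0 = 1\<close>. Leaves that are
  not live may rise above that.\<close>

fun capped :: "(node \<Rightarrow> bool) \<Rightarrow> vtree \<Rightarrow> bool" where
  "capped P (Leaf l j) \<longleftrightarrow> (P l \<longrightarrow> j \<le> 0)"
| "capped P (Edge c t) \<longleftrightarrow> capped P t"
| "capped P (Branch a b) \<longleftrightarrow> capped P a \<and> capped P b"

fun spine_alive :: "(node \<Rightarrow> bool) \<Rightarrow> vtree \<Rightarrow> bool" where
  "spine_alive P (Leaf l j) \<longleftrightarrow> True"
| "spine_alive P (Edge c t) \<longleftrightarrow> spine_alive P t"
| "spine_alive P (Branch a b) \<longleftrightarrow> spine_alive P a \<and> (\<exists>l \<in> labels b. P l)"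

fun tick :: "vtree \<Rightarrow> vtree" where
  "tick (Leaf l j) = Leaf l (j + 1)"
| "tick (Edge c t) = Edge c (tick t)"
| "tick (Branch a b) = Branch (tick a) b"

fun grow :: "vtree \<Rightarrow> vtree \<Rightarrow> vtree" where
  "grow s (Leaf l j) = Edge l s"
| "grow s (Edge c t) = Edge c (grow s t)"
| "grow s (Branch a b) = Branch (grow s a) b"

(* Bounds the number of ticks and prunings, once no level exceeds B. *)
fun room :: "nat \<Rightarrow> vtree \<Rightarrow> nat" where
  "room B (Leaf l j) = Suc (nat (int B - j))"
| "room B (Edge c t) = room B t"
| "room B (Branch a b) = room B a + room B b"

lemma target_in_labels [simp]: "target t \<in> labels t"
  by (induction t) auto

lemma finite_labels [simp]: "finite (labels t)"
  by (induction t) auto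

lemma vpos_prefix: "located n u t \<Longrightarrow> prefix u (vpos u t)"
  by (induction t arbitrary: n u) (auto intro: prefix_order.trans)

lemma length_vpos: "located n u t \<Longrightarrow> n \<le> Suc (length u) \<Longrightarrow> length (vpos u t) \<le> length u + vdepth t"
  by (induction t arbitrary: n u) force+

lemma vpos_eq_target: "level t \<ge> 0 \<Longrightarrow> vpos u t = target t"
  by (induction t arbitrary: u) auto

lemma room_pos: "room B t > 0"
  by (induction t) auto

lemma labels_tick [simp]: "labels (tick t) = labels t"
  by (induction t) auto

lemma located_tick [simp]: "located n u (tick t) = located n u t"
  by (induction t arbitrary: n u) auto

lemma separated_tick [simp]: "separated (tick t) = separated t"
  by (induction t) auto

lemma forks_tick [simp]: "forks (tick t) = forks t"
  by (induction t) auto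

lemma capped_tick: "capped P t \<Longrightarrow> \<not> P (target t) \<or> level t < 0 \<Longrightarrow> capped P (tick t)"
  by (induction t) auto

lemma capped_tick_dead: "capped P t \<Longrightarrow> \<forall>l \<in> labels t. \<not> P l \<Longrightarrow> capped P (tick t)"
  by (rule capped_tick) auto

lemma room_tick: "level t < int B \<Longrightarrow> room B (tick t) < room B t"
  by (induction t) auto

lemma labels_grow: "labels (grow s t) \<subseteq> labels s \<union> labels t"
  by (induction t) auto

lemma labels_grow_supset: "labels t \<union> labels s \<subseteq> insert (target t) (labels (grow s t))"
  by (induction t) auto

lemma target_notin_grow:
  assumes "separated t" "target t \<notin> labels s"
  shows "target t \<notin> labels (grow s t)"
  using assms
proof (induction t)
  case (Branch a b)
  then have "target a \<notin> labels b"
    using target_in_labels[of a] by (metis prefix_order.refl separated.simps(3))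
  then show ?case using Branch by auto
qed auto

lemma located_grow: "located n u t \<Longrightarrow> located (Suc (length (target t))) (target t) s \<Longrightarrow> located n u (grow s t)"
  by (induction t arbitrary: n u) auto

lemma separated_grow:
  assumes "separated t" "separated s" "\<And>x. x \<in> labels s \<Longrightarrow> strict_prefix (target t) x \<and> length x = Suc (length (target t))"
  shows "separated (grow s t)"
  using assms
proof (induction t)
  case (Branch a b)
  have IH: "separated (grow s a)" using Branch by simp
  have "\<not> prefix x y \<and> \<not> prefix y x" if "x \<in> labels (grow s a)" "y \<in> labels b" for x y
  proof (cases "x \<in> labels a")
    case True
    then show ?thesis using Branch.prems that by auto
  next
    case False
    then have x: "x \<in> labels s" using that labels_grow by blast
    have sp: "strict_prefix (target a) x" "length x = Suc (length (target a))"
      using Branch.prems(3)[OF x] by auto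
    have inc: "\<not> prefix (target a) y \<and> \<not> prefix y (target a)"
      using Branch.prems(1) that target_in_labels[of a] by auto
    have "\<not> prefix x y" using inc sp by (meson prefix_order.less_imp_le prefix_order.trans)
    moreover have "\<not> prefix y x"
    proof
      assume "prefix y x"
      moreover have "prefix (target a) x" using sp by (simp add: prefix_order.less_imp_le)
      ultimately show False using inc prefix_same_cases by blast
    qed
    ultimately show ?thesis by simp
  qed
  then show ?case using Branch IH by auto
qed auto

lemma forks_grow: "forks (grow s t) \<le> max (forks t) (spine_forks t + forks s)"
  by (induction t) auto

lemma capped_grow: "capped P t \<Longrightarrow> capped P s \<Longrightarrow> capped P (grow s t)"
  by (induction t) auto

lemma vpos_grow: "level t \<ge> 0 \<Longrightarrow> vpos (target t) s = target t \<Longrightarrow> vpos u (grow s t) = vpos u t"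
  by (induction t arbitrary: u) auto

text \<open>Each sibling of the spine contains a leaf above some \<open>h i\<close>. By separation
  these indices differ from sibling to sibling and from those in \<open>Q\<close>, which lie below
  the target. Through this count the number of robots bounds the number of nested forks.\<close>

lemma spine_forks_le_card:
  assumes "separated t" "spine_alive (\<lambda>l. \<exists>i \<in> I. prefix l (h i)) t" "finite I"
    and "Q \<subseteq> {i \<in> I. prefix (target t) (h i)}"
  shows "spine_forks t + card Q \<le> card {i \<in> I. \<exists>l \<in> labels t. prefix l (h i)}"
  using assms
proof (induction t)
  case (Leaf l j)
  then show ?case by (auto intro!: card_mono)
next
  case (Edge c t)
  then show ?case by auto
next
  case (Branch a b)
  let ?S = "\<lambda>t. {i \<in> I. \<exists>l \<in> labels t. prefix l (h i)}"
  have IH: "spine_forks a + card Q \<le> card (?S a)" using Branch by auto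
  obtain i where "i \<in> ?S b" using Branch.prems(2) by auto
  moreover have "finite (?S b)" using Branch.prems(3) by simp
  ultimately have "1 \<le> card (?S b)" by (metis One_nat_def Suc_leI card_gt_0_iff empty_iff)
  moreover have "?S a \<inter> ?S b = {}"
    using Branch.prems(1) by (auto dest: prefix_same_cases)
  moreover have "?S (Branch a b) = ?S a \<union> ?S b" by auto
  ultimately have "card (?S a) + 1 \<le> card (?S (Branch a b))"
    using Branch.prems(3) by (simp add: card_Un_disjoint)
  then show ?case using IH by simp
qed

section \<open>Values, balance, and the credit that pays for the moves\<close>

section \<open>The value of a search tree\<close>

locale balancing =
  fixes k :: nat
  assumes k_pos: "0 < k"
begin

definition q :: real where "q = 1 + 1 / real k"

definition g :: real where "g = 1 + q\<^sup>2"

text \<open>Chosen so that \<open>\<kappa> * (q - 1) = (g / 2) ^ k\<close>: the smallest excess that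
  triggers a change of sides, \<open>(q - 1) * val b\<close>, then yields
  \<open>(g / 2) ^ k * val b\<close>, an upper bound on the descent into \<open>b\<close>.\<close>

definition \<kappa> :: real where "\<kappa> = real k * (g / 2) ^ k"

text \<open>The price of one unit of value in a tree with \<open>m\<close> nested forks. The step
  that completes an edge gains \<open>(q - 1) / q\<close>, at least \<open>1 / (2 * k)\<close>, and
  has to pay one descent; this gives the start \<open>2 * k\<close>. A fork dilutes every gain by
  \<open>g\<close>, and \<open>\<kappa>\<close> of the proceeds is saved as credit.\<close>

primrec rate :: "nat \<Rightarrow> real" where
  "rate 0 = 2 * real k"
| "rate (Suc m) = g * (rate m + \<kappa>)"

fun val :: "vtree \<Rightarrow> real" where
  "val (Leaf l j) = q powi j"
| "val (Edge c t) = 1 + val t"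
| "val (Branch a b) = (val a + val b) / g"

text \<open>Savings are kept only for an excess of the spine side, because that is the side the
  searcher may have to leave.\<close>

fun credit :: "vtree \<Rightarrow> real" where
  "credit (Leaf l j) = 0"
| "credit (Edge c t) = credit t"
| "credit (Branch a b) = credit a + \<kappa> * max 0 (val a - val b)"

fun balanced :: "vtree \<Rightarrow> bool" where
  "balanced (Leaf l j) \<longleftrightarrow> True"
| "balanced (Edge c t) \<longleftrightarrow> balanced t"
| "balanced (Branch a b) \<longleftrightarrow> balanced a \<and> balanced b \<and>
     val a \<le> q\<^sup>2 * val b \<and> val b \<le> q\<^sup>2 * val a"

fun spine_balanced :: "vtree \<Rightarrow> bool" where
  "spine_balanced (Leaf l j) \<longleftrightarrow> True"
| "spine_balanced (Edge c t) \<longleftrightarrow> spine_balanced t"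
| "spine_balanced (Branch a b) \<longleftrightarrow> spine_balanced a \<and> val a \<le> q * val b"

fun norm_min :: "vtree \<Rightarrow> vtree" where
  "norm_min (Leaf l j) = Leaf l j"
| "norm_min (Edge c t) = Edge c (norm_min t)"
| "norm_min (Branch a b) =
     (if val a \<le> val b then Branch (norm_min a) b else Branch (norm_min b) a)"

text \<open>The change is made at the topmost fork of the spine that violates the factor
  \<open>q\<close>. Inside the sibling the spine is chosen afresh, taking the smaller side at each
  fork.\<close>

fun retarget :: "vtree \<Rightarrow> vtree" where
  "retarget (Leaf l j) = Leaf l j"
| "retarget (Edge c t) = Edge c (retarget t)"
| "retarget (Branch a b) =
     (if val a > q * val b then Branch (norm_min b) a else Branch (retarget a) b)"

(* b need not be balanced along its spine; norm_min makes it so before the tick. *)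
fun heal :: "(node \<Rightarrow> bool) \<Rightarrow> vtree \<Rightarrow> vtree" where
  "heal P (Leaf l j) = Leaf l j"
| "heal P (Edge c t) = Edge c (heal P t)"
| "heal P (Branch a b) =
     (if \<exists>l \<in> labels b. P l then Branch (heal P a) b
      else if val b \<ge> q * val a then a else Branch a (tick (norm_min b)))"

text \<open>At level \<open>- k * k\<close> a leaf is worth at most \<open>1 / k = q - 1\<close>, so
  attaching a fan to a leaf of value 1 multiplies its value by at most \<open>q\<close>, like any
  other step.\<close>

fun fan :: "node list \<Rightarrow> vtree" where
  "fan [] = undefined"
| "fan [l] = Leaf l (- int (k * k))"
| "fan (l # l' # ls) = Branch (fan (l' # ls)) (Leaf l (- int (k * k)))"

definition valid :: "(node \<Rightarrow> bool) \<Rightarrow> vtree \<Rightarrow> bool" where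
  "valid P t \<longleftrightarrow> balanced t \<and> located 0 [] t \<and> separated t \<and> forks t \<le> k \<and> capped P t"

lemma q_gt1: "1 < q"
  using k_pos by (simp add: q_def)

lemma q_pos: "0 < q"
  using q_gt1 by simp

lemma q_le2: "q \<le> 2"
  using k_pos by (simp add: q_def)

lemma q_le_sq: "q \<le> q\<^sup>2"
  using q_gt1 by (simp add: power2_eq_square)

lemma g_gt2: "2 < g"
  using q_gt1 q_le_sq by (simp add: g_def)

lemma g_pos: "0 < g"
  using g_gt2 by simp

lemma \<kappa>_pos: "0 < \<kappa>"
  using k_pos g_gt2 by (simp add: \<kappa>_def)

lemma rate_pos: "0 < rate m"
  using k_pos g_pos \<kappa>_pos by (induction m) (auto intro!: mult_pos_pos add_pos_pos)

lemma rate_Suc_ge: "rate m \<le> rate (Suc m)"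
proof -
  have "rate m \<le> rate m + \<kappa>" using \<kappa>_pos by simp
  also have "\<dots> \<le> g * (rate m + \<kappa>)"
    using mult_right_mono[of 1 g "rate m + \<kappa>"] g_gt2 rate_pos[of m] \<kappa>_pos by simp
  finally show ?thesis by simp
qed

lemma rate_mono: "m \<le> n \<Longrightarrow> rate m \<le> rate n"
  by (rule lift_Suc_mono_le[of rate]) (use rate_Suc_ge in auto)

lemma val_pos: "0 < val t"
  using q_pos g_pos by (induction t) (auto intro: add_pos_pos)

lemma credit_nonneg: "0 \<le> credit t"
  using \<kappa>_pos by (induction t) auto

lemma norm_min_simps [simp]:
  "val (norm_min t) = val t" "labels (norm_min t) = labels t"
  "located n u (norm_min t) = located n u t" "separated (norm_min t) = separated t"
  "forks (norm_min t) = forks t" "capped P (norm_min t) = capped P t"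
  "balanced (norm_min t) = balanced t" "credit (norm_min t) = 0"
  "room B (norm_min t) = room B t"
  by (induction t arbitrary: n u) (auto simp: add.commute)

lemma spine_balanced_norm_min: "spine_balanced (norm_min t)"
proof (induction t)
  case (Branch a b)
  have *: "x \<le> y \<Longrightarrow> 0 < y \<Longrightarrow> x \<le> q * y" for x y
    using q_gt1 by (smt (verit) mult_left_le_one_le mult_less_cancel_right1)
  show ?case using Branch *[of "val a" "val b"] *[of "val b" "val a"] val_pos by auto
qed auto

text \<open>The smaller sibling is at most half of the sum, that is \<open>g / 2\<close> times the
  value of the fork, and each traversed edge is matched by the 1 that it adds to the value. So a way
  that always takes the smaller side is short.\<close>

lemma vdepth_norm_min: "real (vdepth (norm_min t)) \<le> (g / 2) ^ forks t * val t"
proof (induction t)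
  case (Leaf l j)
  have "1 \<le> q powi j" if "j \<ge> 0"
    using that q_gt1 by (simp add: power_int_def one_le_power)
  then show ?case using q_pos by auto
next
  case (Edge c t)
  have "1 \<le> (g / 2) ^ forks t" using g_gt2 by (simp add: one_le_power)
  then show ?case using Edge by (simp add: algebra_simps)
next
  case (Branch a b)
  have *: "real n \<le> (g / 2) ^ forks (Branch a b) * val (Branch a b)"
    if "real n \<le> (g / 2) ^ f * x" "f \<le> max (forks a) (forks b)" "2 * x \<le> val a + val b" "0 < x"
    for n f x
  proof -
    have "real n \<le> (g / 2) ^ max (forks a) (forks b) * x"
      using that g_gt2 by (smt (verit) mult_right_mono power_increasing divide_le_eq_1_pos field_sum_of_halves)
    also have "\<dots> \<le> (g / 2) ^ max (forks a) (forks b) * ((val a + val b) / 2)"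
      using that g_gt2 by (intro mult_left_mono) auto
    also have "\<dots> = (g / 2) ^ forks (Branch a b) * val (Branch a b)"
      using g_pos by (simp add: field_simps)
    finally show ?thesis .
  qed
  show ?case
    using *[of "vdepth (norm_min a)" "forks a" "val a"] *[of "vdepth (norm_min b)" "forks b" "val b"]
      Branch val_pos[of a] val_pos[of b]
    by (cases "val a \<le> val b") (simp_all del: val.simps forks.simps)
qed

lemma retarget_simps [simp]:
  "val (retarget t) = val t" "labels (retarget t) = labels t"
  "located n u (retarget t) = located n u t" "separated (retarget t) = separated t"
  "forks (retarget t) = forks t" "capped P (retarget t) = capped P t"
  "balanced (retarget t) = balanced t" "room B (retarget t) = room B t"
  by (induction t arbitrary: n u) (auto simp: add.commute)

lemma spine_balanced_retarget: "spine_balanced (retarget t)"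
proof (induction t)
  case (Branch a b)
  have "val b \<le> q * val a" if "val a > q * val b"
    using that q_gt1 val_pos[of a] val_pos[of b]
    by (smt (verit) mult_less_cancel_right1)
  then show ?case using Branch spine_balanced_norm_min by auto
qed auto

lemma credit_retarget:
  assumes "located n u t" "n \<le> Suc (length u)" "forks t \<le> k"
  shows "credit (retarget t) + descent (vpos u t) (vpos u (retarget t)) \<le> credit t"
  using assms
proof (induction t arbitrary: n u)
  case (Branch a b)
  show ?case
  proof (cases "val a > q * val b")
    case True
    have loc: "located n u (norm_min b)" "located n u a" using Branch by auto
    \<comment> \<open>Both positions lie below \<open>u\<close>, and climbing back to
      \<open>u\<close> is free, so only the way down from \<open>u\<close> into the sibling is
      charged.\<close>
    have "descent (vpos u a) (vpos u (norm_min b)) \<le> length (vpos u (norm_min b)) - length u"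
      using loc by (intro descent_common_prefix vpos_prefix)
    also have "\<dots> \<le> vdepth (norm_min b)"
      using length_vpos[OF loc(1)] Branch by simp
    finally have "real (descent (vpos u a) (vpos u (norm_min b))) \<le> real (vdepth (norm_min b))"
      by simp
    also have "\<dots> \<le> (g / 2) ^ forks b * val b" by (rule vdepth_norm_min)
    also have "\<dots> \<le> (g / 2) ^ k * val b"
      using Branch.prems val_pos[of b] g_gt2 by (intro mult_right_mono power_increasing) auto
    also have "\<dots> = \<kappa> * ((q - 1) * val b)"
      using k_pos by (simp add: \<kappa>_def q_def)
    also have "\<dots> \<le> \<kappa> * (val a - val b)"
      using True \<kappa>_pos by (intro mult_left_mono) (auto simp: algebra_simps)
    finally have *: "real (descent (vpos u a) (vpos u (norm_min b))) \<le> \<kappa> * (val a - val b)" .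
    have "val b < val a" using True q_gt1 val_pos[of b] by (smt (verit) mult_less_cancel_right1)
    then show ?thesis using True * credit_nonneg[of a] by simp
  next
    case False
    then show ?thesis using Branch by auto
  qed
qed auto

lemma val_tick: "val t \<le> val (tick t)" "val (tick t) \<le> q * val t"
proof (induction t)
  case (Leaf l j)
  { case 1 show ?case using q_gt1 by (simp add: power_int_add) }
  { case 2 show ?case using q_gt1 by (simp add: power_int_add) }
next
  case (Edge c t)
  { case 1 show ?case using Edge by simp }
  { case 2 show ?case using Edge q_gt1 by (simp add: algebra_simps) }
next
  case (Branch a b)
  have "val b \<le> q * val b" using q_gt1 val_pos[of b] by simp
  { case 1 show ?case using Branch g_pos by (simp add: divide_right_mono) }
  { case 2 show ?case using Branch g_pos \<open>val b \<le> q * val b\<close>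
      by (simp add: divide_right_mono distrib_left) }
qed

text \<open>The factor \<open>g\<close> in the rate cancels the divisor \<open>g\<close> of the
  fork. What is left per unit gained by \<open>a\<close> is \<open>rate m\<close> for the costs
  \<open>d\<close> inside \<open>a\<close>, plus \<open>\<kappa>\<close> for the larger excess over
  \<open>b\<close>.\<close>

lemma credit_spine_step:
  assumes "val a \<le> val a'" "credit a' + d \<le> credit a + rate m * (val a' - val a)"
  shows "credit (Branch a' b) + d \<le> credit (Branch a b) + rate (Suc m) * (val (Branch a' b) - val (Branch a b))"
proof -
  have "\<kappa> * max 0 (val a' - val b) \<le> \<kappa> * max 0 (val a - val b) + \<kappa> * (val a' - val a)"
    using assms(1) \<kappa>_pos by (simp flip: distrib_left)
  moreover have "rate (Suc m) * (val (Branch a' b) - val (Branch a b)) = (rate m + \<kappa>) * (val a' - val a)"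
    using g_pos by (simp add: field_simps)
  ultimately show ?thesis using assms(2) by (simp add: algebra_simps)
qed

lemma credit_tick:
  assumes "forks t \<le> m" "located n u t" "n \<le> Suc (length u)"
  shows "credit (tick t) + descent (vpos u t) (vpos u (tick t)) \<le> credit t + rate m * (val (tick t) - val t)"
  using assms
proof (induction t arbitrary: m n u)
  case (Leaf l j)
  have v: "val (tick (Leaf l j)) - val (Leaf l j) = (q - 1) * q powi j"
    using q_pos by (simp add: power_int_add algebra_simps)
  \<comment> \<open>The position changes only in the step from level -1 to level 0, when it crosses
    the single edge from \<open>u\<close> to \<open>l\<close>.\<close>
  have d: "real (descent (vpos u (Leaf l j)) (vpos u (tick (Leaf l j)))) \<le> (if j = -1 then 1 else 0)"
    using Leaf.prems descent_prefix[of u l] by auto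
  have "(if j = -1 then 1 else 0) \<le> rate m * ((q - 1) * q powi j)"
  proof (cases "j = -1")
    case True
    have "1 = q / q" using q_pos by simp
    also have "\<dots> \<le> 2 / q" using q_le2 q_pos by (intro divide_right_mono) auto
    also have "\<dots> = rate 0 * ((q - 1) * q powi j)"
      using True k_pos by (simp add: q_def power_int_minus field_simps)
    also have "\<dots> \<le> rate m * ((q - 1) * q powi j)"
      using rate_mono[of 0 m] q_gt1 by (intro mult_right_mono) auto
    finally show ?thesis using True by simp
  next
    case False
    then show ?thesis using rate_pos[of m] q_gt1 by simp
  qed
  with v d show ?case by simp
next
  case (Edge c t)
  then show ?case by auto
next
  case (Branch a b)
  then obtain m' where m: "m = Suc m'" by (cases m) auto
  have "credit (tick a) + descent (vpos u a) (vpos u (tick a)) \<le> credit a + rate m' * (val (tick a) - val a)"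
    using Branch m by auto
  from credit_spine_step[OF val_tick(1) this] show ?case using m by simp
qed

lemma balanced_tick: "balanced t \<Longrightarrow> spine_balanced t \<Longrightarrow> balanced (tick t)"
proof (induction t)
  case (Branch a b)
  have "val (tick a) \<le> q * val a" by (rule val_tick)
  also have "\<dots> \<le> q * (q * val b)" using Branch q_pos by (intro mult_left_mono) auto
  finally have "val (tick a) \<le> q\<^sup>2 * val b" by (simp add: power2_eq_square mult.assoc)
  moreover have "q\<^sup>2 * val a \<le> q\<^sup>2 * val (tick a)" using val_tick(1) q_pos by (intro mult_left_mono) auto
  ultimately show ?case using Branch by auto
qed auto


text \<open>A dead side is deleted only once \<open>val b \<ge> q * val a\<close>. Balance then
  makes the new value at least the old one, and \<open>g * val a \<le> (q + q\<^sup>2) * val a \<le>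
  q * (val a + val b)\<close> limits the gain to a factor \<open>q\<close>, so from above a deletion
  looks like an ordinary step.\<close>

lemma val_heal: "balanced t \<Longrightarrow> val t \<le> val (heal P t) \<and> val (heal P t) \<le> q * val t"
proof (induction t)
  case (Leaf l j)
  then show ?case using q_gt1 q_pos by simp
next
  case (Edge c t)
  then show ?case using q_gt1 by (simp add: algebra_simps)
next
  case (Branch a b)
  have pos: "0 < val a" "0 < val b" by (rule val_pos)+
  then have le: "val a \<le> q * val a" "val b \<le> q * val b" using q_gt1 by auto
  consider "\<exists>l \<in> labels b. P l" | "\<not> (\<exists>l \<in> labels b. P l)" "val b \<ge> q * val a"
    | "\<not> (\<exists>l \<in> labels b. P l)" "val b < q * val a" by linarith
  then show ?case
  proof cases
    case 1
    then show ?thesis using Branch le g_pos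
      by (auto simp: distrib_left intro!: divide_right_mono add_mono)
  next
    case 2
    have "val b \<le> q\<^sup>2 * val a" using Branch by simp
    then have "val (Branch a b) \<le> val a"
      using g_pos by (simp add: g_def field_simps)
    moreover have "g * val a \<le> q * (val a + val b)"
    proof -
      have "g * val a \<le> (q + q\<^sup>2) * val a" using q_gt1 pos by (simp add: g_def)
      also have "\<dots> = q * (val a + q * val a)" by (simp add: algebra_simps power2_eq_square)
      also have "\<dots> \<le> q * (val a + val b)" using 2 q_pos by simp
      finally show ?thesis .
    qed
    then have "val a \<le> q * val (Branch a b)" using g_pos by (simp add: field_simps)
    ultimately show ?thesis using 2 by simp
  next
    case 3
    then show ?thesis using le g_pos val_tick[of "norm_min b"]
      by (auto simp: distrib_left intro!: divide_right_mono add_mono)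
  qed
qed

lemma vpos_heal [simp]: "vpos u (heal P t) = vpos u t"
  by (induction t arbitrary: u) auto

text \<open>Growth of a dead sibling only diminishes the excess of the spine side, and a deletion
  removes the savings at that fork; above the healed fork the gain in value pays.\<close>

lemma credit_heal:
  assumes "forks t \<le> m" "balanced t"
  shows "credit (heal P t) \<le> credit t + rate m * (val (heal P t) - val t)"
  using assms
proof (induction t arbitrary: m)
  case (Leaf l j)
  then show ?case by simp
next
  case (Edge c t)
  then show ?case by auto
next
  case (Branch a b)
  have nn: "0 \<le> rate m * (val (heal P (Branch a b)) - val (Branch a b))"
    using val_heal[OF Branch.prems(2), of P] rate_pos[of m] by simp
  consider "\<exists>l \<in> labels b. P l" | "\<not> (\<exists>l \<in> labels b. P l)" "val b \<ge> q * val a"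
    | "\<not> (\<exists>l \<in> labels b. P l)" "val b < q * val a" by linarith
  then show ?case
  proof cases
    case 1
    obtain m' where m: "m = Suc m'" using Branch.prems by (cases m) auto
    have "credit (heal P a) + real 0 \<le> credit a + rate m' * (val (heal P a) - val a)"
      using Branch m by auto
    from credit_spine_step[OF _ this] show ?thesis using m 1 val_heal[of a P] Branch.prems by simp
  next
    case 2
    then show ?thesis using nn \<kappa>_pos by (simp add: add_increasing)
  next
    case 3
    have "\<kappa> * max 0 (val a - val (tick (norm_min b))) \<le> \<kappa> * max 0 (val a - val b)"
      using val_tick(1)[of "norm_min b"] \<kappa>_pos by (intro mult_left_mono) auto
    then show ?thesis using nn 3 by simp
  qed
qed

lemma balanced_heal: "balanced t \<Longrightarrow> spine_balanced t \<Longrightarrow> balanced (heal P t)"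
proof (induction t)
  case (Branch a b)
  consider "\<exists>l \<in> labels b. P l" | "\<not> (\<exists>l \<in> labels b. P l)" "val b \<ge> q * val a"
    | "\<not> (\<exists>l \<in> labels b. P l)" "val b < q * val a" by linarith
  then show ?case
  proof cases
    case 1
    have "val (heal P a) \<le> q * val a" using val_heal[of a P] Branch by simp
    also have "\<dots> \<le> q * (q * val b)" using Branch q_pos by (intro mult_left_mono) auto
    finally have "val (heal P a) \<le> q\<^sup>2 * val b" by (simp add: power2_eq_square mult.assoc)
    moreover have "q\<^sup>2 * val a \<le> q\<^sup>2 * val (heal P a)"
      using val_heal[of a P] Branch q_pos by (intro mult_left_mono) auto
    ultimately show ?thesis using Branch 1 by auto
  next
    case 2
    then show ?thesis using Branch by simp
  next
    case 3
    let ?b = "tick (norm_min b)"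
    have "balanced ?b" using Branch by (intro balanced_tick) (auto simp: spine_balanced_norm_min)
    moreover have "val ?b \<le> q * (q * val a)"
      using 3 val_tick(2)[of "norm_min b"] q_pos by (smt (verit) mult_left_mono norm_min_simps(1))
    moreover have "q\<^sup>2 * val b \<le> q\<^sup>2 * val ?b"
      using val_tick(1)[of "norm_min b"] q_pos by (intro mult_left_mono) auto
    ultimately show ?thesis using Branch 3 by (auto simp: power2_eq_square mult.assoc)
  qed
qed auto

lemma labels_heal: "labels (heal P t) \<subseteq> labels t"
  by (induction t) auto

lemma live_labels_heal: "l \<in> labels t \<Longrightarrow> P l \<Longrightarrow> l \<in> labels (heal P t)"
  by (induction t) auto

lemma located_heal: "located n u t \<Longrightarrow> located n u (heal P t)"
  by (induction t arbitrary: n u) auto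

lemma separated_heal: "separated t \<Longrightarrow> separated (heal P t)"
proof (induction t)
  case (Branch a b)
  then show ?case using labels_heal[of P a] by (simp add: subset_iff)
qed auto

lemma forks_heal: "forks (heal P t) \<le> forks t"
  by (induction t) auto

lemma capped_heal: "capped P t \<Longrightarrow> capped P (heal P t)"
  by (induction t) (auto intro: capped_tick_dead)

text \<open>A fork divides by \<open>g\<close> and an edge only adds, so a bound on the value bounds
  the exponent of the target. Together with \<open>room\<close> this gives termination.\<close>

lemma level_bound: "q powi level t \<le> g ^ forks t * val t"
proof (induction t)
  case (Leaf l j)
  then show ?case by simp
next
  case (Edge c t)
  have "0 < g ^ forks t" using g_pos by simp
  then show ?case using Edge by (simp add: distrib_left)
next
  case (Branch a b)
  have "q powi level a \<le> g ^ max (forks a) (forks b) * (val a + val b)"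
    using Branch(1) g_gt2 val_pos[of a] val_pos[of b]
    by (elim order_trans) (intro mult_mono power_increasing, auto)
  then show ?case using g_pos by simp
qed

lemma val_branch_bound:
  "g ^ forks a * val a \<le> g ^ forks (Branch a b) * val (Branch a b)"
  "g ^ forks b * val b \<le> g ^ forks (Branch a b) * val (Branch a b)"
proof -
  have eq: "g ^ forks (Branch a b) * val (Branch a b) = g ^ max (forks a) (forks b) * (val a + val b)"
    using g_pos by simp
  show "g ^ forks a * val a \<le> g ^ forks (Branch a b) * val (Branch a b)"
    "g ^ forks b * val b \<le> g ^ forks (Branch a b) * val (Branch a b)"
    unfolding eq using g_gt2 val_pos[of a] val_pos[of b]
    by (intro mult_mono power_increasing; simp)+
qed

lemma level_less:
  assumes "g ^ forks t * val t < q ^ B"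
  shows "level t < int B"
proof (rule ccontr)
  assume "\<not> level t < int B"
  then have "q powi int B \<le> q powi level t" using q_gt1 by (intro power_int_increasing) auto
  then show False using level_bound[of t] assms by (simp add: power_int_def)
qed

text \<open>If the spine is not alive, \<open>heal\<close> reaches a fork with a dead sibling:
  deleting it frees its positive room, and otherwise the target of the sibling rises by one
  level.\<close>

lemma room_heal:
  assumes "\<not> spine_alive P t" "g ^ forks t * val t < q ^ B"
  shows "room B (heal P t) < room B t"
  using assms
proof (induction t)
  case (Edge c t)
  have "0 < g ^ forks t" using g_pos by simp
  then show ?case using Edge by (simp add: distrib_left)
next
  case (Branch a b)
  have lt: "g ^ forks a * val a < q ^ B" "g ^ forks b * val b < q ^ B"
    using val_branch_bound[where a = a and b = b] Branch.prems(2) by linarith+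
  have "level (norm_min b) < int B" using level_less[of "norm_min b"] lt by simp
  then have "room B (tick (norm_min b)) < room B b" using room_tick[of "norm_min b" B] by simp
  then show ?case using Branch lt room_pos[of B b] by auto
qed auto

text \<open>Here \<open>n\<close> is the length at which the subtree starts. If both sides of a fork
  are live, dividing by \<open>g > 2\<close> yields less than the larger one; if only
  \<open>a\<close> is, balance gives \<open>val a + val b \<le> g * val a\<close>. Hence the levels
  of dead leaves do no harm, and a live leaf contributes at most 1 for its edge.\<close>

lemma val_le_depth:
  assumes "balanced t" "located n u t" "capped P t" "\<exists>l \<in> labels t. P l"
    and "\<forall>l \<in> labels t. P l \<longrightarrow> length l \<le> D"
  shows "val t + real n \<le> real D + 1"
  using assms
proof (induction t arbitrary: n u)
  case (Leaf l j)
  have "q powi j \<le> q powi 0" using Leaf q_gt1 by (intro power_int_increasing) auto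
  then show ?case using Leaf by auto
next
  case (Edge c t)
  then have "val t + real (Suc n) \<le> real D + 1" by (intro Edge.IH[of "Suc n" c]) auto
  then show ?case by simp
next
  case (Branch a b)
  have IH: "\<exists>l \<in> labels a. P l \<Longrightarrow> val a + real n \<le> real D + 1"
    "\<exists>l \<in> labels b. P l \<Longrightarrow> val b + real n \<le> real D + 1"
    using Branch.prems by (auto intro!: Branch.IH(1)[of n u] Branch.IH(2)[of n u])
  let ?X = "real D + 1 - real n"
  consider (both) "\<exists>l \<in> labels a. P l" "\<exists>l \<in> labels b. P l"
    | (left) "\<exists>l \<in> labels a. P l" "\<not> (\<exists>l \<in> labels b. P l)"
    | (right) "\<not> (\<exists>l \<in> labels a. P l)" "\<exists>l \<in> labels b. P l"
    using Branch.prems by auto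
  then have "val a + val b \<le> g * ?X"
  proof cases
    case both
    then have "val a \<le> ?X" "val b \<le> ?X" using IH by auto
    then have "val a + val b \<le> 2 * ?X" by simp
    also have "2 * ?X \<le> g * ?X"
      using \<open>val a \<le> ?X\<close> val_pos[of a] g_gt2 by (intro mult_right_mono) auto
    finally show ?thesis .
  next
    case left
    then have "val a \<le> ?X" using IH by simp
    moreover have "val a + val b \<le> g * val a" using Branch by (simp add: g_def algebra_simps)
    ultimately show ?thesis using g_pos by (smt (verit) mult_left_mono)
  next
    case right
    then have "val b \<le> ?X" using IH by simp
    moreover have "val a + val b \<le> g * val b" using Branch by (simp add: g_def algebra_simps)
    ultimately show ?thesis using g_pos by (smt (verit) mult_left_mono)
  qed
  then show ?case using g_pos by (simp add: field_simps)
qed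

section \<open>Settling: where the searcher may go next\<close>

definition settled :: "(node \<Rightarrow> bool) \<Rightarrow> vtree \<Rightarrow> bool" where
  "settled P t \<longleftrightarrow> spine_balanced t \<and> spine_alive P t \<and> P (target t) \<and> level t = 0"

definition paid :: "vtree \<Rightarrow> vtree \<Rightarrow> bool" where
  "paid t t' \<longleftrightarrow>
     credit t' + descent (vpos [] t) (vpos [] t') \<le> credit t + rate k * (val t' - val t)"

lemma paid_trans: "paid t t' \<Longrightarrow> paid t' t'' \<Longrightarrow> paid t t''"
  using descent_triangle[of "vpos [] t" "vpos [] t''" "vpos [] t'"]
  unfolding paid_def by (simp add: algebra_simps)

lemma valid_retarget: "valid P t \<Longrightarrow> valid P (retarget t)"
  by (simp add: valid_def)

lemma paid_retarget: "valid P t \<Longrightarrow> paid t (retarget t)"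
  unfolding valid_def paid_def using credit_retarget[of 0 "[]" t] by simp

lemma capped_level: "capped P t \<Longrightarrow> P (target t) \<Longrightarrow> level t \<le> 0"
  by (induction t) auto

text \<open>A dead target or an incomplete edge to it is raised by one level. Otherwise the cap
  forces level 0, so the only remaining defect is a dead sibling along the spine, which is healed.
  Either way live leaves survive and \<open>room\<close> decreases.\<close>

lemma settle_step:
  assumes v: "valid P t" and s: "spine_balanced t" "\<not> settled P t"
    and B: "g ^ forks t * val t < q ^ B"
  obtains t' where "valid P t'" "room B t' < room B t" "paid t t'" "labels t' \<subseteq> labels t"
    "\<And>l. l \<in> labels t \<Longrightarrow> P l \<Longrightarrow> l \<in> labels t'"
proof (cases "\<not> P (target t) \<or> level t < 0")
  case True
  have "valid P (tick t)"
    using v s True by (auto simp: valid_def intro: balanced_tick capped_tick)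
  moreover have "room B (tick t) < room B t" using level_less[OF B] by (rule room_tick)
  moreover have "paid t (tick t)"
    using v credit_tick[of t k 0 "[]"] by (simp add: valid_def paid_def)
  ultimately show ?thesis using that by simp
next
  case False
  then have "level t = 0" using capped_level[of P t] v by (simp add: valid_def)
  then have na: "\<not> spine_alive P t" using False s by (simp add: settled_def)
  have "valid P (heal P t)"
    using v s forks_heal[of P t]
    by (auto simp: valid_def intro: balanced_heal located_heal separated_heal capped_heal)
  moreover have "paid t (heal P t)"
    using v credit_heal[of t k P] by (simp add: valid_def paid_def)
  ultimately show ?thesis
    using that room_heal[OF na B] labels_heal live_labels_heal by metis
qed

lemma settle:
  assumes "valid P t" "\<exists>l \<in> labels t. P l" "\<forall>l \<in> labels t. P l \<longrightarrow> length l \<le> D"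
  shows "\<exists>t'. valid P t' \<and> settled P t' \<and> paid t t' \<and> labels t' \<subseteq> labels t \<and>
    (\<forall>l \<in> labels t. P l \<longrightarrow> l \<in> labels t')"
proof -
  \<comment> \<open>The value never exceeds \<open>D + 1\<close> and there are at most
    \<open>k\<close> nested forks, so no target can reach level \<open>B\<close>.\<close>
  obtain B where B: "g ^ k * (real D + 1) < q ^ B"
    using real_arch_pow[OF q_gt1] by blast
  show ?thesis using assms
  proof (induction "room B t" arbitrary: t rule: less_induct)
    case less
    let ?t = "retarget t"
    have vr: "valid P ?t" "paid t ?t" using less.prems valid_retarget paid_retarget by auto
    show ?case
    proof (cases "settled P ?t")
      case True
      then show ?thesis using vr by (intro exI[of _ ?t]) auto
    next
      case False
      have "val ?t + real 0 \<le> real D + 1"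
        using vr less.prems by (intro val_le_depth[where P = P and u = "[]"]) (auto simp: valid_def)
      then have "g ^ forks ?t * val ?t \<le> g ^ k * (real D + 1)"
        using vr g_gt2 val_pos[of ?t] by (intro mult_mono power_increasing) (auto simp: valid_def)
      then have B': "g ^ forks ?t * val ?t < q ^ B" using B by linarith
      obtain t' where t': "valid P t'" "room B t' < room B ?t" "paid ?t t'" "labels t' \<subseteq> labels ?t"
        "\<And>l. l \<in> labels ?t \<Longrightarrow> P l \<Longrightarrow> l \<in> labels t'"
        using settle_step[OF vr(1) spine_balanced_retarget False B'] by blast
      have "\<exists>l \<in> labels t'. P l" "\<forall>l \<in> labels t'. P l \<longrightarrow> length l \<le> D"
        using less.prems t' by auto
      then obtain t'' where "valid P t''" "settled P t''" "paid t' t''" "labels t'' \<subseteq> labels t'"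
        "\<forall>l \<in> labels t'. P l \<longrightarrow> l \<in> labels t''"
        using less.hyps[of t'] t' by auto
      moreover have "paid t t''" using paid_trans vr t' \<open>paid t' t''\<close> by blast
      ultimately show ?thesis using t' by (intro exI[of _ t'']) auto
    qed
  qed
qed

section \<open>Splitting the target into the open edges below it\<close>

lemma q_power_ge: "real k \<le> q ^ (k * k)"
proof -
  have "1 + real (k * k) * (1 / real k) \<le> (1 + 1 / real k) ^ (k * k)"
    by (rule Bernoulli_inequality, rule order_trans[of _ 0]) auto
  moreover have "real (k * k) * (1 / real k) = real k" using k_pos by simp
  ultimately show ?thesis by (simp add: q_def)
qed

text \<open>With \<open>x\<close> the value of one leaf, the bounds \<open>x / q\<^sup>2\<close> and
  \<open>x\<close> on the value of a comb are both preserved when it is joined with another leaf of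
  value \<open>x\<close> and the sum is divided by \<open>g\<close>. They give the balance of every
  fork.\<close>

lemma fan_simps:
  assumes "ls \<noteq> []" "distinct ls" "\<And>l. l \<in> set ls \<Longrightarrow> prefix u l \<and> length l = n"
  shows "labels (fan ls) = set ls \<and> credit (fan ls) = 0 \<and> balanced (fan ls) \<and> located n u (fan ls) \<and>
    separated (fan ls) \<and> forks (fan ls) = length ls - 1 \<and> capped P (fan ls) \<and> vpos u (fan ls) = u \<and>
    val (fan ls) \<le> q powi (- int (k * k)) \<and> q powi (- int (k * k)) \<le> q\<^sup>2 * val (fan ls)"
  using assms
proof (induction ls rule: fan.induct)
  case 1
  then show ?case by simp
next
  case (2 l)
  \<comment> \<open>The level is strictly negative, so attaching a fan does not move the virtual
    position.\<close>
  have "\<not> 0 \<le> - int (k * k)" using k_pos by (simp del: of_nat_mult)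
  moreover have "1 * q powi (- int (k * k)) \<le> q\<^sup>2 * q powi (- int (k * k))"
    using q_gt1 q_pos by (intro mult_right_mono) auto
  ultimately show ?case using 2 by (simp del: of_nat_mult)
next
  case (3 l l' ls)
  let ?x = "q powi (- int (k * k))" and ?f = "fan (l' # ls)"
  have x: "0 < ?x" using q_pos by simp
  have IH: "labels ?f = set (l' # ls)" "credit ?f = 0" "balanced ?f" "located n u ?f"
    "separated ?f" "forks ?f = length (l' # ls) - 1" "capped P ?f" "vpos u ?f = u"
    "val ?f \<le> ?x" "?x \<le> q\<^sup>2 * val ?f"
    using 3 by (auto simp del: fan.simps)
  have ub: "?x + val ?f \<le> g * ?x"
    using IH(9) mult_right_mono[of 2 g ?x] g_gt2 x by linarith
  have lb: "g * ?x \<le> q\<^sup>2 * (?x + val ?f)"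
    using IH(10) by (simp add: g_def algebra_simps)
  have inc: "\<not> prefix x l \<and> \<not> prefix l x" if "x \<in> set (l' # ls)" for x
  proof -
    have "length x = length l" "x \<noteq> l" using 3 that by auto
    then show ?thesis by (metis prefix_order.le_less prefix_length_less less_irrefl)
  qed
  have "1 \<le> q\<^sup>2" using q_gt1 by simp
  then have "val ?f \<le> q\<^sup>2 * ?x" using IH(9) mult_right_mono[of 1 "q\<^sup>2" ?x] x by linarith
  moreover have "(val ?f + ?x) / g \<le> ?x" using ub g_pos by (simp add: field_simps)
  moreover have "?x \<le> q\<^sup>2 * ((val ?f + ?x) / g)" using lb g_pos by (simp add: field_simps)
  ultimately show ?case using IH inc 3 by auto
qed

text \<open>The target has value \<open>q powi 0 = 1\<close>, and it is replaced by a tree of value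
  \<open>1 + val s\<close>, at most \<open>q\<close>.\<close>

lemma val_grow:
  assumes "level t = 0" "val s \<le> q - 1"
  shows "val t \<le> val (grow s t)" "val (grow s t) \<le> q * val t"
proof -
  have "val t \<le> val (grow s t) \<and> val (grow s t) \<le> q * val t" using assms
  proof (induction t)
    case (Leaf l j)
    then show ?case using val_pos[of s] by simp
  next
    case (Edge c t)
    then show ?case using q_gt1 by (simp add: algebra_simps)
  next
    case (Branch a b)
    have "val b \<le> q * val b" using q_gt1 val_pos[of b] by simp
    then show ?case using Branch g_pos by (simp add: divide_right_mono distrib_left)
  qed
  then show "val t \<le> val (grow s t)" "val (grow s t) \<le> q * val t" by auto
qed

lemma balanced_grow:
  assumes "balanced t" "spine_balanced t" "balanced s" "level t = 0" "val s \<le> q - 1"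
  shows "balanced (grow s t)"
  using assms
proof (induction t)
  case (Branch a b)
  have "val (grow s a) \<le> q * val a" using Branch by (intro val_grow) auto
  also have "\<dots> \<le> q * (q * val b)" using Branch q_pos by (intro mult_left_mono) auto
  finally have "val (grow s a) \<le> q\<^sup>2 * val b" by (simp add: power2_eq_square mult.assoc)
  moreover have "q\<^sup>2 * val a \<le> q\<^sup>2 * val (grow s a)"
    using val_grow(1)[of a s] Branch q_pos by (intro mult_left_mono) auto
  ultimately show ?case using Branch by auto
qed auto

lemma credit_grow:
  assumes "forks t \<le> m" "level t = 0" "val s \<le> q - 1" "credit s = 0"
  shows "credit (grow s t) \<le> credit t + rate m * (val (grow s t) - val t)"
  using assms
proof (induction t arbitrary: m)
  case (Leaf l j)
  then show ?case using rate_pos[of m] val_pos[of s] by simp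
next
  case (Edge c t)
  then show ?case by auto
next
  case (Branch a b)
  then obtain m' where m: "m = Suc m'" by (cases m) auto
  have "credit (grow s a) + real 0 \<le> credit a + rate m' * (val (grow s a) - val a)"
    using Branch m by auto
  from credit_spine_step[OF _ this] show ?case using m val_grow(1)[of a s] Branch by simp
qed


section \<open>Replanning at a node without untaken edges\<close>

definition alive :: "node set \<Rightarrow> node \<Rightarrow> bool" where
  "alive C l \<longleftrightarrow> (\<exists>c \<in> C. prefix l c)"

text \<open>A specification instead of a function, because the robots pick any witness by choice.
  The condition \<open>target t' \<noteq> v\<close> ensures that the searcher moves. The
  alternatives for the labels say that at most the leaf \<open>v\<close> is replaced, namely by open
  edges below it.\<close>

definition replan :: "node \<Rightarrow> node set \<Rightarrow> vtree \<Rightarrow> vtree \<Rightarrow> bool" where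
  "replan v C t t' \<longleftrightarrow>
     valid (alive C) t' \<and> alive C (target t') \<and> level t' = 0 \<and> target t' \<noteq> v \<and> paid t t' \<and>
     (labels t' \<subseteq> labels t \<or> v \<in> labels t \<and> labels t' \<subseteq> labels t - {v} \<union> {c \<in> C. prefix v c}) \<and>
     (\<forall>c \<in> C. \<exists>l \<in> labels t'. prefix l c)"

lemma settle_open:
  assumes "valid (alive C) t" "finite C" "C \<noteq> {}" "\<forall>c \<in> C. \<exists>l \<in> labels t. prefix l c"
  shows "\<exists>t'. valid (alive C) t' \<and> settled (alive C) t' \<and> paid t t' \<and> labels t' \<subseteq> labels t \<and>
    (\<forall>c \<in> C. \<exists>l \<in> labels t'. prefix l c)"
proof -
  have "\<exists>l \<in> labels t. alive C l" using assms(3,4) by (auto simp: alive_def)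
  moreover have "\<forall>l \<in> labels t. alive C l \<longrightarrow> length l \<le> Max (length ` C)"
    using assms(2) by (auto simp: alive_def dest!: prefix_length_le intro: order_trans Max_ge)
  ultimately obtain t' where t': "valid (alive C) t'" "settled (alive C) t'" "paid t t'"
    "labels t' \<subseteq> labels t" "\<forall>l \<in> labels t. alive C l \<longrightarrow> l \<in> labels t'"
    using settle[OF assms(1)] by blast
  have "\<exists>l \<in> labels t'. prefix l c" if "c \<in> C" for c
    using t'(5) assms(4) that unfolding alive_def by meson
  then show ?thesis using t' by blast
qed

text \<open>If settling selects \<open>v\<close> itself, its leaf is split into a fan of the open
  edges below it and the tree is settled again. Afterwards \<open>v\<close> is no label any more, so
  a second selection of \<open>v\<close> is impossible.\<close>

lemma replan_exists:
  assumes t: "valid (alive C) t" and C: "finite C" "card C \<le> k" "C \<noteq> {}"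
    and cover: "\<forall>c \<in> C. \<exists>l \<in> labels t. prefix l c"
    and child: "\<And>c. v \<in> labels t \<Longrightarrow> c \<in> C \<Longrightarrow> prefix v c \<Longrightarrow> length c = Suc (length v)"
  shows "\<exists>t'. replan v C t t'"
proof -
  obtain t1 where t1: "valid (alive C) t1" "settled (alive C) t1" "paid t t1" "labels t1 \<subseteq> labels t"
    "\<forall>c \<in> C. \<exists>l \<in> labels t1. prefix l c"
    using settle_open[OF t C(1,3) cover] by blast
  show ?thesis
  proof (cases "target t1 = v")
    case False
    then show ?thesis using t1 by (intro exI[of _ t1]) (auto simp: replan_def settled_def)
  next
    case True
    define Q where "Q = {c \<in> C. prefix v c}"
    have vt: "v \<in> labels t" using True t1(4) target_in_labels[of t1] by blast
    have Q: "prefix v c \<and> length c = Suc (length v)" if "c \<in> Q" for c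
      using that child[OF vt] by (auto simp: Q_def)
    obtain ls where ls: "set ls = Q" "distinct ls"
      using finite_distinct_list[of Q] C(1) by (auto simp: Q_def)
    have "Q \<noteq> {}" using t1(2) True by (auto simp: settled_def alive_def Q_def)
    then have "ls \<noteq> []" using ls by auto
    define s where "s = fan ls"
    have s: "labels s = Q" "credit s = 0" "balanced s" "located (Suc (length v)) v s" "separated s"
      "forks s = length ls - 1" "capped (alive C) s" "vpos v s = v" "val s \<le> q powi (- int (k * k))"
      using fan_simps[OF \<open>ls \<noteq> []\<close> ls(2), of v "Suc (length v)" "alive C"] Q ls(1)
      unfolding s_def by auto
    have "1 / q ^ (k * k) \<le> 1 / real k"
      using q_power_ge k_pos by (intro divide_left_mono) (auto simp: q_pos)
    moreover have "q powi (- int n) = 1 / q ^ n" for n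
      by (simp add: power_int_minus divide_inverse)
    ultimately have s_small: "val s \<le> q - 1" using s(9) by (simp add: q_def del: of_nat_mult)
    define t2 where "t2 = grow s t1"
    have lev: "level t1 = 0" and sb: "spine_balanced t1" "spine_alive (alive C) t1"
      using t1(2) by (auto simp: settled_def)
    note v1 = t1(1)[unfolded valid_def]
    \<comment> \<open>The siblings of the live spine use up elements of \<open>C\<close> outside
      \<open>Q\<close>, so the fan with its \<open>card Q - 1\<close> forks still fits below the
      spine without exceeding \<open>k\<close> nested forks.\<close>
    have "spine_forks t1 + card Q \<le> card {c \<in> C. \<exists>l \<in> labels t1. prefix l (id c)}"
      using v1 sb C(1) True by (intro spine_forks_le_card) (auto simp: alive_def[abs_def] Q_def)
    also have "\<dots> \<le> card C" using C(1) by (intro card_mono) auto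
    finally have "spine_forks t1 + length ls \<le> k" using C(2) ls distinct_card[of ls] by simp
    then have forks2: "forks t2 \<le> k"
      using forks_grow[of s t1] v1 s(6) unfolding t2_def by linarith
    have len: "strict_prefix v x \<and> length x = Suc (length v)" if "x \<in> Q" for x
      using Q[OF that] by (metis n_not_Suc_n prefix_order.le_less)
    have "balanced t2" unfolding t2_def
      using v1 sb s lev s_small by (intro balanced_grow) auto
    moreover have "located 0 [] t2" unfolding t2_def
      using v1 s True by (intro located_grow) auto
    moreover have "separated t2" unfolding t2_def
      using v1 s True len by (intro separated_grow) auto
    moreover have "capped (alive C) t2" unfolding t2_def
      using v1 s by (intro capped_grow) auto
    ultimately have v2: "valid (alive C) t2" using forks2 by (simp add: valid_def)
    have "paid t1 t2"
      using credit_grow[of t1 k s] v1 lev s_small s True vpos_grow[of t1 s "[]"]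
      by (simp add: paid_def t2_def)
    have cover2: "\<forall>c \<in> C. \<exists>l \<in> labels t2. prefix l c"
    proof
      fix c assume "c \<in> C"
      then obtain l where l: "l \<in> labels t1" "prefix l c" using t1(5) by blast
      show "\<exists>l \<in> labels t2. prefix l c"
      proof (cases "l = v")
        case True
        then have "c \<in> labels t2"
          using l \<open>c \<in> C\<close> s(1) labels_grow_supset[of t1 s] \<open>target t1 = v\<close> len[of c]
          by (auto simp: Q_def t2_def)
        then show ?thesis by blast
      next
        case False
        then show ?thesis using l labels_grow_supset[of t1 s] \<open>target t1 = v\<close>
          by (auto simp: t2_def)
      qed
    qed
    obtain t3 where t3: "valid (alive C) t3" "settled (alive C) t3" "paid t2 t3"
      "labels t3 \<subseteq> labels t2" "\<forall>c \<in> C. \<exists>l \<in> labels t3. prefix l c"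
      using settle_open[OF v2 C(1,3) cover2] by blast
    have "target t1 \<notin> labels t2"
      unfolding t2_def using v1 s(1) True len by (intro target_notin_grow) auto
    then have "v \<notin> labels t2" using True by simp
    moreover have "labels t2 \<subseteq> labels t1 \<union> Q" using labels_grow[of s t1] s(1) by (auto simp: t2_def)
    ultimately have "labels t3 \<subseteq> labels t - {v} \<union> Q" "target t3 \<noteq> v"
      using t3(4) t1(4) subsetD[OF t3(4) target_in_labels] by auto
    moreover have "paid t t3" using paid_trans t1(3) t3(3) \<open>paid t1 t2\<close> by blast
    ultimately show ?thesis using t3 vt
      by (intro exI[of _ t3]) (auto simp: replan_def settled_def Q_def)
  qed
qed

text \<open>\<open>g / 2 = 1 + 1 / k + 1 / (2 * k\<^sup>2)\<close> is the quadratic Taylor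
  polynomial of exp at \<open>1 / k\<close>, so its \<open>k\<close>-th power is at most e.\<close>

lemma power_half_g: "(g / 2) ^ k \<le> 3"
proof -
  have "g / 2 = 1 + 1 / real k + (1 / real k)\<^sup>2 / 2"
    by (simp add: g_def q_def power2_eq_square algebra_simps add_divide_distrib)
  also have "\<dots> \<le> exp (1 / real k)" by (rule exp_lower_Taylor_quadratic) simp
  finally have "(g / 2) ^ k \<le> exp (1 / real k) ^ k" using g_pos by (intro power_mono) auto
  also have "\<dots> = exp 1" using k_pos by (simp flip: exp_of_nat_mult)
  finally show ?thesis using exp_le by linarith
qed

lemma rate_le: "rate k \<le> 24 * real k * 2 ^ k"
proof -
  \<comment> \<open>The shift by \<open>2 * \<kappa>\<close> makes the affine recursion geometric:
    \<open>g * \<kappa> + 2 * \<kappa> \<le> 2 * g * \<kappa>\<close> because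
    \<open>g > 2\<close>.\<close>
  have "rate m + 2 * \<kappa> \<le> g ^ m * (2 * real k + 2 * \<kappa>)" for m
  proof (induction m)
    case (Suc m)
    have "rate (Suc m) + 2 * \<kappa> \<le> g * (rate m + 2 * \<kappa>)"
      using g_gt2 \<kappa>_pos by (simp add: distrib_left)
    also have "\<dots> \<le> g * (g ^ m * (2 * real k + 2 * \<kappa>))"
      using Suc g_pos by (intro mult_left_mono) auto
    finally show ?case by simp
  qed simp
  then have "rate k \<le> g ^ k * (2 * real k + 2 * \<kappa>)" using \<kappa>_pos by (smt (verit))
  also have "\<dots> = (g / 2) ^ k * 2 ^ k * (2 * real k + 2 * \<kappa>)" by (simp add: power_divide)
  also have "\<dots> \<le> 3 * 2 ^ k * (2 * real k + 2 * (real k * 3))"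
    using power_half_g g_pos \<kappa>_pos k_pos unfolding \<kappa>_def by (intro mult_mono add_mono) auto
  also have "\<dots> = 24 * real k * 2 ^ k" by simp
  finally show ?thesis .
qed

end

section \<open>A team of robots that know their indices and positions\<close>

section \<open>Exploration by robots with identities\<close>

lemma separated_antichain:
  "separated t \<Longrightarrow> x \<in> labels t \<Longrightarrow> y \<in> labels t \<Longrightarrow> prefix x y \<Longrightarrow> x = y"
  by (induction t) auto

lemma capped_mono_labels:
  "capped P t \<Longrightarrow> (\<And>l. l \<in> labels t \<Longrightarrow> Q l \<Longrightarrow> P l) \<Longrightarrow> capped Q t"
  by (induction t) auto

text \<open>An intermediate model with typed whiteboards and memories. The field \<open>seen\<close>
  collects the nodes where some robot has been activated; the robots cannot read it.\<close>

record ('b, 'm) team =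
  loc :: "nat \<Rightarrow> node"
  info :: "nat \<Rightarrow> 'm"
  wall :: "node \<Rightarrow> 'b"
  seen :: "node set"

type_synonym ('b, 'm) team_algorithm =
  "nat \<Rightarrow> node \<Rightarrow> 'b \<Rightarrow> 'm \<Rightarrow> node set \<Rightarrow> 'b \<times> 'm \<times> node"

definition team_step ::
  "('b, 'm) team_algorithm \<Rightarrow> node set \<Rightarrow> nat \<Rightarrow> ('b, 'm) team \<Rightarrow> ('b, 'm) team" where
  "team_step A T i c =
     (case A i (loc c i) (wall c (loc c i)) (info c i) (adjacent T (loc c i)) of (b, m, u) \<Rightarrow>
       \<lparr>loc = (loc c)(i := u), info = (info c)(i := m), wall = (wall c)(loc c i := b),
        seen = insert (loc c i) (seen c)\<rparr>)"

(* taken: the ports of the edges taken downwards; finished: set by a depth first search leaving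
   upwards; mark: the last stay of the searcher, as its number, the node it left for if it has
   left, and its state (for the next stay if it has left). *)
datatype wb = Board
  (taken: "nat list")
  (finished: bool)
  (mark: "(nat \<times> node option \<times> vtree \<times> node option list) option")

instance wb :: countable
  by countable_datatype

type_synonym memo = "(nat \<times> vtree \<times> node option list) option"

(* The state of the searcher contains, for each robot, the edge below which it explores. *)
definition own :: "node option list \<Rightarrow> nat \<Rightarrow> node option" where
  "own F i = (if i < length F then F ! i else None)"

definition opens :: "node option list \<Rightarrow> node set" where
  "opens F = {d. Some d \<in> set F}"

lemma opens_own: "d \<in> opens F \<longleftrightarrow> (\<exists>i. own F i = Some d)"
  by (auto simp: opens_def own_def in_set_conv_nth split: if_splits)

lemma own_update [simp]: "own (F[i := x]) j = (if j = i \<and> i < length F then x else own F j)"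
  by (auto simp: own_def)

lemma own_map: "h None = None \<Longrightarrow> own (map h F) j = h (own F j)"
  by (auto simp: own_def)

lemma opens_subset: "opens F \<subseteq> the ` set F"
proof
  fix d assume "d \<in> opens F"
  then have "the (Some d) \<in> the ` set F" by (intro imageI) (simp add: opens_def)
  then show "d \<in> the ` set F" by simp
qed

lemma finite_opens [simp]: "finite (opens F)"
  by (rule finite_subset[OF opens_subset]) simp

lemma card_opens: "card (opens F) \<le> length F"
proof -
  have "card (opens F) \<le> card (the ` set F)"
    by (rule card_mono[OF _ opens_subset]) simp
  also have "\<dots> \<le> length F" by (meson List.finite_set card_image_le card_length order_trans)
  finally show ?thesis .
qed

text \<open>The searcher reaches a node below which a robot may be exploring. Of the ports taken
  there only the last one can be unfinished, so the robot is henceforth recorded under that edge, or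
  under none if it has finished \<open>v\<close> or taken no port there.\<close>

definition arrive :: "node \<Rightarrow> wb \<Rightarrow> node option list \<Rightarrow> node option list" where
  "arrive v b F =
     map (\<lambda>x. if x = Some v
       then (if finished b \<or> taken b = [] then None else Some (v @ [last (taken b)])) else x) F"

text \<open>A robot cannot write at its destination, so what it carries is written at its next
  activation, before it decides. \<open>arrive\<close> is applied only at a node without mark, since
  no recorded edge leads into a marked node.\<close>

definition deposit :: "node \<Rightarrow> wb \<Rightarrow> memo \<Rightarrow> wb" where
  "deposit v b m =
     (case m of None \<Rightarrow> b
      | Some (s, t, F) \<Rightarrow>
        (case mark b of
           None \<Rightarrow> Board (taken b) (finished b) (Some (s, None, t, arrive v b F))
         | Some (s', _) \<Rightarrow>
             if s' < s then Board (taken b) (finished b) (Some (s, None, t, F)) else b))"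

definition free_ports :: "node \<Rightarrow> wb \<Rightarrow> node set \<Rightarrow> nat set" where
  "free_ports v b N = {p. v @ [p] \<in> N \<and> p \<notin> set (taken b)}"

definition toward :: "node \<Rightarrow> node \<Rightarrow> node" where
  "toward v w = (if prefix v w then take (Suc (length v)) w else butlast v)"

definition (in balancing) act :: "(wb, memo) team_algorithm" where
  "act i v b0 m N =
     (let b = deposit v b0 m; P = free_ports v b N; p = (SOME p. p \<in> P) in
      case mark b of
        None \<Rightarrow>
          if P = {} then (Board (taken b) True None, None, butlast v)
          else (Board (taken b @ [p]) (finished b) None, None, v @ [p])
      | Some (s, Some u, \<sigma>) \<Rightarrow> (b, Some (Suc s, \<sigma>), u)
      | Some (s, None, t, F) \<Rightarrow>
          if P = {} then
            let F' = F[i := None]; t' = (SOME t'. replan v (opens F') t t');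
                u = toward v (target t')
            in (Board (taken b) (finished b) (Some (s, Some u, t', F')), Some (Suc s, t', F'), u)
          else (Board (taken b @ [p]) (finished b) (Some (s, None, t, F[i := Some (v @ [p])])),
                None, v @ [p]))"

definition below :: "node set \<Rightarrow> node \<Rightarrow> node set" where
  "below T v = {w \<in> T. prefix v w}"

definition blank :: wb where
  "blank = Board [] False None"

text \<open>The state of a lone depth first search at \<open>y\<close> below \<open>d\<close>. The
  last port taken at each proper ancestor leads to \<open>y\<close>, and everything below the ports
  taken at \<open>y\<close> is done. \<open>y\<close> itself may still be waiting for its first
  activation.\<close>

definition dfs :: "node set \<Rightarrow> (wb, memo) team \<Rightarrow> node \<Rightarrow> node \<Rightarrow> bool" where
  "dfs T c d y \<longleftrightarrow>
     (\<forall>z. prefix d z \<and> strict_prefix z y \<longrightarrow>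
        z \<in> seen c \<and> \<not> finished (wall c z) \<and> taken (wall c z) \<noteq> [] \<and>
        prefix (z @ [last (taken (wall c z))]) y) \<and>
     \<not> finished (wall c y) \<and> (\<forall>p \<in> set (taken (wall c y)). below T (y @ [p]) \<subseteq> seen c)"

definition exhausted :: "node set \<Rightarrow> (wb, memo) team \<Rightarrow> node \<Rightarrow> bool" where
  "exhausted T c v \<longleftrightarrow> v \<in> seen c \<and> (\<forall>p. v @ [p] \<in> T \<longrightarrow> p \<in> set (taken (wall c v)))"

definition pending :: "(wb, memo) team \<Rightarrow> nat \<Rightarrow> (nat \<Rightarrow> node) \<Rightarrow> bool" where
  "pending c S tr \<longleftrightarrow> (\<forall>x. mark (wall c (tr S)) = Some x \<longrightarrow> fst x < S)"

definition descents :: "(nat \<Rightarrow> node) \<Rightarrow> nat \<Rightarrow> nat" where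
  "descents tr m = card {s. s < m \<and> length (tr s) < length (tr (Suc s))}"

section \<open>The invariant, and its preservation when the searcher's state is written down\<close>

locale exploration = balancing +
  fixes T :: "node set"
  assumes tree: "rooted_tree T"

(* The searcher has made S moves along tr and holds (t, F); it is pending while no robot has
   written (t, F) at its current node. ell i is the number of moves of the searcher that
   robot i has already retraced or skipped, and n counts the rounds. *)
locale state = exploration +
  fixes c :: "(wb, memo) team" and S :: nat and tr :: "nat \<Rightarrow> node" and t :: vtree
    and F :: "node option list" and ell :: "nat \<Rightarrow> nat" and n :: nat
  assumes loc_in: "loc c i \<in> T"
    and loc_taken: "loc c i \<noteq> [] \<Longrightarrow> last (loc c i) \<in> set (taken (wall c (butlast (loc c i))))"
    and taken_distinct: "distinct (taken (wall c v))"
    and taken_in: "p \<in> set (taken (wall c v)) \<Longrightarrow> v @ [p] \<in> T"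
    and touched: "v \<noteq> [] \<Longrightarrow> wall c v \<noteq> blank \<Longrightarrow> last v \<in> set (taken (wall c (butlast v)))"
    and root_marked: "mark (wall c []) \<noteq> None"
    and marked_prefix: "mark (wall c v) \<noteq> None \<Longrightarrow> prefix w v \<Longrightarrow> mark (wall c w) \<noteq> None"
    and tr_in: "s \<le> S \<Longrightarrow> tr s \<in> T"
    and tr_adj: "s < S \<Longrightarrow> tr (Suc s) \<in> adjacent T (tr s)"
    and mark_depart: "mark (wall c v) = Some (s, Some u, t', F') \<Longrightarrow>
      s < S \<and> tr s = v \<and> u = tr (Suc s) \<and> (Suc s = S \<longrightarrow> pending c S tr \<longrightarrow> t' = t \<and> F' = F)"
    and mark_front: "mark (wall c v) = Some (s, None, t', F') \<Longrightarrow> s = S \<and> tr S = v \<and> t' = t \<and> F' = F"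
    and mark_recent: "s < S \<Longrightarrow> \<exists>x. mark (wall c (tr s)) = Some x \<and> s \<le> fst x"
    and info_some: "info c i = Some (s, t', F') \<Longrightarrow>
      s \<le> S \<and> tr s = loc c i \<and> ell i \<le> s \<and> (s = S \<longrightarrow> pending c S tr \<longrightarrow> t' = t \<and> F' = F)"
    and ell_le: "ell i \<le> S"
    and info_none_marked: "info c i = None \<Longrightarrow> mark (wall c (loc c i)) = Some x \<Longrightarrow> ell i \<le> fst x"
    and info_none_unmarked: "info c i = None \<Longrightarrow> mark (wall c (loc c i)) = None \<Longrightarrow>
      \<exists>d. own F i = Some d \<and> prefix d (loc c i) \<and>
        (\<forall>x. mark (wall c (butlast d)) = Some x \<longrightarrow> ell i \<le> fst x)"
    and len_F: "length F = k"
    and own_props: "own F i = Some d \<Longrightarrow> d \<noteq> [] \<and> d \<in> T \<and> mark (wall c d) = None \<and>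
      mark (wall c (butlast d)) \<noteq> None \<and> last d \<in> set (taken (wall c (butlast d)))"
    and own_dfs: "own F i = Some d \<Longrightarrow>
      (if info c i = None \<and> prefix d (loc c i) then dfs T c d (loc c i) else below T d \<subseteq> seen c)"
    and own_inj: "own F i = Some d \<Longrightarrow> own F j = Some d \<Longrightarrow> i = j"
    and unmarked_finished: "mark (wall c v) = None \<Longrightarrow> finished (wall c v) \<Longrightarrow> below T v \<subseteq> seen c"
    and unmarked_taken: "mark (wall c v) = None \<Longrightarrow> p \<in> set (butlast (taken (wall c v))) \<Longrightarrow>
      below T (v @ [p]) \<subseteq> seen c"
    and tree_valid: "valid (\<lambda>l. alive (opens F) l \<or> l = tr S \<and> \<not> exhausted T c l) t"
    and tree_cover: "d \<in> opens F \<Longrightarrow> \<exists>l \<in> labels t. prefix l d"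
    and label_top: "l \<in> labels t \<Longrightarrow> mark (wall c z) \<noteq> None \<Longrightarrow> prefix l z \<Longrightarrow> z = l"
    and label_prefix: "l \<in> labels t \<Longrightarrow> strict_prefix z l \<Longrightarrow> mark (wall c z) \<noteq> None"
    and label_taken: "l \<in> labels t \<Longrightarrow> l \<noteq> [] \<Longrightarrow> last l \<in> set (taken (wall c (butlast l)))"
    and pending_label: "pending c S tr \<Longrightarrow> mark (wall c (tr S)) = None \<Longrightarrow> tr S \<in> labels t"
    and coverage: "v \<in> T \<Longrightarrow> v \<notin> seen c \<Longrightarrow> (\<exists>d \<in> opens F. prefix d v) \<or>
      \<not> pending c S tr \<and> prefix (tr S) v \<and>
        (v = tr S \<or> v ! length (tr S) \<notin> set (taken (wall c (tr S))))"
    and marked_exhausted: "mark (wall c v) \<noteq> None \<Longrightarrow>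
      exhausted T c v \<or> \<not> pending c S tr \<and> v = tr S \<and> v \<in> labels t"
    and cost: "real (descents tr S) + real (descent (tr S) (vpos [] t)) + credit t \<le> rate k * val t"
    and val_bound: "val t \<le> real (depth T) + 1"
    and count: "n + (\<Sum>i<k. length (loc c i)) \<le>
      2 * ((\<Sum>v\<in>T. length (taken (wall c v))) + (\<Sum>i<k. descents tr (ell i)))"
begin

lemma labels_antichain: "x \<in> labels t \<Longrightarrow> y \<in> labels t \<Longrightarrow> prefix x y \<Longrightarrow> x = y"
  using tree_valid separated_antichain by (auto simp: valid_def)

lemma unmarked_mono: "mark (wall c v) = None \<Longrightarrow> prefix v w \<Longrightarrow> mark (wall c w) = None"
  using marked_prefix by blast

text \<open>The node of every earlier stay \<open>s\<close> bears a mark numbered at least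
  \<open>s\<close>. So information newer than the local mark can only concern the current stay,
  which nobody has written yet.\<close>

lemma deposit_pending:
  assumes m: "info c i = Some (s, t', F')" and f: "\<And>x. mark (wall c (loc c i)) = Some x \<Longrightarrow> fst x < s"
  shows "s = S" "tr S = loc c i" "pending c S tr" "t' = t" "F' = F"
proof -
  note * = info_some[OF m]
  show "s = S" using * mark_recent[of s] f by fastforce
  then show "tr S = loc c i" using * by simp
  then show "pending c S tr" using f \<open>s = S\<close> by (simp add: pending_def)
  then show "t' = t" "F' = F" using * \<open>s = S\<close> by auto
qed

definition deposited :: "node option list \<Rightarrow> (wb, memo) team" where
  "deposited F' = c\<lparr>wall := (wall c)(tr S :=
     Board (taken (wall c (tr S))) (finished (wall c (tr S))) (Some (S, None, t, F')))\<rparr>"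

lemma deposited_simps [simp]:
  "loc (deposited F') = loc c" "info (deposited F') = info c" "seen (deposited F') = seen c"
  "taken (wall (deposited F') v) = taken (wall c v)" "finished (wall (deposited F') v) = finished (wall c v)"
  "mark (wall (deposited F') v) = (if v = tr S then Some (S, None, t, F') else mark (wall c v))"
  "exhausted T (deposited F') v = exhausted T c v" "dfs T (deposited F') d y = dfs T c d y"
  "\<not> pending (deposited F') S tr"
  by (auto simp: deposited_def exhausted_def dfs_def pending_def)

text \<open>A return to a node that the searcher has left before: it is exhausted and no recorded
  edge leads into it, so \<open>F\<close> remains correct.\<close>

lemma deposit_marked:
  assumes p: "pending c S tr" and m: "mark (wall c (tr S)) = Some x0"
  shows "state k T (deposited F) S tr t F ell n"
proof -
  have x0: "fst x0 < S" using p m by (simp add: pending_def)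
  have ex: "exhausted T c (tr S)" using marked_exhausted[of "tr S"] p m by auto
  have blank: "wall (deposited F) v \<noteq> blank \<Longrightarrow> wall c v \<noteq> blank" for v
    using m by (auto simp: deposited_def blank_def split: if_splits)
  show ?thesis
  proof unfold_locales
    fix v s u t' F'
    assume "mark (wall (deposited F) v) = Some (s, Some u, t', F')"
    then show "s < S \<and> tr s = v \<and> u = tr (Suc s) \<and>
      (Suc s = S \<longrightarrow> pending (deposited F) S tr \<longrightarrow> t' = t \<and> F' = F)"
      using mark_depart[of v s u t' F'] by (auto split: if_splits)
  next
    fix v s t' F'
    assume "mark (wall (deposited F) v) = Some (s, None, t', F')"
    then show "s = S \<and> tr S = v \<and> t' = t \<and> F' = F"
      using mark_front[of v s t' F'] by (auto split: if_splits)
  next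
    fix s assume "s < S"
    then show "\<exists>x. mark (wall (deposited F) (tr s)) = Some x \<and> s \<le> fst x"
      using mark_recent[of s] by auto
  next
    fix i s t' F' assume "info (deposited F) i = Some (s, t', F')"
    then show "s \<le> S \<and> tr s = loc (deposited F) i \<and> ell i \<le> s \<and>
      (s = S \<longrightarrow> pending (deposited F) S tr \<longrightarrow> t' = t \<and> F' = F)"
      using info_some by simp
  next
    fix i x assume "info (deposited F) i = None" "mark (wall (deposited F) (loc (deposited F) i)) = Some x"
    then show "ell i \<le> fst x" using info_none_marked ell_le[of i] by (auto split: if_splits)
  next
    fix i assume *: "info (deposited F) i = None" "mark (wall (deposited F) (loc (deposited F) i)) = None"
    then obtain d where "own F i = Some d" "prefix d (loc c i)"
      "\<forall>x. mark (wall c (butlast d)) = Some x \<longrightarrow> ell i \<le> fst x"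
      using info_none_unmarked[of i] by (auto split: if_splits)
    then show "\<exists>d. own F i = Some d \<and> prefix d (loc (deposited F) i) \<and>
        (\<forall>x. mark (wall (deposited F) (butlast d)) = Some x \<longrightarrow> ell i \<le> fst x)"
      using ell_le[of i] by auto
  next
    fix i d assume "own F i = Some d"
    then show "d \<noteq> [] \<and> d \<in> T \<and> mark (wall (deposited F) d) = None \<and>
      mark (wall (deposited F) (butlast d)) \<noteq> None \<and> last d \<in> set (taken (wall (deposited F) (butlast d)))"
      using own_props[of i d] m by auto
  next
    fix v assume "mark (wall (deposited F) v) \<noteq> None"
    then show "exhausted T (deposited F) v \<or>
      \<not> pending (deposited F) S tr \<and> v = tr S \<and> v \<in> labels t"
      using marked_exhausted[of v] p ex by (auto split: if_splits)
  next
    fix v assume "v \<in> T" "v \<notin> seen (deposited F)"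
    then show "(\<exists>d \<in> opens F. prefix d v) \<or>
      \<not> pending (deposited F) S tr \<and> prefix (tr S) v \<and>
        (v = tr S \<or> v ! length (tr S) \<notin> set (taken (wall (deposited F) (tr S))))"
      using coverage p by simp
  next
    fix v w assume "mark (wall (deposited F) v) \<noteq> None" "prefix w v"
    then show "mark (wall (deposited F) w) \<noteq> None"
      using marked_prefix[of v w] m by (cases x0) (auto split: if_splits)
  next
    fix l z assume "l \<in> labels t" "mark (wall (deposited F) z) \<noteq> None" "prefix l z"
    then show "z = l" using label_top[of l z] m by (cases x0) (auto split: if_splits)
  next
    fix v assume "v \<noteq> []" "wall (deposited F) v \<noteq> blank"
    then show "last v \<in> set (taken (wall (deposited F) (butlast v)))"
      using touched blank by simp
  next
    fix l z assume "l \<in> labels t" "strict_prefix z l"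
    then show "mark (wall (deposited F) z) \<noteq> None" using label_prefix[of l z] by simp
  next
    fix v assume "mark (wall (deposited F) v) = None" "finished (wall (deposited F) v)"
    then show "below T v \<subseteq> seen (deposited F)" using unmarked_finished[of v] by (simp split: if_splits)
  next
    fix v p assume "mark (wall (deposited F) v) = None" "p \<in> set (butlast (taken (wall (deposited F) v)))"
    then show "below T (v @ [p]) \<subseteq> seen (deposited F)"
      using unmarked_taken[of v p] by (simp split: if_splits)
  next
    show "mark (wall (deposited F) []) \<noteq> None" using root_marked by simp
  qed (use loc_in loc_taken taken_distinct taken_in tr_in tr_adj ell_le len_F own_dfs own_inj
      tree_valid tree_cover label_taken cost val_bound count in simp_all)
qed

text \<open>The searcher enters a label for the first time. What the depth first search there leaves
  unfinished splits into the part below its last port, recorded by \<open>arrive\<close>, and the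
  untaken ports, which now belong to the searcher's node.\<close>

lemma deposit_unmarked:
  assumes p: "pending c S tr" and m: "mark (wall c (tr S)) = None"
  shows "state k T (deposited (arrive (tr S) (wall c (tr S)) F)) S tr t
    (arrive (tr S) (wall c (tr S)) F) ell n"
proof -
  let ?v = "tr S"
  let ?b = "wall c ?v"
  let ?F = "arrive ?v ?b F"
  let ?d = "?v @ [last (taken ?b)]"
  have vl: "?v \<in> labels t" using pending_label p m by simp
  have own: "own ?F j = (if own F j = Some ?v
      then (if finished ?b \<or> taken ?b = [] then None else Some ?d) else own F j)" for j
    unfolding arrive_def by (subst own_map) auto
  have dm: "mark (wall c ?d) = None" using unmarked_mono[OF m, of ?d] by simp
  have opens: "d \<in> opens ?F \<Longrightarrow>
      d \<in> opens F \<and> d \<noteq> ?v \<or> ?v \<in> opens F \<and> d = ?d \<and> \<not> finished ?b \<and> taken ?b \<noteq> []" for d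
    by (auto simp: opens_own own split: if_splits)
  have opens1: "d \<in> opens F \<Longrightarrow> d \<noteq> ?v \<Longrightarrow> d \<in> opens ?F" for d
    unfolding opens_own own by (metis option.inject)
  have opens2: "?v \<in> opens F \<Longrightarrow> \<not> finished ?b \<Longrightarrow> taken ?b \<noteq> [] \<Longrightarrow> ?d \<in> opens ?F"
    by (auto simp: opens_own own)
  have nd: "own F j = Some ?d \<Longrightarrow> False" for j
    using own_props[of j ?d] m by simp
  \<comment> \<open>The only new open edge lies below \<open>tr S\<close>, which is itself a label;
    as labels are incomparable, no other label becomes alive.\<close>
  have alive: "alive (opens F) l" if "l \<in> labels t" "alive (opens ?F) l" for l
  proof -
    from that(2) obtain d where d: "d \<in> opens ?F" "prefix l d" by (auto simp: alive_def)
    from opens[OF d(1)] show ?thesis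
    proof
      assume "?v \<in> opens F \<and> d = ?d \<and> \<not> finished ?b \<and> taken ?b \<noteq> []"
      moreover from this d(2) have "prefix l ?v \<or> l = ?d" by (metis prefix_snoc)
      moreover have "l \<noteq> ?d" using labels_antichain[OF vl that(1)] by auto
      ultimately show ?thesis by (auto simp: alive_def)
    qed (use d in \<open>auto simp: alive_def\<close>)
  qed
  have blank: "wall (deposited ?F) v \<noteq> blank \<Longrightarrow> v \<noteq> ?v \<Longrightarrow> wall c v \<noteq> blank" for v
    by (auto simp: deposited_def split: if_splits)
  show ?thesis
  proof unfold_locales
    fix v s u t' F'
    assume "mark (wall (deposited ?F) v) = Some (s, Some u, t', F')"
    then show "s < S \<and> tr s = v \<and> u = tr (Suc s) \<and>
      (Suc s = S \<longrightarrow> pending (deposited ?F) S tr \<longrightarrow> t' = t \<and> F' = ?F)"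
      using mark_depart[of v s u t' F'] by (auto split: if_splits)
  next
    fix v s t' F'
    assume "mark (wall (deposited ?F) v) = Some (s, None, t', F')"
    then show "s = S \<and> tr S = v \<and> t' = t \<and> F' = ?F"
      using mark_front[of v s t' F'] by (auto split: if_splits)
  next
    fix s assume "s < S"
    then show "\<exists>x. mark (wall (deposited ?F) (tr s)) = Some x \<and> s \<le> fst x"
      using mark_recent[of s] by auto
  next
    fix i s t' F' assume "info (deposited ?F) i = Some (s, t', F')"
    then show "s \<le> S \<and> tr s = loc (deposited ?F) i \<and> ell i \<le> s \<and>
      (s = S \<longrightarrow> pending (deposited ?F) S tr \<longrightarrow> t' = t \<and> F' = ?F)"
      using info_some by simp
  next
    fix i x assume "info (deposited ?F) i = None" "mark (wall (deposited ?F) (loc (deposited ?F) i)) = Some x"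
    then show "ell i \<le> fst x" using info_none_marked ell_le[of i] by (auto split: if_splits)
  next
    fix i assume *: "info (deposited ?F) i = None" "mark (wall (deposited ?F) (loc (deposited ?F) i)) = None"
    then have ne: "loc c i \<noteq> ?v" by (auto split: if_splits)
    obtain d where d: "own F i = Some d" "prefix d (loc c i)"
      "\<forall>x. mark (wall c (butlast d)) = Some x \<longrightarrow> ell i \<le> fst x"
      using * info_none_unmarked[of i] by (auto split: if_splits)
    show "\<exists>d. own ?F i = Some d \<and> prefix d (loc (deposited ?F) i) \<and>
        (\<forall>x. mark (wall (deposited ?F) (butlast d)) = Some x \<longrightarrow> ell i \<le> fst x)"
    proof (cases "d = ?v")
      case False
      then show ?thesis using d own ell_le[of i] by (intro exI[of _ d]) auto
    next
      case True
      have sp: "strict_prefix ?v (loc c i)" using d True ne by (metis prefix_order.le_less)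
      have dfs: "dfs T c ?v (loc c i)" using own_dfs[OF d(1)] * d True by simp
      then have "own ?F i = Some ?d" "prefix ?d (loc c i)"
        using sp own d True by (auto simp: dfs_def)
      then show ?thesis using ell_le[of i] by (intro exI[of _ ?d]) auto
    qed
  next
    fix i d assume "own ?F i = Some d"
    then show "d \<noteq> [] \<and> d \<in> T \<and> mark (wall (deposited ?F) d) = None \<and>
      mark (wall (deposited ?F) (butlast d)) \<noteq> None \<and> last d \<in> set (taken (wall (deposited ?F) (butlast d)))"
      using own_props[of i d] dm taken_in[of "last (taken ?b)" ?v] by (auto simp: own split: if_splits)
  next
    fix i d assume d: "own ?F i = Some d"
    have "if info c i = None \<and> prefix d (loc c i) then dfs T c d (loc c i) else below T d \<subseteq> seen c"
    proof (cases "own F i = Some ?v")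
      case False
      then show ?thesis using own_dfs[of i d] d own by auto
    next
      case True
      then have d': "d = ?d" "taken ?b \<noteq> []" using d own by (auto split: if_splits)
      have sub: "below T ?d \<subseteq> below T ?v" by (auto simp: below_def dest: append_prefixD)
      consider "info c i = None" "loc c i = ?v" | "info c i = None" "strict_prefix ?v (loc c i)"
        | "\<not> (info c i = None \<and> prefix ?v (loc c i))"
        by (metis prefix_order.le_less)
      then show ?thesis
      proof cases
        case 1
        then have "below T ?d \<subseteq> seen c" using own_dfs[OF True] d' by (auto simp: dfs_def)
        then show ?thesis using 1 d' by simp
      next
        case 2
        then have dfs: "dfs T c ?v (loc c i)" using own_dfs[OF True] by (simp add: prefix_order.less_imp_le)
        then have "prefix ?d (loc c i)" using 2 by (auto simp: dfs_def)
        moreover have "dfs T c ?d (loc c i)"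
          using dfs unfolding dfs_def by (meson append_prefixD)
        ultimately show ?thesis using 2 d' by simp
      next
        case 3
        then have "below T ?v \<subseteq> seen c" using own_dfs[OF True] by simp
        with sub have "below T ?d \<subseteq> seen c" by (rule order_trans)
        moreover have "\<not> (info c i = None \<and> prefix ?d (loc c i))" using 3 append_prefixD by blast
        ultimately show ?thesis using d' by auto
      qed
    qed
    then show "if info (deposited ?F) i = None \<and> prefix d (loc (deposited ?F) i)
      then dfs T (deposited ?F) d (loc (deposited ?F) i) else below T d \<subseteq> seen (deposited ?F)"
      by simp
  next
    fix i j d assume "own ?F i = Some d" "own ?F j = Some d"
    then show "i = j" using own_inj nd by (auto simp: own split: if_splits)
  next
    fix d assume "d \<in> opens ?F"
    then show "\<exists>l \<in> labels t. prefix l d" using opens[of d] tree_cover vl by (auto intro: bexI[of _ ?v])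
  next
    fix v assume "mark (wall (deposited ?F) v) \<noteq> None"
    then show "exhausted T (deposited ?F) v \<or>
      \<not> pending (deposited ?F) S tr \<and> v = tr S \<and> v \<in> labels t"
      using marked_exhausted[of v] p vl by (auto split: if_splits)
  next
    fix w assume w: "w \<in> T" "w \<notin> seen (deposited ?F)"
    then obtain d where d: "d \<in> opens F" "prefix d w" using coverage p by auto
    show "(\<exists>d \<in> opens ?F. prefix d w) \<or>
      \<not> pending (deposited ?F) S tr \<and> prefix (tr S) w \<and>
        (w = tr S \<or> w ! length (tr S) \<notin> set (taken (wall (deposited ?F) (tr S))))"
    proof (cases "d = ?v")
      case False
      then show ?thesis using d opens1 by blast
    next
      case True
      show ?thesis
      proof (rule ccontr)
        assume neg: "\<not> ?thesis"
        then have "w \<noteq> ?v" and tk: "w ! length ?v \<in> set (taken ?b)" using d True by auto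
        then obtain p' r where pr: "w = ?v @ p' # r"
          using d True by (metis append.right_neutral neq_Nil_conv prefix_def)
        then have p': "p' \<in> set (taken ?b)" using tk by simp
        \<comment> \<open>An unseen node can lie neither below a finished node nor below a port
          taken before the last one. Its port, being taken, must then be the last.\<close>
        have "\<not> finished ?b" using unmarked_finished[OF m] w d True by (auto simp: below_def)
        moreover have ne: "taken ?b \<noteq> []" using p' by auto
        ultimately have "?d \<in> opens ?F" using opens2 d True by simp
        moreover have "w \<in> below T (?v @ [p'])" using w pr by (simp add: below_def prefix_def)
        then have "p' \<notin> set (butlast (taken ?b))"
          using unmarked_taken[OF m, of p'] w by auto
        then have "p' = last (taken ?b)" using p' ne
          by (metis append_butlast_last_id rotate1.simps(2) set_ConsD set_rotate1)
        then have "prefix ?d w" using pr by simp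
        ultimately show False using neg by blast
      qed
    qed
  next
    fix v w assume "mark (wall (deposited ?F) v) \<noteq> None" "prefix w v"
    moreover have "strict_prefix w ?v \<Longrightarrow> mark (wall c w) \<noteq> None" using label_prefix[OF vl] by simp
    ultimately show "mark (wall (deposited ?F) w) \<noteq> None"
      using marked_prefix[of v w] by (auto split: if_splits simp: prefix_order.le_less)
  next
    fix l z assume l: "l \<in> labels t" and "mark (wall (deposited ?F) z) \<noteq> None" "prefix l z"
    then show "z = l" using label_top[of l z] labels_antichain[OF l vl] by (auto split: if_splits)
  next
    fix v assume v: "v \<noteq> []" "wall (deposited ?F) v \<noteq> blank"
    then show "last v \<in> set (taken (wall (deposited ?F) (butlast v)))"
      using touched blank label_taken[OF vl] by (cases "v = ?v") auto
  next
    fix l z assume "l \<in> labels t" "strict_prefix z l"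
    then show "mark (wall (deposited ?F) z) \<noteq> None" using label_prefix[of l z] by simp
  next
    fix v assume "mark (wall (deposited ?F) v) = None" "finished (wall (deposited ?F) v)"
    then show "below T v \<subseteq> seen (deposited ?F)" using unmarked_finished[of v] by (simp split: if_splits)
  next
    fix v p assume "mark (wall (deposited ?F) v) = None" "p \<in> set (butlast (taken (wall (deposited ?F) v)))"
    then show "below T (v @ [p]) \<subseteq> seen (deposited ?F)"
      using unmarked_taken[of v p] by (simp split: if_splits)
  next
    show "mark (wall (deposited ?F) []) \<noteq> None" using root_marked by simp
  next
    show "length ?F = k" using len_F by (simp add: arrive_def)
  next
    have "capped (\<lambda>l. alive (opens ?F) l \<or> l = tr S \<and> \<not> exhausted T c l) t"
      using tree_valid unfolding valid_def by (auto intro: capped_mono_labels alive)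
    then show "valid (\<lambda>l. alive (opens ?F) l \<or> l = tr S \<and> \<not> exhausted T (deposited ?F) l) t"
      using tree_valid by (simp add: valid_def)
  qed (use loc_in loc_taken taken_distinct taken_in tr_in tr_adj ell_le 
      label_taken cost val_bound count in simp_all)
qed

end

section \<open>Counting descents, and single steps in the tree\<close>

lemma dfs_mono:
  assumes "dfs T c d y" "seen c \<subseteq> seen c'"
    "\<And>z. prefix d z \<Longrightarrow> prefix z y \<Longrightarrow> taken (wall c' z) = taken (wall c z) \<and> finished (wall c' z) = finished (wall c z)"
    "prefix d y"
  shows "dfs T c' d y"
  unfolding dfs_def
proof (intro conjI allI impI ballI)
  fix z assume z: "prefix d z \<and> strict_prefix z y"
  then have "taken (wall c' z) = taken (wall c z)" "finished (wall c' z) = finished (wall c z)"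
    using assms(3)[of z] by auto
  then show "z \<in> seen c'" "\<not> finished (wall c' z)" "taken (wall c' z) \<noteq> []"
    "prefix (z @ [last (taken (wall c' z))]) y"
    using assms(1,2) z by (auto simp: dfs_def)
next
  fix p assume "p \<in> set (taken (wall c' y))"
  then have "below T (y @ [p]) \<subseteq> seen c" using assms(1) assms(3)[of y] assms(4) by (simp add: dfs_def)
  then show "below T (y @ [p]) \<subseteq> seen c'" using assms(2) by (rule order_trans)
next
  show "\<not> finished (wall c' y)" using assms(1) assms(3)[of y] assms(4) by (simp add: dfs_def)
qed

lemma sum_fun_upd:
  fixes f :: "'b \<Rightarrow> nat"
  assumes "finite A" "i \<in> A"
  shows "(\<Sum>j\<in>A. f ((h(i := x)) j)) + f (h i) = (\<Sum>j\<in>A. f (h j)) + f x"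
proof -
  have "(\<Sum>j\<in>A - {i}. f ((h(i := x)) j)) = (\<Sum>j\<in>A - {i}. f (h j))" by (intro sum.cong) auto
  then show ?thesis using assms by (simp add: sum.remove)
qed

lemma descents_mono: "m \<le> m' \<Longrightarrow> descents tr m \<le> descents tr m'"
  unfolding descents_def by (intro card_mono) auto

lemma descents_step:
  "descents tr (Suc s) = descents tr s + (if length (tr s) < length (tr (Suc s)) then 1 else 0)"
proof -
  have "{s'. s' < Suc s \<and> length (tr s') < length (tr (Suc s'))} =
    (if length (tr s) < length (tr (Suc s)) then insert s else id)
      {s'. s' < s \<and> length (tr s') < length (tr (Suc s'))}"
    by (auto simp: less_Suc_eq)
  then show ?thesis unfolding descents_def by simp
qed

lemma descents_cong: "(\<And>s. s \<le> m \<Longrightarrow> tr s = tr' s) \<Longrightarrow> descents tr m = descents tr' m"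
  unfolding descents_def by (rule arg_cong[where f = card]) (auto simp: Suc_leI)

text \<open>The first part is the exchange rate of the amortisation: a step towards \<open>w\<close>
  shortens the remaining descent by exactly the descent that it makes.\<close>

lemma toward_props:
  assumes "v \<noteq> w"
  shows "descent (toward v w) w + (if length v < length (toward v w) then 1 else 0) = descent v w"
    and "prefix v w \<Longrightarrow> prefix (toward v w) w \<and> (\<exists>p. toward v w = v @ [p])"
    and "\<not> prefix v w \<Longrightarrow> v \<noteq> [] \<and> toward v w = butlast v"
proof -
  have *: "prefix (toward v w) w \<and> (\<exists>p. toward v w = v @ [p])" if "prefix v w"
  proof -
    obtain p r where "w = v @ p # r"
      using \<open>prefix v w\<close> \<open>v \<noteq> w\<close> by (metis append.right_neutral neq_Nil_conv prefix_def)
    then show ?thesis by (auto simp: toward_def)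
  qed
  then show "prefix v w \<Longrightarrow> prefix (toward v w) w \<and> (\<exists>p. toward v w = v @ [p])" .
  show **: "\<not> prefix v w \<Longrightarrow> v \<noteq> [] \<and> toward v w = butlast v" by (auto simp: toward_def)
  show "descent (toward v w) w + (if length v < length (toward v w) then 1 else 0) = descent v w"
  proof (cases "prefix v w")
    case True
    then obtain p where p: "prefix (toward v w) w" "toward v w = v @ [p]" using * by blast
    then show ?thesis using descent_prefix[OF p(1)] descent_prefix[OF True] prefix_length_le[OF p(1)] by simp
  next
    case False
    then show ?thesis using ** descent_butlast[OF False] by simp
  qed
qed

lemma (in exploration) length_le_depth: "v \<in> T \<Longrightarrow> length v \<le> depth T"
  using tree unfolding depth_def rooted_tree_def by simp

lemma (in exploration) prefix_in_tree: "w \<in> T \<Longrightarrow> prefix v w \<Longrightarrow> v \<in> T"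
proof (induction w rule: rev_induct)
  case (snoc p w)
  then show ?case using tree unfolding rooted_tree_def by (metis prefix_snoc)
qed simp

lemma (in exploration) adjacent_snoc: "v @ [p] \<in> T \<Longrightarrow> v @ [p] \<in> adjacent T v"
  by (simp add: adjacent_def)

lemma (in exploration) adjacent_butlast: "v \<in> T \<Longrightarrow> v \<noteq> [] \<Longrightarrow> butlast v \<in> adjacent T v"
  using prefix_in_tree[of v "butlast v"] by (auto simp: adjacent_def prefixeq_butlast intro: exI[of _ "last v"])

definition acted :: "nat \<Rightarrow> 'b \<Rightarrow> 'm \<Rightarrow> node \<Rightarrow> ('b, 'm) team \<Rightarrow> ('b, 'm) team" where
  "acted i b m u c =
     \<lparr>loc = (loc c)(i := u), info = (info c)(i := m), wall = (wall c)(loc c i := b),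
      seen = insert (loc c i) (seen c)\<rparr>"

lemma acted_simps [simp]:
  "loc (acted i b m u c) = (loc c)(i := u)" "info (acted i b m u c) = (info c)(i := m)"
  "wall (acted i b m u c) v = (if v = loc c i then b else wall c v)"
  "seen (acted i b m u c) = insert (loc c i) (seen c)"
  by (auto simp: acted_def)

section \<open>The five kinds of moves preserve the invariant\<close>

context state
begin

text \<open>There is no mark below a recorded edge, so a robot at a marked node has left the subtree
  recorded for it, and it leaves only when all of it has been seen.\<close>

lemma own_at_marked:
  assumes "mark (wall c (loc c i)) \<noteq> None" "own F i = Some d"
  shows "below T d \<subseteq> seen c"
proof -
  have "\<not> prefix d (loc c i)"
    using own_props[OF assms(2)] marked_prefix[OF assms(1)] by blast
  then show ?thesis using own_dfs[OF assms(2)] by simp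
qed

text \<open>The lower end of a recorded edge is unmarked and its upper end is marked, while marks
  are closed upwards; so recorded edges are never nested.\<close>

lemma own_unique:
  assumes "own F i = Some d" "own F j = Some d'" "prefix d y" "prefix d' y"
  shows "i = j"
proof -
  have *: "\<not> strict_prefix a b" if "own F j1 = Some a" "own F j2 = Some b" for a b j1 j2
  proof
    assume "strict_prefix a b"
    then have "prefix a (butlast b)"
      using own_props[OF that(2)] by (metis append_butlast_last_id prefix_order.less_le prefix_snoc)
    then show False using own_props[OF that(1)] own_props[OF that(2)] marked_prefix by blast
  qed
  have "d = d'" using prefix_same_cases[OF assms(3,4)] *[OF assms(1,2)] *[OF assms(2,1)]
    by (auto simp: prefix_order.le_less)
  then show ?thesis using own_inj assms by blast
qed

lemmas persistent = taken_distinct taken_in root_marked marked_prefix tr_in tr_adj mark_depart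
  mark_front mark_recent ell_le len_F own_inj tree_cover label_top label_prefix pending_label
  cost val_bound

lemma node_taken:
  assumes "mark (wall c v) \<noteq> None \<or> v \<in> labels t" "v \<noteq> []"
  shows "last v \<in> set (taken (wall c (butlast v)))"
proof -
  have "wall c v \<noteq> blank" if "mark (wall c v) \<noteq> None" using that by (auto simp: blank_def)
  then show ?thesis using assms touched[of v] label_taken[of v] by blast
qed

text \<open>The robot resumes the trace at the latest departure from its node and thereby skips any
  loops in between. As \<open>ell i \<le> s\<close>, the move number \<open>s\<close> of the trace
  has not been charged to this robot before.\<close>

lemma follow:
  assumes i: "i < k" and m: "mark (wall c (loc c i)) = Some (s, Some u, \<sigma>)"
    and fresh: "\<And>s0 t0 F0. info c i = Some (s0, t0, F0) \<Longrightarrow> s0 \<le> s"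
  shows "state k T (acted i (wall c (loc c i)) (Some (Suc s, \<sigma>)) u c) S tr t F (ell(i := Suc s)) (Suc n)"
    and "u \<in> adjacent T (loc c i)"
proof -
  let ?v = "loc c i"
  let ?c = "acted i (wall c ?v) (Some (Suc s, \<sigma>)) u c"
  obtain t' F' where \<sigma>: "\<sigma> = (t', F')" by (cases \<sigma>)
  have dep: "s < S" "tr s = ?v" "u = tr (Suc s)" "Suc s = S \<Longrightarrow> pending c S tr \<Longrightarrow> t' = t \<and> F' = F"
    using mark_depart[of ?v s u t' F'] m \<sigma> by auto
  show adj: "u \<in> adjacent T ?v" using tr_adj[OF dep(1)] dep by simp
  have ell: "ell i \<le> s"
  proof (cases "info c i")
    case None
    then show ?thesis using info_none_marked[OF None m] by simp
  next
    case (Some x)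
    then show ?thesis using info_some[of i "fst x" "fst (snd x)" "snd (snd x)"] fresh[of "fst x" "fst (snd x)" "snd (snd x)"] by simp
  qed
  have u: "mark (wall c u) \<noteq> None \<or> u \<in> labels t"
  proof (cases "Suc s < S")
    case True
    then show ?thesis using mark_recent[of "Suc s"] dep(3) by auto
  next
    case False
    then have "Suc s = S" using dep(1) by simp
    then show ?thesis using pending_label dep(3)
      by (cases "mark (wall c (tr S))") (auto simp: pending_def)
  qed
  have wall [simp]: "wall ?c = wall c" by (auto simp: acted_def)
  have pend: "pending ?c S tr = pending c S tr" by (simp add: pending_def)
  have exh: "exhausted T c l \<Longrightarrow> exhausted T ?c l" for l by (auto simp: exhausted_def)
  have cnt: "Suc n + (\<Sum>j<k. length (loc ?c j)) \<le>
      2 * ((\<Sum>v\<in>T. length (taken (wall c v))) + (\<Sum>j<k. descents tr ((ell(i := Suc s)) j)))"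
  proof -
    have "(\<Sum>j<k. length (((loc c)(i := u)) j)) + length ?v = (\<Sum>j<k. length (loc c j)) + length u"
      using sum_fun_upd[of "{..<k}" i length "loc c" u] i by simp
    moreover have "(\<Sum>j<k. descents tr ((ell(i := Suc s)) j)) + descents tr (ell i) =
        (\<Sum>j<k. descents tr (ell j)) + descents tr (Suc s)"
      using sum_fun_upd[of "{..<k}" i "descents tr" ell "Suc s"] i by simp
    moreover have "descents tr (ell i) + (if length ?v < length u then 1 else 0) \<le> descents tr (Suc s)"
      using descents_step[of tr s] descents_mono[OF ell, of tr] dep by simp
    moreover have "length u = Suc (length ?v) \<or> Suc (length u) = length ?v"
      using adj by (auto simp: adjacent_def)
    ultimately show ?thesis using count by (auto split: if_splits)
  qed
  show "state k T ?c S tr t F (ell(i := Suc s)) (Suc n)"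
  proof unfold_locales
    fix j show "loc ?c j \<in> T" using loc_in adj by (simp add: adjacent_def)
  next
    fix j assume "loc ?c j \<noteq> []"
    then show "last (loc ?c j) \<in> set (taken (wall ?c (butlast (loc ?c j))))"
      using loc_taken[of j] node_taken[OF u] by (auto split: if_splits)
  next
    fix j s' t'' F'' assume "info ?c j = Some (s', t'', F'')"
    then show "s' \<le> S \<and> tr s' = loc ?c j \<and> (ell(i := Suc s)) j \<le> s' \<and>
      (s' = S \<longrightarrow> pending ?c S tr \<longrightarrow> t'' = t \<and> F'' = F)"
      using info_some[of j s' t'' F''] dep \<sigma> pend by (auto split: if_splits)
  next
    fix j show "(ell(i := Suc s)) j \<le> S" using ell_le dep by simp
  next
    fix j x assume "info ?c j = None" "mark (wall ?c (loc ?c j)) = Some x"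
    then show "(ell(i := Suc s)) j \<le> fst x" using info_none_marked by (auto split: if_splits)
  next
    fix j assume "info ?c j = None" "mark (wall ?c (loc ?c j)) = None"
    then show "\<exists>d. own F j = Some d \<and> prefix d (loc ?c j) \<and>
        (\<forall>x. mark (wall ?c (butlast d)) = Some x \<longrightarrow> (ell(i := Suc s)) j \<le> fst x)"
      using info_none_unmarked by (auto split: if_splits)
  next
    fix j d assume d: "own F j = Some d"
    show "if info ?c j = None \<and> prefix d (loc ?c j) then dfs T ?c d (loc ?c j) else below T d \<subseteq> seen ?c"
    proof (cases "j = i")
      case True
      then show ?thesis using own_at_marked[of i d] m d by auto
    next
      case False
      then show ?thesis using own_dfs[OF d] dfs_mono[of T c d "loc c j" ?c] by (auto split: if_splits)
    qed
  next
    fix v assume "mark (wall ?c v) = None" "finished (wall ?c v)"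
    then show "below T v \<subseteq> seen ?c" using unmarked_finished[of v] by auto
  next
    fix v p assume "mark (wall ?c v) = None" "p \<in> set (butlast (taken (wall ?c v)))"
    then show "below T (v @ [p]) \<subseteq> seen ?c" using unmarked_taken[of v p] by auto
  next
    show "valid (\<lambda>l. alive (opens F) l \<or> l = tr S \<and> \<not> exhausted T ?c l) t"
      using tree_valid exh unfolding valid_def by (auto intro: capped_mono_labels)
  next
    fix v assume "v \<in> T" "v \<notin> seen ?c"
    then show "(\<exists>d \<in> opens F. prefix d v) \<or>
      \<not> pending ?c S tr \<and> prefix (tr S) v \<and>
        (v = tr S \<or> v ! length (tr S) \<notin> set (taken (wall ?c (tr S))))"
      using coverage[of v] pend by simp
  next
    fix v assume "mark (wall ?c v) \<noteq> None"
    then show "exhausted T ?c v \<or> \<not> pending ?c S tr \<and> v = tr S \<and> v \<in> labels t"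
      using marked_exhausted[of v] exh pend by auto
  next
    show "Suc n + (\<Sum>j<k. length (loc ?c j)) \<le>
      2 * ((\<Sum>v\<in>T. length (taken (wall ?c v))) + (\<Sum>j<k. descents tr ((ell(i := Suc s)) j)))"
      using cnt by simp
  qed (unfold wall pend, (rule persistent touched own_props label_taken; assumption)+)
qed

lemma mark_le:
  assumes "mark (wall c z) = Some x"
  shows "fst x \<le> S"
proof -
  obtain s d t' F' where x: "x = (s, d, t', F')" by (cases x)
  show ?thesis
  proof (cases d)
    case None
    then show ?thesis using mark_front[of z s t' F'] assms x by simp
  next
    case (Some u)
    then show ?thesis using mark_depart[of z s u t' F'] assms x by simp
  qed
qed

text \<open>A marked node with an untaken edge is a label, so the new open edge lies below an
  existing live leaf and the search tree need not change. The record of robot \<open>i\<close> can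
  be overwritten because its previous subtree has been seen.\<close>

lemma take_port:
  assumes i: "i < k" and m: "mark (wall c (loc c i)) = Some (s, None, \<sigma>)"
    and pT: "loc c i @ [p] \<in> T" and pn: "p \<notin> set (taken (wall c (loc c i)))"
  shows "state k T
    (acted i (Board (taken (wall c (loc c i)) @ [p]) (finished (wall c (loc c i)))
       (Some (s, None, t, F[i := Some (loc c i @ [p])]))) None (loc c i @ [p]) c)
    S tr t (F[i := Some (loc c i @ [p])]) ell (Suc n)"
proof -
  let ?v = "loc c i"
  let ?d = "?v @ [p]"
  let ?F = "F[i := Some ?d]"
  let ?b = "Board (taken (wall c ?v) @ [p]) (finished (wall c ?v)) (Some (s, None, t, ?F))"
  let ?c = "acted i ?b None ?d c"
  have front: "s = S" "tr S = ?v" "\<sigma> = (t, F)" using m mark_front by (cases \<sigma>; fastforce)+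
  have np: "\<not> pending c S tr" "\<not> pending ?c S tr"
    using m front by (auto simp: pending_def)
  have "\<not> exhausted T c ?v" using pT pn by (auto simp: exhausted_def)
  then have vl: "?v \<in> labels t" using marked_exhausted[of ?v] m by auto
  have dm: "mark (wall c ?d) = None" using label_top[OF vl, of ?d] by fastforce
  have db: "wall c ?d = blank" using touched[of ?d] pn by fastforce
  have own: "own ?F j = (if j = i then Some ?d else own F j)" for j using i len_F by simp
  have opens: "x \<in> opens ?F \<Longrightarrow> x = ?d \<or> x \<in> opens F" for x
    unfolding opens_own own by (auto split: if_splits)
  have dF: "?d \<in> opens ?F" unfolding opens_own own by auto
  have marked: "mark (wall ?c z) = None \<longleftrightarrow> mark (wall c z) = None" for z using m by simp
  have taken_mono: "x \<in> set (taken (wall c z)) \<Longrightarrow> x \<in> set (taken (wall ?c z))" for x z by auto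
  have exh: "exhausted T c z \<Longrightarrow> exhausted T ?c z" for z by (auto simp: exhausted_def)
  have cnt: "Suc n + (\<Sum>j<k. length (loc ?c j)) \<le>
      2 * ((\<Sum>z\<in>T. length (taken (wall ?c z))) + (\<Sum>j<k. descents tr (ell j)))"
  proof -
    have "(\<Sum>j<k. length (((loc c)(i := ?d)) j)) + length ?v = (\<Sum>j<k. length (loc c j)) + length ?d"
      using sum_fun_upd[of "{..<k}" i length "loc c" ?d] i by simp
    moreover have "(\<Sum>z\<in>T. length (taken (((wall c)(?v := ?b)) z))) + length (taken (wall c ?v)) =
        (\<Sum>z\<in>T. length (taken (wall c z))) + length (taken ?b)"
      using sum_fun_upd[of T ?v "\<lambda>b. length (taken b)" "wall c" ?b] tree loc_in
      by (simp add: rooted_tree_def del: fun_upd_apply)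
    moreover have "wall ?c = (wall c)(?v := ?b)" by (simp add: acted_def)
    ultimately show ?thesis using count by (simp del: fun_upd_apply acted_simps(3))
  qed
  show ?thesis
  proof unfold_locales
    fix j show "loc ?c j \<in> T" using loc_in pT by simp
  next
    fix j assume "loc ?c j \<noteq> []"
    then show "last (loc ?c j) \<in> set (taken (wall ?c (butlast (loc ?c j))))"
      using loc_taken[of j] by auto
  next
    fix z show "distinct (taken (wall ?c z))" using taken_distinct[of z] pn by auto
  next
    fix q z assume "q \<in> set (taken (wall ?c z))"
    then show "z @ [q] \<in> T" using taken_in[of q z] pT by (auto split: if_splits)
  next
    fix z assume z: "z \<noteq> []" "wall ?c z \<noteq> blank"
    have "last z \<in> set (taken (wall c (butlast z)))"
    proof (cases "z = ?v")
      case True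
      then show ?thesis using node_taken[of z] m z by simp
    next
      case False
      then show ?thesis using touched z by simp
    qed
    then show "last z \<in> set (taken (wall ?c (butlast z)))" by (rule taken_mono)
  next
    show "mark (wall ?c []) \<noteq> None" unfolding marked by (rule root_marked)
  next
    fix z w assume "mark (wall ?c z) \<noteq> None" "prefix w z"
    then show "mark (wall ?c w) \<noteq> None" using marked_prefix[of z w] unfolding marked by blast
  next
    fix z s' u t' F' assume "mark (wall ?c z) = Some (s', Some u, t', F')"
    then show "s' < S \<and> tr s' = z \<and> u = tr (Suc s') \<and>
      (Suc s' = S \<longrightarrow> pending ?c S tr \<longrightarrow> t' = t \<and> F' = ?F)"
      using mark_depart[of z s' u t' F'] np by (auto split: if_splits)
  next
    fix z s' t' F' assume "mark (wall ?c z) = Some (s', None, t', F')"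
    then show "s' = S \<and> tr S = z \<and> t' = t \<and> F' = ?F"
      using mark_front[of z s' t' F'] front by (auto split: if_splits)
  next
    fix s' assume "s' < S"
    then show "\<exists>x. mark (wall ?c (tr s')) = Some x \<and> s' \<le> fst x"
      using mark_recent[of s'] front by auto
  next
    fix j s' t' F' assume "info ?c j = Some (s', t', F')"
    then show "s' \<le> S \<and> tr s' = loc ?c j \<and> ell j \<le> s' \<and>
      (s' = S \<longrightarrow> pending ?c S tr \<longrightarrow> t' = t \<and> F' = ?F)"
      using info_some[of j s' t' F'] np by (auto split: if_splits)
  next
    fix j x assume *: "info ?c j = None" "mark (wall ?c (loc ?c j)) = Some x"
    show "ell j \<le> fst x"
    proof (cases "loc ?c j = ?v")
      case True
      then show ?thesis using * ell_le[of j] front by auto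
    next
      case False
      then show ?thesis using * info_none_marked[of j x] dm by (auto split: if_splits)
    qed
  next
    fix j assume *: "info ?c j = None" "mark (wall ?c (loc ?c j)) = None"
    show "\<exists>d. own ?F j = Some d \<and> prefix d (loc ?c j) \<and>
        (\<forall>x. mark (wall ?c (butlast d)) = Some x \<longrightarrow> ell j \<le> fst x)"
    proof (cases "j = i")
      case True
      then show ?thesis using i len_F ell_le[of i] front by (intro exI[of _ ?d]) auto
    next
      case False
      then obtain d where "own F j = Some d" "prefix d (loc c j)"
        "\<forall>x. mark (wall c (butlast d)) = Some x \<longrightarrow> ell j \<le> fst x"
        using * info_none_unmarked[of j] marked by auto
      then show ?thesis using False ell_le[of j] front by (intro exI[of _ d]) auto
    qed
  next
    show "length ?F = k" using len_F by simp
  next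
    fix j d assume d: "own ?F j = Some d"
    show "d \<noteq> [] \<and> d \<in> T \<and> mark (wall ?c d) = None \<and>
      mark (wall ?c (butlast d)) \<noteq> None \<and> last d \<in> set (taken (wall ?c (butlast d)))"
    proof (cases "j = i")
      case True
      then have "d = ?d" using d i len_F by simp
      then show ?thesis using pT dm by auto
    next
      case False
      then have "own F j = Some d" using d i len_F by simp
      from own_props[OF this] show ?thesis unfolding marked using taken_mono by blast
    qed
  next
    fix j d assume d: "own ?F j = Some d"
    show "if info ?c j = None \<and> prefix d (loc ?c j) then dfs T ?c d (loc ?c j) else below T d \<subseteq> seen ?c"
    proof (cases "j = i")
      case True
      then have "d = ?d" using d i len_F by simp
      moreover have "dfs T ?c ?d ?d" using db by (auto simp: dfs_def blank_def)
      ultimately show ?thesis using True by simp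
    next
      case False
      then have d': "own F j = Some d" using d i len_F by simp
      have "prefix d z \<Longrightarrow> z \<noteq> ?v" for z using unmarked_mono[of d z] own_props[OF d'] m by auto
      then show ?thesis using own_dfs[OF d'] dfs_mono[of T c d "loc c j" ?c] False by (auto split: if_splits)
    qed
  next
    fix j j' d assume "own ?F j = Some d" "own ?F j' = Some d"
    moreover have "own F j'' \<noteq> Some ?d" for j'' using own_props[of j'' ?d] pn by auto
    ultimately show "j = j'" using own_inj by (auto simp: own split: if_splits)
  next
    fix z assume "mark (wall ?c z) = None" "finished (wall ?c z)"
    then show "below T z \<subseteq> seen ?c" using unmarked_finished[of z] m by (auto split: if_splits)
  next
    fix z q assume "mark (wall ?c z) = None" "q \<in> set (butlast (taken (wall ?c z)))"
    then show "below T (z @ [q]) \<subseteq> seen ?c" using unmarked_taken[of z q] by (auto split: if_splits)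
  next
    have "alive (opens F) l \<or> l = ?v" if "l \<in> labels t" "alive (opens ?F) l" for l
    proof -
      from that(2) obtain x where x: "x \<in> opens ?F" "prefix l x" by (auto simp: alive_def)
      from opens[OF x(1)] show ?thesis
      proof
        assume "x = ?d"
        then have "prefix l ?v \<or> l = ?d" using x by (metis prefix_snoc)
        moreover have "l \<noteq> ?d" using labels_antichain[OF vl that(1)] by auto
        ultimately show ?thesis using labels_antichain[OF that(1) vl] by simp
      qed (use x in \<open>auto simp: alive_def\<close>)
    qed
    then have "capped (\<lambda>l. alive (opens ?F) l \<or> l = tr S \<and> \<not> exhausted T ?c l) t"
      using tree_valid front \<open>\<not> exhausted T c ?v\<close> unfolding valid_def
      by (auto intro: capped_mono_labels)
    then show "valid (\<lambda>l. alive (opens ?F) l \<or> l = tr S \<and> \<not> exhausted T ?c l) t"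
      using tree_valid by (simp add: valid_def)
  next
    fix d assume "d \<in> opens ?F"
    then show "\<exists>l \<in> labels t. prefix l d" using opens[of d] tree_cover vl by (auto intro: bexI[of _ ?v])
  next
    fix l z assume "l \<in> labels t" "mark (wall ?c z) \<noteq> None" "prefix l z"
    then show "z = l" using label_top unfolding marked by blast
  next
    fix l z assume "l \<in> labels t" "strict_prefix z l"
    then show "mark (wall ?c z) \<noteq> None" using label_prefix unfolding marked by blast
  next
    fix l assume "l \<in> labels t" "l \<noteq> []"
    then show "last l \<in> set (taken (wall ?c (butlast l)))" using label_taken taken_mono by blast
  next
    show "pending ?c S tr \<Longrightarrow> mark (wall ?c (tr S)) = None \<Longrightarrow> tr S \<in> labels t" using np by simp
  next
    fix w assume w: "w \<in> T" "w \<notin> seen ?c"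
    then have w': "w \<notin> seen c" "w \<noteq> ?v" by auto
    consider (opn) d where "d \<in> opens F" "prefix d w"
      | (port) "prefix ?v w" "w ! length ?v \<notin> set (taken (wall c ?v))"
      using coverage[OF w(1) w'(1)] w'(2) front by auto
    then show "(\<exists>d \<in> opens ?F. prefix d w) \<or>
      \<not> pending ?c S tr \<and> prefix (tr S) w \<and>
        (w = tr S \<or> w ! length (tr S) \<notin> set (taken (wall ?c (tr S))))"
    proof cases
      case opn
      then obtain j where j: "own F j = Some d" by (auto simp: opens_own)
      have "j \<noteq> i" using own_at_marked[of i d] m j opn w w' by (auto simp: below_def)
      then have "own ?F j = Some d" using j i len_F by simp
      then have "d \<in> opens ?F" unfolding opens_own by blast
      then show ?thesis using opn by blast
    next
      case port
      then obtain p' r where pr: "w = ?v @ p' # r"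
        using w' by (metis append.right_neutral neq_Nil_conv prefix_def)
      show ?thesis
      proof (cases "p' = p")
        case True
        then have "prefix ?d w" using pr by simp
        then show ?thesis using dF by blast
      next
        case False
        then show ?thesis using port np front pr by simp
      qed
    qed
  next
    fix z assume "mark (wall ?c z) \<noteq> None"
    then have "mark (wall c z) \<noteq> None" unfolding marked .
    then show "exhausted T ?c z \<or> \<not> pending ?c S tr \<and> z = tr S \<and> z \<in> labels t"
      using marked_exhausted[of z] exh np by auto
  next
    show "Suc n + (\<Sum>j<k. length (loc ?c j)) \<le>
      2 * ((\<Sum>z\<in>T. length (taken (wall ?c z))) + (\<Sum>j<k. descents tr (ell j)))" by (rule cnt)
  qed (use tr_in tr_adj ell_le cost val_bound in simp_all)
qed

text \<open>The active robot is on the path, hence done with its own subtree, and its record is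
  cleared before replanning. The move itself is already paid for: the potential contains the descent
  from the searcher to the virtual position, and the target of the new tree is that
  position.\<close>

lemma depart:
  assumes i: "i < k" and m: "mark (wall c (loc c i)) = Some (s, None, \<sigma>)"
    and full: "\<And>p. loc c i @ [p] \<in> T \<Longrightarrow> p \<in> set (taken (wall c (loc c i)))"
    and re: "replan (loc c i) (opens (F[i := None])) t t'"
    and u: "u = toward (loc c i) (target t')"
  shows "state k T
    (acted i (Board (taken (wall c (loc c i))) (finished (wall c (loc c i)))
       (Some (s, Some u, t', F[i := None]))) (Some (Suc s, t', F[i := None])) u c)
    (Suc S) (tr(Suc S := u)) t' (F[i := None]) (ell(i := Suc S)) (Suc n)"
    and "u \<in> adjacent T (loc c i)"
proof -
  let ?v = "loc c i"
  let ?F = "F[i := None]"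
  let ?b = "Board (taken (wall c ?v)) (finished (wall c ?v)) (Some (s, Some u, t', ?F))"
  let ?c = "acted i ?b (Some (Suc s, t', ?F)) u c"
  let ?tr = "tr(Suc S := u)"
  let ?ell = "ell(i := Suc S)"
  have front: "s = S" "tr S = ?v" "\<sigma> = (t, F)" using m mark_front by (cases \<sigma>; fastforce)+
  have own: "own ?F j = (if j = i then None else own F j)" for j using i len_F by simp
  have opens: "x \<in> opens ?F \<Longrightarrow> x \<in> opens F" for x
    unfolding opens_own own by (auto split: if_splits)
  have marked: "mark (wall ?c z) = None \<longleftrightarrow> mark (wall c z) = None" for z using m by simp
  have tk: "taken (wall ?c z) = taken (wall c z)" "finished (wall ?c z) = finished (wall c z)" for z
    by auto
  have exh: "exhausted T c z \<Longrightarrow> exhausted T ?c z" "exhausted T ?c ?v" for z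
    using full by (auto simp: exhausted_def)
  note re' = re[unfolded replan_def]
  let ?w = "target t'"
  have wv: "?v \<noteq> ?w" using re' by auto
  have openT: "d \<in> T" if "d \<in> opens ?F" for d
    using that own_props unfolding opens_own own by (auto split: if_splits)
  have aliveT: "l \<in> T" if "alive (opens ?F) l" for l
    using that openT prefix_in_tree unfolding alive_def by blast
  \<comment> \<open>A new label is the lower end of a recorded edge, and \<open>own_props\<close>
    provides there the properties demanded of labels.\<close>
  have lab: "x \<in> labels t \<or> (\<exists>j. own F j = Some x)" if "x \<in> labels t'" for x
    using re' that opens unfolding opens_own by blast
  have lab_top: "z = x" if x: "x \<in> labels t'" "mark (wall c z) \<noteq> None" "prefix x z" for x z
    using lab[OF x(1)] label_top x own_props marked_prefix by blast
  have lab_prefix: "mark (wall c z) \<noteq> None" if x: "x \<in> labels t'" "strict_prefix z x" for x z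
    using lab[OF x(1)]
  proof
    assume "\<exists>j. own F j = Some x"
    then have "x \<noteq> []" "mark (wall c (butlast x)) \<noteq> None" using own_props by auto
    moreover have "prefix z (butlast x)"
      using x(2) \<open>x \<noteq> []\<close> by (metis append_butlast_last_id prefix_order.less_le prefix_snoc)
    ultimately show ?thesis using marked_prefix by blast
  qed (use label_prefix x in blast)
  have lab_taken: "last x \<in> set (taken (wall c (butlast x)))" if "x \<in> labels t'" "x \<noteq> []" for x
    using lab[OF that(1)] label_taken own_props that by blast
  have u_adj: "u \<in> adjacent T ?v"
  proof (cases "prefix ?v ?w")
    case True
    then obtain p where "prefix u ?w" "u = ?v @ [p]" using toward_props(2)[OF wv True] u by blast
    then show ?thesis using aliveT[of ?w] re' prefix_in_tree adjacent_snoc by metis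
  next
    case False
    then show ?thesis using toward_props(3)[OF wv False] adjacent_butlast loc_in u by simp
  qed
  then show "u \<in> adjacent T ?v" .
  have uv: "u \<noteq> ?v" using u_adj by (auto simp: adjacent_def)
  have u_mark: "mark (wall c u) \<noteq> None \<or> u = ?w"
  proof (cases "prefix ?v ?w")
    case True
    then show ?thesis
      using toward_props(2)[OF wv True] u lab_prefix[of ?w u] by (auto simp: prefix_order.le_less)
  next
    case False
    then have "prefix u ?v" using toward_props(3)[OF wv False] u prefixeq_butlast[of ?v] by simp
    then show ?thesis using marked_prefix[of ?v u] m by simp
  qed
  then have u_taken: "u \<noteq> [] \<Longrightarrow> last u \<in> set (taken (wall c (butlast u)))"
    using node_taken[of u] lab_taken[of u] by auto
  have pend: "pending ?c (Suc S) ?tr"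
    using mark_le[of u] uv by (fastforce simp: pending_def)
  have desc: "descents ?tr m' = descents tr m'" if "m' \<le> S" for m'
    using that by (intro descents_cong) auto
  have descS: "descents ?tr (Suc S) = descents tr S + (if length ?v < length u then 1 else 0)"
    using descents_step[of ?tr S] desc[of S] front by simp
  have cnt: "Suc n + (\<Sum>j<k. length (loc ?c j)) \<le>
      2 * ((\<Sum>v\<in>T. length (taken (wall c v))) + (\<Sum>j<k. descents ?tr (?ell j)))"
  proof -
    have "(\<Sum>j<k. length (((loc c)(i := u)) j)) + length ?v = (\<Sum>j<k. length (loc c j)) + length u"
      using sum_fun_upd[of "{..<k}" i length "loc c" u] i by simp
    moreover have "(\<Sum>j<k. descents ?tr (?ell j)) + descents ?tr (ell i) =
        (\<Sum>j<k. descents ?tr (ell j)) + descents ?tr (Suc S)"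
      using sum_fun_upd[of "{..<k}" i "descents ?tr" ell "Suc S"] i by simp
    moreover have "(\<Sum>j<k. descents ?tr (ell j)) = (\<Sum>j<k. descents tr (ell j))"
      using desc ell_le by simp
    moreover have "descents ?tr (ell i) + (if length ?v < length u then 1 else 0) \<le> descents ?tr (Suc S)"
      using descS descents_mono[OF ell_le[of i], of tr] desc[OF ell_le[of i]] by simp
    moreover have "length u = Suc (length ?v) \<or> Suc (length u) = length ?v"
      using u_adj by (auto simp: adjacent_def)
    ultimately show ?thesis using count by (auto split: if_splits)
  qed
  have vp: "vpos [] t' = ?w" using re' vpos_eq_target by simp
  show "state k T ?c (Suc S) ?tr t' ?F ?ell (Suc n)"
  proof unfold_locales
    fix j show "loc ?c j \<in> T" using loc_in u_adj by (simp add: adjacent_def)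
  next
    fix j assume "loc ?c j \<noteq> []"
    then show "last (loc ?c j) \<in> set (taken (wall ?c (butlast (loc ?c j))))"
      using loc_taken[of j] u_taken by (auto split: if_splits)
  next
    fix z assume z: "z \<noteq> []" "wall ?c z \<noteq> blank"
    have "last z \<in> set (taken (wall c (butlast z)))"
    proof (cases "z = ?v")
      case True
      then show ?thesis using node_taken[of z] m z by simp
    next
      case False
      then show ?thesis using touched z by simp
    qed
    then show "last z \<in> set (taken (wall ?c (butlast z)))" by auto
  next
    show "mark (wall ?c []) \<noteq> None" unfolding marked by (rule root_marked)
  next
    fix z w assume "mark (wall ?c z) \<noteq> None" "prefix w z"
    then show "mark (wall ?c w) \<noteq> None" using marked_prefix[of z w] unfolding marked by blast
  next
    fix s' assume "s' \<le> Suc S"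
    then show "?tr s' \<in> T" using tr_in u_adj by (auto simp: adjacent_def)
  next
    fix s' assume "s' < Suc S"
    then show "?tr (Suc s') \<in> adjacent T (?tr s')" using tr_adj[of s'] u_adj front by (auto simp: less_Suc_eq)
  next
    fix z s' u' t'' F' assume *: "mark (wall ?c z) = Some (s', Some u', t'', F')"
    show "s' < Suc S \<and> ?tr s' = z \<and> u' = ?tr (Suc s') \<and>
      (Suc s' = Suc S \<longrightarrow> pending ?c (Suc S) ?tr \<longrightarrow> t'' = t' \<and> F' = ?F)"
    proof (cases "z = ?v")
      case True
      then show ?thesis using * front by auto
    next
      case False
      then show ?thesis using * mark_depart[of z s' u' t'' F'] by auto
    qed
  next
    fix z s' t'' F' assume "mark (wall ?c z) = Some (s', None, t'', F')"
    then show "s' = Suc S \<and> ?tr (Suc S) = z \<and> t'' = t' \<and> F' = ?F"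
      using mark_front[of z s' t'' F'] front by (auto split: if_splits)
  next
    fix s' assume "s' < Suc S"
    then show "\<exists>x. mark (wall ?c (?tr s')) = Some x \<and> s' \<le> fst x"
      using mark_recent[of s'] front by (auto simp: less_Suc_eq)
  next
    fix j s' t'' F' assume "info ?c j = Some (s', t'', F')"
    then show "s' \<le> Suc S \<and> ?tr s' = loc ?c j \<and> ?ell j \<le> s' \<and>
      (s' = Suc S \<longrightarrow> pending ?c (Suc S) ?tr \<longrightarrow> t'' = t' \<and> F' = ?F)"
      using info_some[of j s' t'' F'] front by (auto split: if_splits)
  next
    fix j show "?ell j \<le> Suc S" using ell_le[of j] by simp
  next
    fix j x assume *: "info ?c j = None" "mark (wall ?c (loc ?c j)) = Some x"
    then have "j \<noteq> i" by auto
    then show "?ell j \<le> fst x"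
      using * info_none_marked[of j] ell_le[of j] front by (auto split: if_splits)
  next
    fix j assume *: "info ?c j = None" "mark (wall ?c (loc ?c j)) = None"
    then have ji: "j \<noteq> i" by auto
    then obtain d where "own F j = Some d" "prefix d (loc c j)"
      "\<forall>x. mark (wall c (butlast d)) = Some x \<longrightarrow> ell j \<le> fst x"
      using * info_none_unmarked[of j] marked by auto
    then show "\<exists>d. own ?F j = Some d \<and> prefix d (loc ?c j) \<and>
        (\<forall>x. mark (wall ?c (butlast d)) = Some x \<longrightarrow> ?ell j \<le> fst x)"
      using ji ell_le[of j] front by (intro exI[of _ d]) auto
  next
    show "length ?F = k" using len_F by simp
  next
    fix j d assume "own ?F j = Some d"
    then have "own F j = Some d" using own by (auto split: if_splits)
    from own_props[OF this] show "d \<noteq> [] \<and> d \<in> T \<and> mark (wall ?c d) = None \<and>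
      mark (wall ?c (butlast d)) \<noteq> None \<and> last d \<in> set (taken (wall ?c (butlast d)))"
      unfolding marked tk .
  next
    fix j d assume "own ?F j = Some d"
    then have d: "own F j = Some d" "j \<noteq> i" using own by (auto split: if_splits)
    have "dfs T ?c d y" if "dfs T c d y" "prefix d y" for y
      by (rule dfs_mono[OF that(1) _ _ that(2)]) auto
    then show "if info ?c j = None \<and> prefix d (loc ?c j) then dfs T ?c d (loc ?c j) else below T d \<subseteq> seen ?c"
      using own_dfs[OF d(1)] d(2) by (auto split: if_splits)
  next
    fix j j' d assume "own ?F j = Some d" "own ?F j' = Some d"
    then show "j = j'" using own_inj by (auto simp: own split: if_splits)
  next
    fix z assume "mark (wall ?c z) = None" "finished (wall ?c z)"
    then show "below T z \<subseteq> seen ?c" using unmarked_finished[of z] unfolding marked tk by auto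
  next
    fix z q assume "mark (wall ?c z) = None" "q \<in> set (butlast (taken (wall ?c z)))"
    then show "below T (z @ [q]) \<subseteq> seen ?c" using unmarked_taken[of z q] unfolding marked tk by auto
  next
    \<comment> \<open>If \<open>u\<close> is marked it is exhausted and the second clause of
      liveness is void; otherwise \<open>u\<close> is the new target, which is alive in any
      case.\<close>
    have "alive (opens ?F) l" if "l = u" "\<not> exhausted T ?c l" for l
    proof -
      have "mark (wall c u) = None"
      proof (rule ccontr)
        assume "mark (wall c u) \<noteq> None"
        then have "exhausted T c u" using marked_exhausted[of u] uv front by simp
        then show False using that exh(1) by blast
      qed
      then show ?thesis using u_mark re' that by auto
    qed
    then show "valid (\<lambda>l. alive (opens ?F) l \<or> l = ?tr (Suc S) \<and> \<not> exhausted T ?c l) t'"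
      using re' unfolding valid_def by (auto intro: capped_mono_labels)
  next
    fix d assume "d \<in> opens ?F"
    then show "\<exists>l \<in> labels t'. prefix l d" using re' by blast
  next
    fix l z assume "l \<in> labels t'" "mark (wall ?c z) \<noteq> None" "prefix l z"
    then show "z = l" using lab_top unfolding marked by blast
  next
    fix l z assume "l \<in> labels t'" "strict_prefix z l"
    then show "mark (wall ?c z) \<noteq> None" using lab_prefix unfolding marked by blast
  next
    fix l assume "l \<in> labels t'" "l \<noteq> []"
    then show "last l \<in> set (taken (wall ?c (butlast l)))" using lab_taken[of l] by auto
  next
    assume "mark (wall ?c (?tr (Suc S))) = None"
    then show "?tr (Suc S) \<in> labels t'" using u_mark uv by auto
  next
    fix w assume w: "w \<in> T" "w \<notin> seen ?c"
    then have w': "w \<notin> seen c" "w \<noteq> ?v" by auto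
    have "\<not> (prefix ?v w \<and> w ! length ?v \<notin> set (taken (wall c ?v)))"
    proof
      assume *: "prefix ?v w \<and> w ! length ?v \<notin> set (taken (wall c ?v))"
      then obtain p' r where pr: "w = ?v @ p' # r"
        using w' by (metis append.right_neutral neq_Nil_conv prefix_def)
      then have "?v @ [p'] \<in> T" using prefix_in_tree[OF w(1), of "?v @ [p']"] by simp
      then show False using full[of p'] * pr by simp
    qed
    then obtain d where d: "d \<in> opens F" "prefix d w"
      using coverage[OF w(1) w'(1)] w'(2) front by auto
    then obtain j where j: "own F j = Some d" by (auto simp: opens_own)
    have "j \<noteq> i" using own_at_marked[of i d] m j d w w' by (auto simp: below_def)
    then have "own ?F j = Some d" using j i len_F by simp
    then have "d \<in> opens ?F" unfolding opens_own by blast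
    then show "(\<exists>d \<in> opens ?F. prefix d w) \<or>
      \<not> pending ?c (Suc S) ?tr \<and> prefix (?tr (Suc S)) w \<and>
        (w = ?tr (Suc S) \<or> w ! length (?tr (Suc S)) \<notin> set (taken (wall ?c (?tr (Suc S)))))"
      using d by blast
  next
    fix z assume "mark (wall ?c z) \<noteq> None"
    then have "mark (wall c z) \<noteq> None" unfolding marked .
    then have "exhausted T c z \<or> z = ?v" using marked_exhausted[of z] front by auto
    then have "exhausted T ?c z" using exh by blast
    then show "exhausted T ?c z \<or> \<not> pending ?c (Suc S) ?tr \<and> z = ?tr (Suc S) \<and> z \<in> labels t'" ..
  next
    have "real (descents ?tr (Suc S)) + descent u ?w = real (descents tr S) + descent ?v ?w"
      using toward_props(1)[OF wv] descS u by (simp split: if_splits)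
    moreover have "descent ?v ?w \<le> descent ?v (vpos [] t) + descent (vpos [] t) ?w"
      by (rule descent_triangle)
    moreover have "credit t' + descent (vpos [] t) ?w \<le> credit t + rate k * (val t' - val t)"
      using re' vp by (simp add: paid_def)
    ultimately show "real (descents ?tr (Suc S)) + real (descent (?tr (Suc S)) (vpos [] t')) + credit t'
        \<le> rate k * val t'"
      using cost front vp by (simp add: algebra_simps)
  next
    have "\<forall>l \<in> labels t'. alive (opens ?F) l \<longrightarrow> length l \<le> depth T"
      using aliveT length_le_depth by blast
    moreover have "\<exists>l \<in> labels t'. alive (opens ?F) l" using re' target_in_labels by blast
    ultimately have "val t' + real 0 \<le> real (depth T) + 1"
      using re' by (intro val_le_depth[where P = "alive (opens ?F)" and u = "[]"]) (auto simp: valid_def)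
    then show "val t' \<le> real (depth T) + 1" by simp
  next
    show "Suc n + (\<Sum>j<k. length (loc ?c j)) \<le>
      2 * ((\<Sum>v\<in>T. length (taken (wall ?c v))) + (\<Sum>j<k. descents ?tr (?ell j)))" unfolding tk by (rule cnt)
  qed (unfold tk, use taken_distinct taken_in in simp_all)
qed

text \<open>The search has finished the ports taken so far at its node, so the new port may become
  the last one: everything below its predecessors has been seen.\<close>

lemma dfs_down:
  assumes m: "mark (wall c (loc c i)) = None" and inf: "info c i = None"
    and pT: "loc c i @ [p] \<in> T" and pn: "p \<notin> set (taken (wall c (loc c i)))"
  shows "state k T
    (acted i (Board (taken (wall c (loc c i)) @ [p]) (finished (wall c (loc c i))) None)
       None (loc c i @ [p]) c)
    S tr t F ell (Suc n)"
proof -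
  let ?v = "loc c i"
  let ?w = "?v @ [p]"
  let ?b = "Board (taken (wall c ?v) @ [p]) (finished (wall c ?v)) None"
  let ?c = "acted i ?b None ?w c"
  obtain d where d: "own F i = Some d" "prefix d ?v"
    "\<forall>x. mark (wall c (butlast d)) = Some x \<longrightarrow> ell i \<le> fst x"
    using info_none_unmarked inf m by blast
  have i: "i < k" using d(1) len_F by (auto simp: own_def split: if_splits)
  have dfs: "dfs T c d ?v" using own_dfs[OF d(1)] inf d(2) by simp
  have vr: "?v \<noteq> []" using m root_marked by auto
  have wm: "mark (wall c ?w) = None" using unmarked_mono[OF m, of ?w] by simp
  \<comment> \<open>A node whose whiteboard has been touched is reached through a taken port, and
    \<open>p\<close> is untaken.\<close>
  have wb: "wall c ?w = blank" using touched[of ?w] pn by fastforce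
  have marked [simp]: "mark (wall ?c z) = mark (wall c z)" for z using m by simp
  have taken_mono: "x \<in> set (taken (wall c z)) \<Longrightarrow> x \<in> set (taken (wall ?c z))" for x z by auto
  have exh: "exhausted T c z \<Longrightarrow> exhausted T ?c z" for z by (auto simp: exhausted_def)
  have pend: "pending ?c S tr = pending c S tr" unfolding pending_def marked by (rule refl)
  have front: "tr S \<noteq> ?v" if "\<not> pending c S tr" using that m by (auto simp: pending_def)
  have cnt: "Suc n + (\<Sum>j<k. length (loc ?c j)) \<le>
      2 * ((\<Sum>z\<in>T. length (taken (wall ?c z))) + (\<Sum>j<k. descents tr (ell j)))"
  proof -
    have "(\<Sum>j<k. length (((loc c)(i := ?w)) j)) + length ?v = (\<Sum>j<k. length (loc c j)) + length ?w"
      using sum_fun_upd[of "{..<k}" i length "loc c" ?w] i by simp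
    moreover have "(\<Sum>z\<in>T. length (taken (((wall c)(?v := ?b)) z))) + length (taken (wall c ?v)) =
        (\<Sum>z\<in>T. length (taken (wall c z))) + length (taken ?b)"
      using sum_fun_upd[of T ?v "\<lambda>b. length (taken b)" "wall c" ?b] tree loc_in
      by (simp add: rooted_tree_def del: fun_upd_apply)
    moreover have "wall ?c = (wall c)(?v := ?b)" by (simp add: acted_def)
    ultimately show ?thesis using count by (simp del: fun_upd_apply acted_simps(3))
  qed
  show ?thesis
  proof unfold_locales
    fix j show "loc ?c j \<in> T" using loc_in pT by simp
  next
    fix j assume "loc ?c j \<noteq> []"
    then show "last (loc ?c j) \<in> set (taken (wall ?c (butlast (loc ?c j))))"
      using loc_taken[of j] by auto
  next
    fix z show "distinct (taken (wall ?c z))" using taken_distinct[of z] pn by auto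
  next
    fix q z assume "q \<in> set (taken (wall ?c z))"
    then show "z @ [q] \<in> T" using taken_in[of q z] pT by (auto split: if_splits)
  next
    fix z assume z: "z \<noteq> []" "wall ?c z \<noteq> blank"
    have "last z \<in> set (taken (wall c (butlast z)))"
    proof (cases "z = ?v")
      case True
      then show ?thesis using loc_taken[of i] z by simp
    next
      case False
      then show ?thesis using touched z by simp
    qed
    then show "last z \<in> set (taken (wall ?c (butlast z)))" by (rule taken_mono)
  next
    fix j s' t' F' assume "info ?c j = Some (s', t', F')"
    then show "s' \<le> S \<and> tr s' = loc ?c j \<and> ell j \<le> s' \<and>
      (s' = S \<longrightarrow> pending ?c S tr \<longrightarrow> t' = t \<and> F' = F)"
      using info_some[of j s' t' F'] pend by (auto split: if_splits)
  next
    fix j x assume "info ?c j = None" "mark (wall ?c (loc ?c j)) = Some x"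
    then show "ell j \<le> fst x" unfolding marked
      using info_none_marked[of j x] wm by (auto split: if_splits)
  next
    fix j assume *: "info ?c j = None" "mark (wall ?c (loc ?c j)) = None"
    show "\<exists>d. own F j = Some d \<and> prefix d (loc ?c j) \<and>
        (\<forall>x. mark (wall ?c (butlast d)) = Some x \<longrightarrow> ell j \<le> fst x)"
    proof (cases "j = i")
      case True
      then show ?thesis unfolding marked using d by (intro exI[of _ d]) auto
    next
      case False
      then show ?thesis using * info_none_unmarked[of j] unfolding marked by auto
    qed
  next
    fix j d' assume "own F j = Some d'"
    from own_props[OF this] show "d' \<noteq> [] \<and> d' \<in> T \<and> mark (wall ?c d') = None \<and>
      mark (wall ?c (butlast d')) \<noteq> None \<and> last d' \<in> set (taken (wall ?c (butlast d')))"
      unfolding marked using taken_mono by blast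
  next
    fix j d' assume d': "own F j = Some d'"
    show "if info ?c j = None \<and> prefix d' (loc ?c j) then dfs T ?c d' (loc ?c j) else below T d' \<subseteq> seen ?c"
    proof (cases "j = i")
      case True
      then have "d' = d" using d d' by simp
      have "dfs T ?c d ?w" unfolding dfs_def
      proof (intro conjI allI impI)
        fix z assume z: "prefix d z \<and> strict_prefix z ?w"
        then have zv: "z = ?v \<or> strict_prefix z ?v" by (auto simp: strict_prefix_def)
        then show "z \<in> seen ?c" "\<not> finished (wall ?c z)" "taken (wall ?c z) \<noteq> []"
          using dfs z by (auto simp: dfs_def)
        show "prefix (z @ [last (taken (wall ?c z))]) ?w"
          using zv dfs z by (auto simp: dfs_def prefix_order.less_le)
      qed (use wb in \<open>auto simp: blank_def\<close>)
      then show ?thesis using True \<open>d' = d\<close> d(2) by simp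
    next
      case False
      have nv: "z \<noteq> ?v" if "prefix d' z" for z using own_unique[OF d(1) d' d(2)] that False by auto
      have "dfs T ?c d' y" if "dfs T c d' y" "prefix d' y" for y
        by (rule dfs_mono[OF that(1) _ _ that(2)]) (auto dest: nv)
      then show ?thesis using own_dfs[OF d'] False by (auto split: if_splits)
    qed
  next
    fix z assume "mark (wall ?c z) = None" "finished (wall ?c z)"
    then have "below T z \<subseteq> seen c"
      using unmarked_finished[of z] m by (auto split: if_splits)
    then show "below T z \<subseteq> seen ?c" by auto
  next
    fix z q assume *: "mark (wall ?c z) = None" "q \<in> set (butlast (taken (wall ?c z)))"
    have "below T (z @ [q]) \<subseteq> seen c"
    proof (cases "z = ?v")
      case True
      then show ?thesis using dfs * by (simp add: dfs_def)
    next
      case False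
      then show ?thesis using unmarked_taken[of z q] * by simp
    qed
    then show "below T (z @ [q]) \<subseteq> seen ?c" by auto
  next
    show "valid (\<lambda>l. alive (opens F) l \<or> l = tr S \<and> \<not> exhausted T ?c l) t"
      using tree_valid exh unfolding valid_def by (auto intro: capped_mono_labels)
  next
    fix l assume "l \<in> labels t" "l \<noteq> []"
    then show "last l \<in> set (taken (wall ?c (butlast l)))" using label_taken taken_mono by blast
  next
    fix w assume "w \<in> T" "w \<notin> seen ?c"
    then show "(\<exists>d \<in> opens F. prefix d w) \<or>
      \<not> pending ?c S tr \<and> prefix (tr S) w \<and>
        (w = tr S \<or> w ! length (tr S) \<notin> set (taken (wall ?c (tr S))))"
      using coverage[of w] pend front by auto
  next
    fix z assume "mark (wall ?c z) \<noteq> None"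
    then show "exhausted T ?c z \<or> \<not> pending ?c S tr \<and> z = tr S \<and> z \<in> labels t"
      unfolding pend marked using marked_exhausted[of z] exh by blast
  next
    show "Suc n + (\<Sum>j<k. length (loc ?c j)) \<le>
      2 * ((\<Sum>z\<in>T. length (taken (wall ?c z))) + (\<Sum>j<k. descents tr (ell j)))" by (rule cnt)
  qed (unfold pend marked, (rule persistent; assumption)+)
qed

text \<open>Without untaken ports the subtree has been seen entirely, which the flag
  \<open>finished\<close> certifies. If the node was the lower end of the recorded edge, the robot
  is back on the path; otherwise the search continues at the parent.\<close>

lemma dfs_up:
  assumes m: "mark (wall c (loc c i)) = None" and inf: "info c i = None"
    and full: "\<And>p. loc c i @ [p] \<in> T \<Longrightarrow> p \<in> set (taken (wall c (loc c i)))"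
  shows "state k T
    (acted i (Board (taken (wall c (loc c i))) True None) None (butlast (loc c i)) c)
    S tr t F ell (Suc n)"
    and "butlast (loc c i) \<in> adjacent T (loc c i)"
proof -
  let ?v = "loc c i"
  let ?w = "butlast ?v"
  let ?b = "Board (taken (wall c ?v)) True None"
  let ?c = "acted i ?b None ?w c"
  obtain d where d: "own F i = Some d" "prefix d ?v"
    "\<forall>x. mark (wall c (butlast d)) = Some x \<longrightarrow> ell i \<le> fst x"
    using info_none_unmarked inf m by blast
  have i: "i < k" using d(1) len_F by (auto simp: own_def split: if_splits)
  have dfs: "dfs T c d ?v" using own_dfs[OF d(1)] inf d(2) by simp
  have vr: "?v \<noteq> []" using m root_marked by auto
  then show adj: "?w \<in> adjacent T ?v" using adjacent_butlast loc_in by blast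
  have marked [simp]: "mark (wall ?c z) = mark (wall c z)" for z using m by simp
  have tk: "taken (wall ?c z) = taken (wall c z)" for z by auto
  have exh: "exhausted T c z \<Longrightarrow> exhausted T ?c z" for z by (auto simp: exhausted_def)
  have pend: "pending ?c S tr = pending c S tr" unfolding pending_def marked by (rule refl)
  have subtree_seen: "below T ?v \<subseteq> seen ?c"
  proof
    fix w assume w: "w \<in> below T ?v"
    show "w \<in> seen ?c"
    proof (cases "w = ?v")
      case False
      then obtain p r where pr: "w = ?v @ p # r"
        using w by (metis (mono_tags, lifting) append.right_neutral below_def mem_Collect_eq neq_Nil_conv prefix_def)
      then have "?v @ [p] \<in> T" using prefix_in_tree[of w "?v @ [p]"] w by (simp add: below_def)
      then have "below T (?v @ [p]) \<subseteq> seen c" using full[of p] dfs by (simp add: dfs_def)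
      moreover have "w \<in> below T (?v @ [p])" using w pr by (simp add: below_def prefix_def)
      ultimately show ?thesis by auto
    qed simp
  qed
  have cnt: "Suc n + (\<Sum>j<k. length (loc ?c j)) \<le>
      2 * ((\<Sum>z\<in>T. length (taken (wall c z))) + (\<Sum>j<k. descents tr (ell j)))"
  proof -
    have "(\<Sum>j<k. length (((loc c)(i := ?w)) j)) + length ?v = (\<Sum>j<k. length (loc c j)) + length ?w"
      using sum_fun_upd[of "{..<k}" i length "loc c" ?w] i by simp
    moreover have "Suc (length ?w) = length ?v" using vr by simp
    ultimately show ?thesis using count by simp
  qed
  have up: "d \<noteq> ?v \<Longrightarrow> prefix d ?w"
    using d(2) vr by (metis append_butlast_last_id prefix_snoc)
  show "state k T ?c S tr t F ell (Suc n)"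
  proof unfold_locales
    fix j show "loc ?c j \<in> T" using loc_in adj by (simp add: adjacent_def)
  next
    fix j assume *: "loc ?c j \<noteq> []"
    show "last (loc ?c j) \<in> set (taken (wall ?c (butlast (loc ?c j))))"
    proof (cases "j = i")
      case True
      have "wall c ?w \<noteq> blank" using loc_taken[of i] vr by (auto simp: blank_def)
      then show ?thesis using touched[of ?w] * True by auto
    next
      case False
      then show ?thesis using loc_taken[of j] * by auto
    qed
  next
    fix z assume z: "z \<noteq> []" "wall ?c z \<noteq> blank"
    have "last z \<in> set (taken (wall c (butlast z)))"
    proof (cases "z = ?v")
      case True
      then show ?thesis using loc_taken[of i] z by simp
    next
      case False
      then show ?thesis using touched z by simp
    qed
    then show "last z \<in> set (taken (wall ?c (butlast z)))" by auto
  next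
    fix j s' t' F' assume "info ?c j = Some (s', t', F')"
    then show "s' \<le> S \<and> tr s' = loc ?c j \<and> ell j \<le> s' \<and>
      (s' = S \<longrightarrow> pending ?c S tr \<longrightarrow> t' = t \<and> F' = F)"
      using info_some[of j s' t' F'] pend by (auto split: if_splits)
  next
    fix j x assume *: "info ?c j = None" "mark (wall ?c (loc ?c j)) = Some x"
    show "ell j \<le> fst x"
    proof (cases "j = i")
      case True
      have "d = ?v"
        using up * True own_props[OF d(1)] marked_prefix[of ?w d] unfolding marked by auto
      then show ?thesis using * d(3) True unfolding marked by simp
    next
      case False
      then show ?thesis using * info_none_marked[of j x] unfolding marked by simp
    qed
  next
    fix j assume *: "info ?c j = None" "mark (wall ?c (loc ?c j)) = None"
    show "\<exists>d. own F j = Some d \<and> prefix d (loc ?c j) \<and>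
        (\<forall>x. mark (wall ?c (butlast d)) = Some x \<longrightarrow> ell j \<le> fst x)"
    proof (cases "j = i")
      case True
      have "d \<noteq> ?v" using * own_props[OF d(1)] True unfolding marked by auto
      then show ?thesis unfolding marked using d up True by (intro exI[of _ d]) auto
    next
      case False
      then show ?thesis using * info_none_unmarked[of j] unfolding marked by auto
    qed
  next
    fix j d' assume "own F j = Some d'"
    from own_props[OF this] show "d' \<noteq> [] \<and> d' \<in> T \<and> mark (wall ?c d') = None \<and>
      mark (wall ?c (butlast d')) \<noteq> None \<and> last d' \<in> set (taken (wall ?c (butlast d')))"
      unfolding marked tk .
  next
    fix j d' assume d': "own F j = Some d'"
    show "if info ?c j = None \<and> prefix d' (loc ?c j) then dfs T ?c d' (loc ?c j) else below T d' \<subseteq> seen ?c"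
    proof (cases "j = i")
      case True
      then have dd: "d' = d" using d d' by simp
      show ?thesis
      proof (cases "d = ?v")
        case True
        have "length ?w < length ?v" using vr by simp
        then have "\<not> prefix d ?w" using True prefix_length_le[of d ?w] by auto
        then show ?thesis using \<open>j = i\<close> dd subtree_seen True by simp
      next
        case False
        have dw: "prefix d ?w" using up False by blast
        have wv: "?v = ?w @ [last ?v]" using vr by simp
        have wm: "mark (wall c ?w) = None" using unmarked_mono[OF _ dw] own_props[OF d(1)] by simp
        have "length ?w < length ?v" using vr by simp
        then have "?w \<noteq> ?v" by (metis less_irrefl)
        then have sw: "strict_prefix ?w ?v" by (simp add: strict_prefix_def prefixeq_butlast)
        have dw2: "\<not> finished (wall c ?w)" "taken (wall c ?w) \<noteq> []"
          "prefix (?w @ [last (taken (wall c ?w))]) ?v"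
          using dfs dw sw by (auto simp: dfs_def)
        have "prefix (?w @ [last (taken (wall c ?w))]) (?w @ [last ?v])"
          using dw2(3) unfolding wv[symmetric] .
        \<comment> \<open>The last port taken at the parent is the one through which the robot
          returns, so the subtree just completed is the only one there that could have been
          unfinished.\<close>
        then have lastw: "last (taken (wall c ?w)) = last ?v" by simp
        have "dfs T ?c d ?w" unfolding dfs_def
        proof (intro conjI allI impI ballI)
          fix z assume z: "prefix d z \<and> strict_prefix z ?w"
          then have zv: "strict_prefix z ?v" using sw by (meson prefix_order.less_trans)
          then have z2: "z \<in> seen c" "\<not> finished (wall c z)" "taken (wall c z) \<noteq> []"
            "prefix (z @ [last (taken (wall c z))]) ?v" using dfs z by (auto simp: dfs_def)
          then show "z \<in> seen ?c" "\<not> finished (wall ?c z)" "taken (wall ?c z) \<noteq> []"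
            using zv by auto
          have "length (z @ [last (taken (wall c z))]) \<le> length ?w"
            using z prefix_length_less[of z ?w] by simp
          then show "prefix (z @ [last (taken (wall ?c z))]) ?w"
            unfolding tk using z2(4) prefix_length_prefix[of _ ?v ?w] prefixeq_butlast[of ?v] by simp
        next
          show "\<not> finished (wall ?c ?w)" using dw2 sw by auto
        next
          fix p assume "p \<in> set (taken (wall ?c ?w))"
          then have "p \<in> set (butlast (taken (wall c ?w))) \<or> p = last (taken (wall c ?w))"
            using dw2(2) unfolding tk by (metis append_butlast_last_id rotate1.simps(2) set_ConsD set_rotate1)
          then show "below T (?w @ [p]) \<subseteq> seen ?c"
          proof
            assume "p = last (taken (wall c ?w))"
            then show ?thesis using subtree_seen lastw wv by simp
          next
            assume "p \<in> set (butlast (taken (wall c ?w)))"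
            then show ?thesis using unmarked_taken[OF wm] by auto
          qed
        qed
        then show ?thesis using \<open>j = i\<close> dd dw by simp
      qed
    next
      case False
      have nv: "z \<noteq> ?v" if "prefix d' z" for z using own_unique[OF d(1) d' d(2)] that False by auto
      have "dfs T ?c d' y" if "dfs T c d' y" "prefix d' y" for y
        by (rule dfs_mono[OF that(1) _ _ that(2)]) (auto dest: nv)
      then show ?thesis using own_dfs[OF d'] False by (auto split: if_splits)
    qed
  next
    fix z assume *: "mark (wall ?c z) = None" "finished (wall ?c z)"
    show "below T z \<subseteq> seen ?c"
    proof (cases "z = ?v")
      case False
      then show ?thesis using unmarked_finished[of z] * by auto
    qed (use subtree_seen in simp)
  next
    fix z q assume *: "mark (wall ?c z) = None" "q \<in> set (butlast (taken (wall ?c z)))"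
    then show "below T (z @ [q]) \<subseteq> seen ?c" using unmarked_taken[of z q] unfolding marked tk by auto
  next
    show "valid (\<lambda>l. alive (opens F) l \<or> l = tr S \<and> \<not> exhausted T ?c l) t"
      using tree_valid exh unfolding valid_def by (auto intro: capped_mono_labels)
  next
    fix w assume "w \<in> T" "w \<notin> seen ?c"
    then show "(\<exists>d \<in> opens F. prefix d w) \<or>
      \<not> pending ?c S tr \<and> prefix (tr S) w \<and>
        (w = tr S \<or> w ! length (tr S) \<notin> set (taken (wall ?c (tr S))))"
      using coverage[of w] pend by auto
  next
    fix z assume "mark (wall ?c z) \<noteq> None"
    then show "exhausted T ?c z \<or> \<not> pending ?c S tr \<and> z = tr S \<and> z \<in> labels t"
      unfolding pend marked using marked_exhausted[of z] exh by blast
  next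
    show "Suc n + (\<Sum>j<k. length (loc ?c j)) \<le>
      2 * ((\<Sum>z\<in>T. length (taken (wall ?c z))) + (\<Sum>j<k. descents tr (ell j)))" unfolding tk by (rule cnt)
  qed (unfold pend marked tk, (rule persistent label_taken; assumption)+)
qed

end

text \<open>The simulation by anonymous robots requires a legal move for every input, also where no
  replanned tree exists. Moves that are legal anyway are not altered.\<close>

definition guarded :: "('b, 'm) team_algorithm \<Rightarrow> ('b, 'm) team_algorithm" where
  "guarded A i v b m N =
     (case A i v b m N of (b', m', u) \<Rightarrow> (b', m', if u \<in> N then u else (SOME u. u \<in> N)))"

lemma guarded_in: "N \<noteq> {} \<Longrightarrow> guarded A i v b m N = (b', m', u) \<Longrightarrow> u \<in> N"
  by (auto simp: guarded_def some_in_eq split: prod.splits if_splits)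

lemma seen_team_step: "seen (team_step A T i c) = insert (loc c i) (seen c)"
  by (simp add: team_step_def split: prod.splits)

lemma (in exploration) free_ports_adjacent:
  "free_ports v b (adjacent T v) = {p. v @ [p] \<in> T \<and> p \<notin> set (taken b)}"
  by (auto simp: free_ports_def adjacent_def)

section \<open>A whole activation, and the number of rounds\<close>

context state
begin

text \<open>The configuration between the deposit and the decision of the active robot. The
  invariant is re-established here, so the five moves may assume that the local mark is up to
  date.\<close>

definition deposit_at :: "nat \<Rightarrow> (wb, memo) team" where
  "deposit_at i = c\<lparr>wall := (wall c)(loc c i := deposit (loc c i) (wall c (loc c i)) (info c i))\<rparr>"

lemma deposit_at_simps [simp]:
  "loc (deposit_at i) = loc c" "info (deposit_at i) = info c" "seen (deposit_at i) = seen c"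
  "wall (deposit_at i) (loc c i) = deposit (loc c i) (wall c (loc c i)) (info c i)"
  by (simp_all add: deposit_at_def)

lemma deposit_trivial:
  assumes "deposit (loc c i) (wall c (loc c i)) (info c i) = wall c (loc c i)"
  shows "state k T (deposit_at i) S tr t F ell n"
proof -
  have "deposit_at i = c" using assms by (simp add: deposit_at_def)
  then show ?thesis using state_axioms by simp
qed

lemma deposit_state: "\<exists>F'. state k T (deposit_at i) S tr t F' ell n"
proof (cases "info c i")
  case None
  then show ?thesis using deposit_trivial[of i] by (auto simp: deposit_def)
next
  case (Some x)
  obtain s t' F' where x: "x = (s, t', F')" by (cases x)
  show ?thesis
  proof (cases "mark (wall c (loc c i))")
    case None
    note * = deposit_pending[OF Some[unfolded x]]
    have "deposit_at i = deposited (arrive (tr S) (wall c (tr S)) F)"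
      using * None Some x by (simp add: deposit_at_def deposit_def deposited_def)
    then show ?thesis using deposit_unmarked * None by force
  next
    case m: (Some y)
    show ?thesis
    proof (cases "fst y < s")
      case True
      note * = deposit_pending[OF Some[unfolded x]]
      have "deposit_at i = deposited F"
        using * True m Some x by (cases y) (simp add: deposit_at_def deposit_def deposited_def)
      then show ?thesis using deposit_marked[of y] * True m by force
    next
      case False
      then have "state k T (deposit_at i) S tr t F ell n"
        using m Some x by (intro deposit_trivial) (cases y, simp add: deposit_def)
      then show ?thesis by blast
    qed
  qed
qed

lemma deposit_ready:
  assumes "info c i = Some (s, t', F')"
  shows "\<exists>x. mark (deposit (loc c i) (wall c (loc c i)) (info c i)) = Some x \<and> s \<le> fst x"
proof (cases "mark (wall c (loc c i))")
  case None
  then show ?thesis using assms by (simp add: deposit_def)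
next
  case (Some y)
  then show ?thesis using assms by (cases y) (auto simp: deposit_def)
qed

lemma team_step_acted:
  assumes "A i (loc c i) (wall c (loc c i)) (info c i) (adjacent T (loc c i)) = (b, m, u)"
  shows "team_step A T i c = acted i b m u (deposit_at i)"
  using assms by (simp add: team_step_def acted_def deposit_at_def)

lemma act_state:
  assumes i: "i < k" and unseen: "\<not> T \<subseteq> insert (loc c i) (seen c)"
    and act: "act i (loc c i) (wall c (loc c i)) (info c i) (adjacent T (loc c i)) = (b, m, u)"
  shows "(\<exists>S tr t F ell. state k T (acted i b m u (deposit_at i)) S tr t F ell (Suc n)) \<and>
    u \<in> adjacent T (loc c i)"
proof -
  obtain F0 where "state k T (deposit_at i) S tr t F0 ell n" using deposit_state by blast
  then interpret d: state k T "deposit_at i" S tr t F0 ell n .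
  let ?v = "loc c i"
  let ?b = "deposit ?v (wall c ?v) (info c i)"
  define P where "P = {p. ?v @ [p] \<in> T \<and> p \<notin> set (taken ?b)}"
  define p where "p = (SOME p. p \<in> P)"
  have P: "free_ports ?v ?b (adjacent T ?v) = P" by (simp add: free_ports_adjacent P_def)
  have full: "P = {} \<Longrightarrow> ?v @ [q] \<in> T \<Longrightarrow> q \<in> set (taken ?b)" for q by (auto simp: P_def)
  have p: "?v @ [p] \<in> T \<and> p \<notin> set (taken ?b)" if "P \<noteq> {}"
    using that some_in_eq[of P] by (auto simp: P_def p_def)
  note act' = act[unfolded act_def Let_def P, folded p_def]
  consider (none) "mark ?b = None"
    | (follow) s w \<sigma> where "mark ?b = Some (s, Some w, \<sigma>)"
    | (front) s t' F' where "mark ?b = Some (s, None, t', F')"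
    by (metis option.exhaust prod_cases4)
  then show ?thesis
  proof cases
    case none
    then have inf: "info c i = None" using deposit_ready[of i] by (cases "info c i") auto
    show ?thesis
    proof (cases "P = {}")
      case True
      then have res: "b = Board (taken ?b) True None" "m = None" "u = butlast ?v"
        using act' none by auto
      have "state k T (acted i b m u (deposit_at i)) S tr t F0 ell (Suc n)" "u \<in> adjacent T ?v"
        using d.dfs_up[of i] none inf full[OF True] by (simp_all add: res)
      then show ?thesis by blast
    next
      case False
      then have res: "b = Board (taken ?b @ [p]) (finished ?b) None" "m = None" "u = ?v @ [p]"
        using act' none by auto
      have "state k T (acted i b m u (deposit_at i)) S tr t F0 ell (Suc n)"
        using d.dfs_down[of i p] none inf p[OF False] by (simp add: res)
      then show ?thesis using p[OF False] adjacent_snoc res by blast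
    qed
  next
    case follow
    then have res: "b = ?b" "m = Some (Suc s, \<sigma>)" "u = w" using act' by auto
    have "s0 \<le> s" if "info c i = Some (s0, t0, G0)" for s0 t0 G0
      using deposit_ready[OF that] follow by simp
    then have "state k T (acted i b m u (deposit_at i)) S tr t F0 (ell(i := Suc s)) (Suc n)"
      "u \<in> adjacent T ?v"
      using d.follow[of i s w \<sigma>] follow i by (simp_all add: res)
    then show ?thesis by blast
  next
    case front
    then have fr: "s = S" "tr S = ?v" "t' = t" "F' = F0"
      using d.mark_front[of ?v s t' F'] by auto
    show ?thesis
    proof (cases "P = {}")
      case False
      then have res: "b = Board (taken ?b @ [p]) (finished ?b) (Some (s, None, t, F0[i := Some (?v @ [p])]))"
        "m = None" "u = ?v @ [p]"
        using act' front fr by auto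
      have "state k T (acted i b m u (deposit_at i)) S tr t (F0[i := Some (?v @ [p])]) ell (Suc n)"
        using d.take_port[of i s "(t', F')" p] front i p[OF False] by (simp add: res)
      then show ?thesis using p[OF False] adjacent_snoc res by blast
    next
      case True
      let ?F = "F0[i := None]"
      define t2 where "t2 = (SOME t2. replan ?v (opens ?F) t t2)"
      have res: "b = Board (taken ?b) (finished ?b) (Some (s, Some (toward ?v (target t2)), t2, ?F))"
        "m = Some (Suc s, t2, ?F)" "u = toward ?v (target t2)"
        using act' front fr True by (auto simp: t2_def)
      have mk: "mark (wall (deposit_at i) ?v) \<noteq> None" using front by simp
      have own: "own F0 j = Some x \<and> j \<noteq> i" if "own ?F j = Some x" for j x
        using that i d.len_F by (auto split: if_splits)
      have sub: "x \<in> opens F0" if "x \<in> opens ?F" for x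
        using that own unfolding opens_own by blast
      \<comment> \<open>If no other robot had an open edge, nothing would be unseen apart from the
        current node: its ports are all taken, and the subtree recorded for the active robot has
        been seen.\<close>
      have ne: "opens ?F \<noteq> {}"
      proof
        assume em: "opens ?F = {}"
        have "w \<in> insert ?v (seen c)" if w: "w \<in> T" for w
        proof (rule ccontr)
          assume nw: "w \<notin> insert ?v (seen c)"
          have "\<not> (prefix ?v w \<and> w ! length ?v \<notin> set (taken ?b))"
          proof
            assume *: "prefix ?v w \<and> w ! length ?v \<notin> set (taken ?b)"
            then obtain p' r where pr: "w = ?v @ p' # r"
              using nw by (metis append.right_neutral insertI1 neq_Nil_conv prefix_def)
            then have "?v @ [p'] \<in> T" using prefix_in_tree[OF w, of "?v @ [p']"] by simp
            then show False using full[OF True, of p'] * pr by simp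
          qed
          then obtain x where x: "x \<in> opens F0" "prefix x w"
            using d.coverage[of w] w nw fr by auto
          then obtain j where j: "own F0 j = Some x" by (auto simp: opens_own)
          have "j = i"
          proof (rule ccontr)
            assume "j \<noteq> i"
            then have "own ?F j = Some x" using j by simp
            then have "x \<in> opens ?F" unfolding opens_own by blast
            then show False using em by simp
          qed
          then have "below T x \<subseteq> seen c" using d.own_at_marked[of i x] mk j by simp
          then show False using x w nw by (auto simp: below_def)
        qed
        then show False using unseen by blast
      qed
      have "capped (alive (opens ?F)) t"
        using d.tree_valid sub unfolding valid_def alive_def by (auto intro: capped_mono_labels)
      then have "valid (alive (opens ?F)) t" using d.tree_valid by (simp add: valid_def)
      moreover have "card (opens ?F) \<le> k" using card_opens[of ?F] d.len_F by simp
      moreover have "\<forall>x \<in> opens ?F. \<exists>l \<in> labels t. prefix l x" using d.tree_cover sub by blast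
      \<comment> \<open>The upper end of an open edge is marked, and no marked node lies strictly
        below a label; so an open edge below \<open>?v\<close> starts at \<open>?v\<close>.\<close>
      moreover have "length x = Suc (length ?v)"
        if v: "?v \<in> labels t" and x: "x \<in> opens ?F" "prefix ?v x" for x
      proof -
        obtain j where j: "own F0 j = Some x" using sub[OF x(1)] by (auto simp: opens_own)
        note pr = d.own_props[OF j]
        have "x \<noteq> ?v" using pr mk by auto
        then have "prefix ?v (butlast x)"
          using x(2) pr by (metis append_butlast_last_id prefix_snoc)
        then have "butlast x = ?v" using d.label_top[OF v] pr by blast
        then show ?thesis using pr by (metis append_butlast_last_id length_append_singleton)
      qed
      ultimately have "\<exists>t2. replan ?v (opens ?F) t t2"
        using ne by (intro replan_exists) auto
      then have "replan ?v (opens ?F) t t2" unfolding t2_def by (rule someI_ex)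
      then have *: "replan (loc (deposit_at i) i) (opens ?F) t t2" by simp
      have full': "\<And>q. loc (deposit_at i) i @ [q] \<in> T \<Longrightarrow> q \<in> set (taken (wall (deposit_at i) (loc (deposit_at i) i)))"
        using full[OF True] by simp
      have mk': "mark (wall (deposit_at i) (loc (deposit_at i) i)) = Some (s, None, t', F')"
        using front by simp
      have "state k T (acted i b m u (deposit_at i)) (Suc S) (tr(Suc S := u)) t2 ?F (ell(i := Suc S)) (Suc n)"
        "u \<in> adjacent T ?v"
        using d.depart[OF i mk' full' *, of u] by (simp_all add: res)
      then show ?thesis by blast
    qed
  qed
qed

lemma step_state:
  assumes "i < k" "\<not> T \<subseteq> seen (team_step (guarded act) T i c)"
  shows "\<exists>S tr t F ell. state k T (team_step (guarded act) T i c) S tr t F ell (Suc n)"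
proof -
  obtain b m u where act: "act i (loc c i) (wall c (loc c i)) (info c i) (adjacent T (loc c i)) = (b, m, u)"
    by (metis prod_cases3)
  from act_state[OF assms(1) _ act] assms(2)
  have *: "\<exists>S tr t F ell. state k T (acted i b m u (deposit_at i)) S tr t F ell (Suc n)"
    "u \<in> adjacent T (loc c i)"
    by (simp_all add: seen_team_step)
  then have "guarded act i (loc c i) (wall c (loc c i)) (info c i) (adjacent T (loc c i)) = (b, m, u)"
    using act by (simp add: guarded_def)
  from team_step_acted[of "guarded act", OF this] * show ?thesis by simp
qed

text \<open>Ascents equal descents minus the current depth, which is why \<open>count\<close> has
  the factor 2 and the sum of depths. First descents are counted by the edges; each robot retraces
  at most all descents of the searcher, and these are bounded by the potential.\<close>

lemma rounds_bound: "real n \<le> 2 * (real (card T) - 1) + 2 * real k * rate k * (real (depth T) + 1)"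
proof -
  have fin: "finite T" and root: "[] \<in> T" using tree by (auto simp: rooted_tree_def)
  have "(\<Sum>v\<in>T. length (taken (wall c v))) = (\<Sum>v\<in>T. card (set (taken (wall c v))))"
    using taken_distinct distinct_card by (intro sum.cong) (auto simp: distinct_card)
  also have "\<dots> = card (SIGMA v:T. set (taken (wall c v)))" using fin by simp
  also have "\<dots> \<le> card (T - {[]})"
    using fin taken_in
    by (intro card_inj_on_le[of "\<lambda>(v, p). v @ [p]"]) (auto simp: inj_on_def)
  finally have tk: "(\<Sum>v\<in>T. length (taken (wall c v))) \<le> card T - 1" using fin root by simp
  have "1 \<le> card T" using fin root by (metis One_nat_def Suc_leI card_gt_0_iff empty_iff)
  then have tk': "real (\<Sum>v\<in>T. length (taken (wall c v))) \<le> real (card T) - 1"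
    using tk by linarith
  have "(\<Sum>i<k. descents tr (ell i)) \<le> (\<Sum>i<k. descents tr S)"
    by (intro sum_mono descents_mono ell_le)
  then have ds: "(\<Sum>i<k. descents tr (ell i)) \<le> k * descents tr S" by simp
  have "real (descents tr S) \<le> rate k * val t" using cost credit_nonneg[of t] by linarith
  also have "\<dots> \<le> rate k * (real (depth T) + 1)"
    using val_bound rate_pos[of k] by (intro mult_left_mono) auto
  finally have "real k * real (descents tr S) \<le> real k * (rate k * (real (depth T) + 1))"
    by (intro mult_left_mono) auto
  then have ds': "real (\<Sum>i<k. descents tr (ell i)) \<le> real k * (rate k * (real (depth T) + 1))"
    using ds by (metis (no_types) of_nat_le_iff of_nat_mult order_trans)
  have "n \<le> 2 * ((\<Sum>v\<in>T. length (taken (wall c v))) + (\<Sum>i<k. descents tr (ell i)))"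
    using count by linarith
  then have "real n \<le> 2 * (real (\<Sum>v\<in>T. length (taken (wall c v))) + real (\<Sum>i<k. descents tr (ell i)))"
    by (metis (no_types) of_nat_le_iff of_nat_mult of_nat_add of_nat_numeral)
  then show ?thesis using tk' ds' by (simp add: algebra_simps)
qed

end

text \<open>The searcher starts at the root, represented by a completed imaginary edge into it. This
  edge is the additional 1 in the bound \<open>depth T + 1\<close> on the value.\<close>

definition (in balancing) wall_init :: "node \<Rightarrow> wb" where
  "wall_init v =
     (if v = [] then Board [] False (Some (0, None, Leaf [] 0, replicate k None)) else blank)"

definition team_init :: "'m \<Rightarrow> (node \<Rightarrow> 'b) \<Rightarrow> ('b, 'm) team" where
  "team_init m b = \<lparr>loc = \<lambda>i. [], info = \<lambda>i. m, wall = b, seen = {}\<rparr>"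

lemma (in exploration) init_state:
  "state k T (team_init None wall_init) 0 (\<lambda>s. []) (Leaf [] 0) (replicate k None) (\<lambda>i. 0) 0"
proof -
  have T: "[] \<in> T" using tree by (simp add: rooted_tree_def)
  have own: "own (replicate k None) i = None" for i by (auto simp: own_def)
  have opens: "opens (replicate k None) = {}" unfolding opens_own own by (simp add: set_eq_iff opens_own own)
  have np: "\<not> pending (team_init None wall_init) 0 (\<lambda>s. [])"
    by (simp add: pending_def team_init_def wall_init_def)
  have rk: "0 \<le> rate k" using rate_pos[of k] by simp
  show ?thesis
    by unfold_locales
      (use T own opens np rk in \<open>auto simp: team_init_def wall_init_def blank_def valid_def
        exhausted_def descents_def below_def split: if_splits\<close>)
qed

definition run_team ::
  "('b, 'm) team_algorithm \<Rightarrow> node set \<Rightarrow> ('b, 'm) team \<Rightarrow> nat list \<Rightarrow> ('b, 'm) team" where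
  "run_team A T c xs = fold (team_step A T) xs c"

text \<open>The invariant is claimed only while the tree is not fully seen; afterwards a departing
  robot may find no open edge to plan for.\<close>

lemma (in exploration) run_state:
  assumes "set xs \<subseteq> {..<k}"
  shows "T \<subseteq> seen (run_team (guarded act) T (team_init None wall_init) xs) \<or>
    (\<exists>S tr t F ell.
      state k T (run_team (guarded act) T (team_init None wall_init) xs) S tr t F ell (length xs))"
  using assms
proof (induction xs rule: rev_induct)
  case Nil
  then show ?case using init_state by (auto simp: run_team_def)
next
  case (snoc i xs)
  let ?c = "run_team (guarded act) T (team_init None wall_init) xs"
  have eq: "run_team (guarded act) T (team_init None wall_init) (xs @ [i]) = team_step (guarded act) T i ?c"
    by (simp add: run_team_def)
  show ?case
  proof (cases "T \<subseteq> seen (team_step (guarded act) T i ?c)")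
    case False
    then have "\<not> T \<subseteq> seen ?c" by (auto simp: seen_team_step)
    then have "\<exists>S tr t F ell. state k T ?c S tr t F ell (length xs)" using snoc by simp
    then obtain S tr t F ell where "state k T ?c S tr t F ell (length xs)" by blast
    then interpret state k T ?c S tr t F ell "length xs" .
    show ?thesis using step_state[of i] False snoc.prems unfolding eq by simp
  qed (simp add: eq)
qed

lemma (in exploration) team_bound:
  assumes "set xs \<subseteq> {..<k}" "\<not> T \<subseteq> seen (run_team (guarded act) T (team_init None wall_init) xs)"
  shows "real (length xs) \<le> 2 * (real (card T) - 1) + 2 * real k * rate k * (real (depth T) + 1)"
  using run_state[OF assms(1)] assms(2) state.rounds_bound by blast

section \<open>Simulating a team by robots without identities\<close>

section \<open>Anonymous robots\<close>

text \<open>Typed contents are encoded in one natural number. The empty board stands for the initial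
  content, which depends on the node. The first component is the number of enrolled robots, relevant
  at the root; the list maps a robot of the team and its move number to its new memory and
  destination.\<close>

definition read_wall :: "(node \<Rightarrow> 'b) \<Rightarrow> node \<Rightarrow> whiteboard \<Rightarrow>
    nat \<times> ((nat \<times> nat) \<times> (('m::countable) \<times> node)) list \<times> ('b::countable)" where
  "read_wall b0 v w = (if w = [] then (0, [], b0 v) else from_nat (hd w))"

definition read_memory :: "nat \<Rightarrow> 'm \<Rightarrow> memory \<Rightarrow> nat \<times> nat \<times> ('m::countable) \<times> node" where
  "read_memory r m0 m = (if m = [] then (r, 0, m0, []) else from_nat (hd m))"

(* Robots number themselves at the root, and those with the same number divided by q act as one
   robot of the team: whoever is ahead makes its next move and leaves a record for the others.
   The root is recognised by the empty memory. *)
definition anonymous ::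
  "nat \<Rightarrow> ('b::countable, 'm::countable) team_algorithm \<Rightarrow> 'm \<Rightarrow> (node \<Rightarrow> 'b) \<Rightarrow> algorithm" where
  "anonymous q A m0 b0 w m N =
     (let r = fst (read_wall b0 [] w :: nat \<times> ((nat \<times> nat) \<times> ('m \<times> node)) list \<times> 'b);
          (a, s, x, v) = read_memory r m0 m;
          (r, h, b) = read_wall b0 v w;
          r' = (if m = [] then Suc r else r);
          (h', b', x', u) = (case map_of h (a div q, s) of
              Some (x', u) \<Rightarrow> (h, b, x', u)
            | None \<Rightarrow> (case A (a div q) v b x N of (b', x', u) \<Rightarrow>
                (((a div q, s), (x', u)) # h, b', x', u)))
      in ([to_nat (r', h', b')], [to_nat (a, Suc s, x', u)],
          if u \<in> N then u else (SOME u. u \<in> N)))"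

lemma is_algorithm_anonymous: "is_algorithm (anonymous q A m0 b0)"
  unfolding is_algorithm_def anonymous_def Let_def
  by (auto split: prod.splits option.splits simp: some_in_eq)

(* The team has made the moves xs; traj g s and memo g s are the position and the information
   of its robot g after s moves. Robot i has number num i and has retraced stp i moves. *)
locale shadow =
  fixes q :: nat and A :: "('b::countable, 'm::countable) team_algorithm" and m0 :: 'm
    and b0 :: "node \<Rightarrow> 'b" and T :: "node set" and k K :: nat
    and c :: config and xs :: "nat list" and traj :: "nat \<Rightarrow> nat \<Rightarrow> node"
    and memo :: "nat \<Rightarrow> nat \<Rightarrow> 'm" and num stp :: "nat \<Rightarrow> nat" and n :: nat
  assumes team: "k \<le> q * K" "set xs \<subseteq> {..<K}"
    and guard: "\<And>i v b m N b' m' u. N \<noteq> {} \<Longrightarrow> A i v b m N = (b', m', u) \<Longrightarrow> u \<in> N"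
    and adj_nonempty: "\<And>v. v \<in> T \<Longrightarrow> adjacent T v \<noteq> {}"
    and start: "traj g 0 = []" "memo g 0 = m0"
    and current: "traj g (count_list xs g) = loc (run_team A T (team_init m0 b0) xs) g"
      "memo g (count_list xs g) = info (run_team A T (team_init m0 b0) xs) g"
    and traj_in: "s \<le> count_list xs g \<Longrightarrow> traj g s \<in> T"
    and traj_adj: "s < count_list xs g \<Longrightarrow> traj g (Suc s) \<in> adjacent T (traj g s)"
    and enrolled: "mem c i \<noteq> [] \<Longrightarrow> i < k \<and>
      mem c i = [to_nat (num i, stp i, memo (num i div q) (stp i), pos c i)] \<and>
      pos c i = traj (num i div q) (stp i) \<and> stp i \<le> count_list xs (num i div q) \<and>
      num i < card {i. mem c i \<noteq> []}"
    and idle: "mem c i = [] \<Longrightarrow> pos c i = [] \<and> stp i = 0"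
    and num_inj: "mem c i \<noteq> [] \<Longrightarrow> mem c j \<noteq> [] \<Longrightarrow> num i = num j \<Longrightarrow> i = j"
    and root_count: "fst (read_wall b0 [] (board c []) :: nat \<times> ((nat \<times> nat) \<times> ('m \<times> node)) list \<times> 'b)
      = card {i. mem c i \<noteq> []}"
    and walls: "\<exists>r h. read_wall b0 v (board c v) =
        (r, h, wall (run_team A T (team_init m0 b0) xs) v) \<and>
      (\<forall>g s. map_of h (g, s) = (if s < count_list xs g \<and> traj g s = v
         then Some (memo g (Suc s), traj g (Suc s)) else None))"
    and rounds: "n = (\<Sum>i<k. stp i)"
begin

abbreviation "tm \<equiv> run_team A T (team_init m0 b0) xs"

lemma finite_enrolled: "finite {i. mem c i \<noteq> []}"
  by (rule finite_subset[of _ "{..<k}"]) (use enrolled in auto)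

lemma card_enrolled: "card {i. mem c i \<noteq> []} \<le> k"
  using card_mono[of "{..<k}" "{i. mem c i \<noteq> []}"] enrolled by auto

text \<open>A robot with number \<open>a\<close> has retraced at most the moves of robot
  \<open>a div q\<close> of the team. The numbers are distinct and below \<open>q * K\<close>, so
  each robot of the team is simulated by at most \<open>q\<close> robots.\<close>

lemma rounds_le: "n \<le> q * length xs"
proof -
  let ?E = "{i. mem c i \<noteq> []}" and ?f = "\<lambda>a. count_list xs (a div q)"
  have "n = (\<Sum>i\<in>?E. stp i)"
    unfolding rounds using enrolled idle by (intro sum.mono_neutral_right) auto
  also have "\<dots> \<le> (\<Sum>i\<in>?E. ?f (num i))" using enrolled by (intro sum_mono) auto
  also have "\<dots> = (\<Sum>a\<in>num ` ?E. ?f a)"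
    using num_inj by (subst sum.reindex) (auto simp: inj_on_def)
  also have "\<dots> \<le> (\<Sum>a<q * K. ?f a)"
  proof (intro sum_mono2)
    show "num ` ?E \<subseteq> {..<q * K}" using enrolled card_enrolled team(1) by fastforce
  qed auto
  also have "\<dots> = (\<Sum>g<K. q * count_list xs g)"
  proof (cases "q = 0")
    case False
    show ?thesis
    proof (induction K)
      case (Suc K)
      have "{..<q * Suc K} = {..<q * K} \<union> {q * K..<q * K + q}" by auto
      then have "(\<Sum>a<q * Suc K. ?f a) = (\<Sum>a<q * K. ?f a) + (\<Sum>a\<in>{q * K..<q * K + q}. ?f a)"
        by (simp add: sum.union_disjoint ivl_disj_int)
      also have "(\<Sum>a\<in>{q * K..<q * K + q}. ?f a) = (\<Sum>a\<in>{q * K..<q * K + q}. count_list xs K)"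
        by (intro sum.cong refl arg_cong[where f = "count_list xs"] div_nat_eqI) (auto simp: mult.commute)
      finally show ?case using Suc by simp
    qed simp
  qed simp
  also have "\<dots> = q * (\<Sum>g\<in>{..<K}. count_list xs g)" by (simp add: sum_distrib_left)
  also have "(\<Sum>g\<in>{..<K}. count_list xs g) = length xs"
    using team(2) by (subst sum_count_set) auto
  finally show ?thesis .
qed

text \<open>A move that is already recorded is replayed and the team stays as it is; otherwise the
  team makes one more move, at the node where the active robot stands. In both cases whatever the
  team sees has been visited.\<close>

lemma shadow_step:
  assumes i: "i < k"
  shows "\<exists>xs' traj' memo' num' stp'.
    shadow q A m0 b0 T k K (activate (anonymous q A m0 b0) T i c) xs' traj' memo' num' stp' (Suc n) \<and>
    seen (run_team A T (team_init m0 b0) xs') \<subseteq> insert (pos c i) (seen tm)"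
proof -
  let ?v = "pos c i"
  let ?E = "{i. mem c i \<noteq> []}"
  let ?N = "adjacent T ?v"
  define a where "a = (if mem c i = [] then card ?E else num i)"
  define g where "g = a div q"
  define s where "s = stp i"
  have v: "?v = traj g s"
    using enrolled[of i] idle[of i] start by (cases "mem c i = []") (auto simp: a_def g_def s_def)
  have sN: "s \<le> count_list xs g"
    using enrolled[of i] idle[of i] by (cases "mem c i = []") (auto simp: a_def g_def s_def)
  have ak: "a < k"
  proof (cases "mem c i = []")
    case True
    have "?E \<subseteq> {..<k} - {i}" using enrolled True by auto
    then have "card ?E \<le> card ({..<k} - {i})" by (intro card_mono) auto
    then show ?thesis using i True by (simp add: a_def)
  next
    case False
    then show ?thesis using enrolled[OF False] card_enrolled by (simp add: a_def)
  qed
  have gK: "g < K"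
    unfolding g_def using ak team(1) by (intro less_mult_imp_div_less) (simp add: mult.commute)
  obtain r h where rh: "read_wall b0 ?v (board c ?v) = (r, h, wall tm ?v)"
    "\<And>g' s'. map_of h (g', s') = (if s' < count_list xs g' \<and> traj g' s' = ?v
       then Some (memo g' (Suc s'), traj g' (Suc s')) else None)"
    using walls[of ?v] by blast
  define x where "x = memo g s"
  have vT: "?v \<in> T" using traj_in[OF sN] v by simp
  have Nne: "?N \<noteq> {}" using adj_nonempty vT by simp
  have mem_read: "read_memory (fst (read_wall b0 [] (board c ?v) ::
      nat \<times> ((nat \<times> nat) \<times> ('m \<times> node)) list \<times> 'b)) m0 (mem c i) = (a, s, x, ?v)"
  proof (cases "mem c i = []")
    case True
    then have "?v = []" "s = 0" using idle by (auto simp: s_def)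
    then show ?thesis using True root_count start by (simp add: read_memory_def a_def x_def)
  next
    case False
    then show ?thesis using enrolled[OF False] by (simp add: read_memory_def a_def x_def g_def s_def)
  qed
  define r' where "r' = (if mem c i = [] then Suc r else r)"
  define num' where "num' = num(i := a)"
  define stp' where "stp' = stp(i := Suc s)"
  have E': "{j. j = i \<or> mem c j \<noteq> []} = insert i ?E" by auto
  have cardE': "card (insert i ?E) = (if mem c i = [] then Suc (card ?E) else card ?E)"
    using finite_enrolled by (simp add: card_insert_if)
  have a_card: "a < card (insert i ?E)"
    using cardE' enrolled[of i] by (auto simp: a_def)
  have num_inj': "j = j'"
    if "j = i \<or> mem c j \<noteq> []" "j' = i \<or> mem c j' \<noteq> []" "num' j = num' j'" for j j'
  proof -
    have ne: "num l \<noteq> a" if l: "mem c l \<noteq> []" "l \<noteq> i" for l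
    proof (cases "mem c i = []")
      case True
      then show ?thesis using enrolled[OF l(1)] by (simp add: a_def)
    next
      case False
      then show ?thesis using num_inj[OF l(1) False] l(2) by (auto simp: a_def)
    qed
    show ?thesis
    proof (cases "j = i \<or> j' = i")
      case True
      then show ?thesis using that ne[of j] ne[of j'] by (auto simp: num'_def split: if_splits)
    next
      case False
      then show ?thesis using that num_inj[of j j'] by (simp add: num'_def)
    qed
  qed
  have num_lt': "num' j < card (insert i ?E)" if "j = i \<or> mem c j \<noteq> []" for j
    using that a_card enrolled[of j] cardE' by (auto simp: num'_def split: if_splits)
  have rounds': "Suc n = (\<Sum>j<k. stp' j)"
    using sum_fun_upd[of "{..<k}" i id stp "Suc s"] i rounds by (simp add: stp'_def s_def)
  have root_count': "?v = [] \<Longrightarrow> r = card ?E" using root_count rh(1) by simp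
  have root_card: "(if ?v = [] then r' else card ?E) = card (insert i ?E)"
    using root_count' cardE' idle[of i] by (auto simp: r'_def)
  show ?thesis
  proof (cases "s < count_list xs g")
    case True
    let ?u = "traj g (Suc s)"
    have look: "map_of h (g, s) = Some (memo g (Suc s), ?u)" using rh(2) True v by simp
    have uN: "?u \<in> ?N" using traj_adj[OF True] v by simp
    have out: "anonymous q A m0 b0 (board c ?v) (mem c i) ?N =
        ([to_nat (r', h, wall tm ?v)], [to_nat (a, Suc s, memo g (Suc s), ?u)], ?u)"
      unfolding anonymous_def Let_def mem_read
      using rh(1) look uN by (simp add: g_def r'_def)
    let ?c = "activate (anonymous q A m0 b0) T i c"
    have c': "pos ?c = (pos c)(i := ?u)" "mem ?c = (mem c)(i := [to_nat (a, Suc s, memo g (Suc s), ?u)])"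
      "board ?c = (board c)(?v := [to_nat (r', h, wall tm ?v)])"
      using out Nne by (simp_all add: activate_def Let_def)
    have En: "{j. mem ?c j \<noteq> []} = insert i ?E" unfolding c' by auto
    have "shadow q A m0 b0 T k K ?c xs traj memo num' stp' (Suc n)"
    proof unfold_locales
      fix j assume "mem ?c j \<noteq> []"
      then have j: "j = i \<or> mem c j \<noteq> []" by (auto simp: c')
      show "j < k \<and> mem ?c j = [to_nat (num' j, stp' j, memo (num' j div q) (stp' j), pos ?c j)] \<and>
        pos ?c j = traj (num' j div q) (stp' j) \<and> stp' j \<le> count_list xs (num' j div q) \<and>
        num' j < card {i. mem ?c i \<noteq> []}"
        unfolding En using num_lt'[OF j] True i enrolled[of j] j
        by (auto simp: c' num'_def stp'_def g_def)
    next
      fix j assume "mem ?c j = []"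
      then show "pos ?c j = [] \<and> stp' j = 0" using idle[of j] by (auto simp: c' stp'_def split: if_splits)
    next
      fix j j' assume "mem ?c j \<noteq> []" "mem ?c j' \<noteq> []" "num' j = num' j'"
      then show "j = j'" using num_inj'[of j j'] by (auto simp: c' split: if_splits)
    next
      show "fst (read_wall b0 [] (board ?c []) :: nat \<times> ((nat \<times> nat) \<times> ('m \<times> node)) list \<times> 'b) =
        card {i. mem ?c i \<noteq> []}"
        unfolding En using root_card root_count by (auto simp: c' read_wall_def)
    next
      fix w show "\<exists>r h. read_wall b0 w (board ?c w) = (r, h, wall tm w) \<and>
        (\<forall>g s. map_of h (g, s) = (if s < count_list xs g \<and> traj g s = w
           then Some (memo g (Suc s), traj g (Suc s)) else None))"
      proof (cases "w = ?v")
        case True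
        then show ?thesis using rh(2) by (intro exI[of _ r'] exI[of _ h]) (simp add: c' read_wall_def)
      next
        case False
        then show ?thesis using walls[of w] by (simp add: c')
      qed
    next
      fix i v b m N b' m' u assume "N \<noteq> {}" "A i v b m N = (b', m', u)"
      then show "u \<in> N" by (rule guard)
    qed (use team adj_nonempty start current traj_in traj_adj rounds' in simp_all)
    then show ?thesis by blast
  next
    case False
    \<comment> \<open>Robot \<open>i\<close> is foremost in its group, so its memory and the decoded
      board are the current ones of robot \<open>g\<close> of the team.\<close>
    then have s: "s = count_list xs g" using sN by simp
    have look: "map_of h (g, s) = None" using rh(2) s by simp
    have cur: "loc tm g = ?v" "info tm g = x" using current[of g] v s by (auto simp: x_def)
    obtain b' x' u where out0: "A g ?v (wall tm ?v) x ?N = (b', x', u)" by (metis prod_cases3)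
    have uN: "u \<in> ?N" using guard[OF Nne out0] .
    let ?h = "((g, s), (x', u)) # h"
    have out: "anonymous q A m0 b0 (board c ?v) (mem c i) ?N =
        ([to_nat (r', ?h, b')], [to_nat (a, Suc s, x', u)], u)"
      unfolding anonymous_def Let_def mem_read
      using rh(1) look uN out0 by (simp add: g_def r'_def)
    let ?c = "activate (anonymous q A m0 b0) T i c"
    have c': "pos ?c = (pos c)(i := u)" "mem ?c = (mem c)(i := [to_nat (a, Suc s, x', u)])"
      "board ?c = (board c)(?v := [to_nat (r', ?h, b')])"
      using out Nne by (simp_all add: activate_def Let_def)
    have En: "{j. mem ?c j \<noteq> []} = insert i ?E" unfolding c' by auto
    let ?xs = "xs @ [g]"
    have tm': "run_team A T (team_init m0 b0) ?xs = team_step A T g tm"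
      by (simp add: run_team_def)
    have tm'_fields: "loc (team_step A T g tm) = (loc tm)(g := u)" "info (team_step A T g tm) = (info tm)(g := x')"
      "wall (team_step A T g tm) = (wall tm)(?v := b')" "seen (team_step A T g tm) = insert ?v (seen tm)"
      using out0 cur by (simp_all add: team_step_def)
    have cnt: "count_list ?xs g' = (if g' = g then Suc s else count_list xs g')" for g'
      using s by simp
    define traj' where "traj' = traj(g := (traj g)(Suc s := u))"
    define memo' where "memo' = memo(g := (memo g)(Suc s := x'))"
    have old: "s' \<le> count_list xs g' \<Longrightarrow> traj' g' s' = traj g' s' \<and> memo' g' s' = memo g' s'" for g' s'
      using s by (auto simp: traj'_def memo'_def)
    have new: "traj' g (Suc s) = u" "memo' g (Suc s) = x'" by (simp_all add: traj'_def memo'_def)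
    have "shadow q A m0 b0 T k K ?c ?xs traj' memo' num' stp' (Suc n)"
    proof unfold_locales
      show "set ?xs \<subseteq> {..<K}" using team gK by simp
    next
      fix g' show "traj' g' 0 = []" "memo' g' 0 = m0" using old[of 0 g'] start by auto
      show "traj' g' (count_list ?xs g') = loc (run_team A T (team_init m0 b0) ?xs) g'"
        "memo' g' (count_list ?xs g') = info (run_team A T (team_init m0 b0) ?xs) g'"
        unfolding tm' cnt using old[of "count_list xs g'" g'] new current[of g']
        by (auto simp: tm'_fields)
    next
      fix s' g' assume "s' \<le> count_list ?xs g'"
      then have "s' \<le> count_list xs g' \<or> g' = g \<and> s' = Suc s" unfolding cnt using s by (auto split: if_splits)
      then show "traj' g' s' \<in> T" using old[of s' g'] traj_in new uN by (auto simp: adjacent_def)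
    next
      fix s' g' assume "s' < count_list ?xs g'"
      then have "s' < count_list xs g' \<or> g' = g \<and> s' = s" unfolding cnt using s by (auto split: if_splits)
      then show "traj' g' (Suc s') \<in> adjacent T (traj' g' s')"
        using old[of s' g'] old[of "Suc s'" g'] traj_adj[of s' g'] new uN v s by auto
    next
      fix j assume "mem ?c j \<noteq> []"
      then have j: "j = i \<or> mem c j \<noteq> []" by (auto simp: c')
      show "j < k \<and> mem ?c j = [to_nat (num' j, stp' j, memo' (num' j div q) (stp' j), pos ?c j)] \<and>
        pos ?c j = traj' (num' j div q) (stp' j) \<and> stp' j \<le> count_list ?xs (num' j div q) \<and>
        num' j < card {i. mem ?c i \<noteq> []}"
      proof (cases "j = i")
        case True
        then show ?thesis unfolding En cnt using num_lt'[OF j] i new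
          by (auto simp: c' num'_def stp'_def g_def)
      next
        case False
        then have e: "mem c j \<noteq> []" using j by simp
        then show ?thesis unfolding En cnt
          using num_lt'[OF j] False enrolled[OF e] old[of "stp j" "num j div q"] s
          by (auto simp: c' num'_def stp'_def)
      qed
    next
      fix j assume "mem ?c j = []"
      then show "pos ?c j = [] \<and> stp' j = 0" using idle[of j] by (auto simp: c' stp'_def split: if_splits)
    next
      fix j j' assume "mem ?c j \<noteq> []" "mem ?c j' \<noteq> []" "num' j = num' j'"
      then show "j = j'" using num_inj'[of j j'] by (auto simp: c' split: if_splits)
    next
      show "fst (read_wall b0 [] (board ?c []) :: nat \<times> ((nat \<times> nat) \<times> ('m \<times> node)) list \<times> 'b) =
        card {i. mem ?c i \<noteq> []}"
        unfolding En using root_card root_count by (auto simp: c' read_wall_def)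
    next
      fix w
      have eq: "(if s' < count_list ?xs g' \<and> traj' g' s' = w
          then Some (memo' g' (Suc s'), traj' g' (Suc s')) else None) =
        (if g' = g \<and> s' = s \<and> w = ?v then Some (x', u)
         else if s' < count_list xs g' \<and> traj g' s' = w
         then Some (memo g' (Suc s'), traj g' (Suc s')) else None)" for g' s'
      proof (cases "g' = g \<and> s' = s")
        case True
        then show ?thesis unfolding cnt using new old[of s g] s v by auto
      next
        case False
        then have "s' < count_list ?xs g' \<longleftrightarrow> s' < count_list xs g'" unfolding cnt using s by auto
        then show ?thesis using False old[of s' g'] old[of "Suc s'" g'] by auto
      qed
      show "\<exists>r h. read_wall b0 w (board ?c w) = (r, h, wall (run_team A T (team_init m0 b0) ?xs) w) \<and>
        (\<forall>g' s'. map_of h (g', s') = (if s' < count_list ?xs g' \<and> traj' g' s' = w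
           then Some (memo' g' (Suc s'), traj' g' (Suc s')) else None))"
      proof (cases "w = ?v")
        case True
        then show ?thesis unfolding eq tm' using rh(2)
          by (intro exI[of _ r'] exI[of _ ?h]) (auto simp: c' read_wall_def tm'_fields)
      next
        case False
        then show ?thesis unfolding eq tm' using walls[of w] by (simp add: c' tm'_fields)
      qed
    next
      fix i v b m N b' m' u assume "N \<noteq> {}" "A i v b m N = (b', m', u)"
      then show "u \<in> N" by (rule guard)
    qed (use team adj_nonempty rounds' in simp_all)
    moreover have "seen (run_team A T (team_init m0 b0) ?xs) \<subseteq> insert ?v (seen tm)"
      unfolding tm' tm'_fields by simp
    ultimately show ?thesis by blast
  qed
qed

end

section \<open>From schedules of the team to adversaries\<close>

lemma visited_Suc: "visited B T adv (Suc m) = insert (pos (run B T adv m) (adv m (run B T adv m))) (visited B T adv m)"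
  by (auto simp: visited_def less_Suc_eq)

lemma shadow_run:
  fixes A :: "('b::countable, 'm::countable) team_algorithm"
  assumes adv: "is_adversary k adv" and qK: "k \<le> q * K"
    and guard: "\<And>i v b m N b' m' u. N \<noteq> {} \<Longrightarrow> A i v b m N = (b', m', u) \<Longrightarrow> u \<in> N"
    and T: "[] \<in> T" "\<And>v. v \<in> T \<Longrightarrow> adjacent T v \<noteq> {}"
  shows "\<exists>xs traj memo num stp.
    shadow q A m0 b0 T k K (run (anonymous q A m0 b0) T adv n) xs traj memo num stp n \<and>
    seen (run_team A T (team_init m0 b0) xs) \<subseteq> visited (anonymous q A m0 b0) T adv n"
proof (induction n)
  case 0
  have "shadow q A m0 b0 T k K initial_config [] (\<lambda>g s. []) (\<lambda>g s. m0) (\<lambda>i. 0) (\<lambda>i. 0) 0"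
  proof unfold_locales
    fix i v b m N b' m' u assume "N \<noteq> {}" "A i v b m N = (b', m', u)"
    then show "u \<in> N" by (rule guard)
  qed (use qK T in \<open>simp_all add: initial_config_def run_team_def team_init_def read_wall_def\<close>)
  moreover have "seen (run_team A T (team_init m0 b0) []) \<subseteq> visited (anonymous q A m0 b0) T adv 0"
    by (simp add: run_team_def team_init_def)
  ultimately show ?case unfolding run.simps by blast
next
  case (Suc n)
  let ?c = "run (anonymous q A m0 b0) T adv n"
  obtain xs traj memo num stp where IH: "shadow q A m0 b0 T k K ?c xs traj memo num stp n"
    "seen (run_team A T (team_init m0 b0) xs) \<subseteq> visited (anonymous q A m0 b0) T adv n"
    using Suc by blast
  have "adv n ?c < k" using adv by (simp add: is_adversary_def)
  from shadow.shadow_step[OF IH(1) this] IH(2) show ?case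
    unfolding visited_Suc run.simps by blast
qed

lemma explores_mono: "explores_in_at_most k A T M \<Longrightarrow> M \<le> M' \<Longrightarrow> explores_in_at_most k A T M'"
  unfolding explores_in_at_most_def by (meson order_trans)

lemma explores_root: "1 \<le> M \<Longrightarrow> explores_in_at_most k A {[]} M"
  unfolding explores_in_at_most_def
  by (intro allI impI exI[of _ "Suc 0"]) (simp add: visited_Suc initial_config_def)

lemma adjacent_nonempty:
  assumes T: "rooted_tree T" "T \<noteq> {[]}" and v: "v \<in> T"
  shows "adjacent T v \<noteq> {}"
proof -
  \<comment> \<open>The number of robots is arbitrary here; only the facts about the tree are
    wanted.\<close>
  interpret exploration 1 T by unfold_locales (use T in auto)
  show ?thesis
  proof (cases "v = []")
    case False
    then show ?thesis using adjacent_butlast[OF v] by auto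
  next
    case True
    obtain w where w: "w \<in> T" "w \<noteq> []" using T v True by blast
    have "prefix ([] @ [hd w]) w" using w(2) by (cases w) auto
    then have "[] @ [hd w] \<in> T" by (rule prefix_in_tree[OF w(1)])
    then show ?thesis using adjacent_snoc[of "[]"] True by auto
  qed
qed

text \<open>The tree with one node is separate because a robot there has no neighbour to choose. In
  any other tree the depth is positive, so the additive 1 in the bound can be absorbed into the term
  for the depth.\<close>

lemma grouped_exploration:
  assumes K: "0 < K" and q: "0 < q" and k: "k \<le> q * K" and T: "rooted_tree T"
  shows "explores_in_at_most k
    (anonymous q (guarded (balancing.act K)) None (balancing.wall_init K)) T
    (real q * (2 * real (card T) + 96 * real K ^ 2 * 2 ^ K * real (depth T)))"
proof (cases "T = {[]}")
  case True
  have "1 \<le> real q * 2" using q by simp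
  then have "1 \<le> real q * (2 * real (card T) + 96 * real K ^ 2 * 2 ^ K * real (depth T))"
    using True by (simp add: depth_def)
  then show ?thesis using True explores_root by simp
next
  case False
  interpret exploration K T by unfold_locales (use K T in auto)
  let ?A = "anonymous q (guarded act) None wall_init"
  let ?X = "96 * real K ^ 2 * 2 ^ K * real (depth T)"
  let ?B = "real q * (2 * real (card T) + ?X)"
  obtain w where w: "w \<in> T" "w \<noteq> []" using T False by (auto simp: rooted_tree_def)
  then have D: "1 \<le> depth T" using length_le_depth[OF w(1)] by (cases w) auto
  \<comment> \<open>The constant is \<open>96 = 2 * 24 * 2\<close>, the last factor from
    \<open>depth T + 1 \<le> 2 * depth T\<close>.\<close>
  have "2 * real K * rate K * (real (depth T) + 1) \<le>
      2 * real K * (24 * real K * 2 ^ K) * (2 * real (depth T))"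
    using D rate_le rate_pos[of K] by (intro mult_mono) auto
  also have "\<dots> = ?X" by (simp add: power2_eq_square)
  finally have X: "2 * real K * rate K * (real (depth T) + 1) \<le> ?X" .
  show ?thesis unfolding explores_in_at_most_def
  proof (intro allI impI)
    fix adv assume adv: "is_adversary k adv"
    \<comment> \<open>Rounding down loses less than 1, whereas counting edges instead of nodes
      leaves a slack of \<open>2 * q\<close> rounds.\<close>
    let ?m = "nat \<lfloor>?B\<rfloor>"
    have B: "0 \<le> ?B" by simp
    then have m: "real ?m \<le> ?B" "?B < real ?m + 1" by linarith+
    have "T \<subseteq> visited ?A T adv ?m"
    proof (rule ccontr)
      assume unseen: "\<not> T \<subseteq> visited ?A T adv ?m"
      have "[] \<in> T" using T by (simp add: rooted_tree_def)
      then have "\<exists>xs traj memo num stp.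
          shadow q (guarded act) None wall_init T k K (run ?A T adv ?m) xs traj memo num stp ?m \<and>
          seen (run_team (guarded act) T (team_init None wall_init) xs) \<subseteq> visited ?A T adv ?m"
        using adjacent_nonempty[OF T False]
        by (intro shadow_run[OF adv k]) (auto intro: guarded_in)
      then obtain xs traj memo num stp where
        sh: "shadow q (guarded act) None wall_init T k K (run ?A T adv ?m) xs traj memo num stp ?m"
        and sub: "seen (run_team (guarded act) T (team_init None wall_init) xs) \<subseteq> visited ?A T adv ?m"
        by blast
      have "set xs \<subseteq> {..<K}" using sh by (simp add: shadow_def)
      then have "real (length xs) \<le> 2 * (real (card T) - 1) + 2 * real K * rate K * (real (depth T) + 1)"
        using unseen sub by (intro team_bound) auto
      then have "real (length xs) \<le> 2 * (real (card T) - 1) + ?X"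
        using add_left_mono[OF X] by (rule order_trans)
      then have "real (length xs) \<le> 2 * real (card T) + ?X - 2" by simp
      then have "real q * real (length xs) \<le> real q * (2 * real (card T) + ?X - 2)"
        by (intro mult_left_mono) auto
      also have "\<dots> = ?B - 2 * real q" by (simp add: algebra_simps)
      finally have "real q * real (length xs) \<le> ?B - 2" using q by simp
      moreover have "real ?m \<le> real q * real (length xs)"
        using shadow.rounds_le[OF sh] by (metis of_nat_le_iff of_nat_mult)
      ultimately show False using m by linarith
    qed
    then show "\<exists>m. real m \<le> ?B \<and> T \<subseteq> visited ?A T adv m" using m by blast
  qed
qed

section \<open>The number and the size of the groups\<close>

lemma square_le_power: "n ^ 2 \<le> 2 * 2 ^ (n::nat)"
proof (induction n)
  case (Suc n)
  have "Suc n \<le> 2 ^ n" using less_exp[of n] by (simp add: Suc_leI)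
  then show ?case using Suc by (simp add: power2_eq_square)
qed simp

(* About (log k) / 2 groups, for which the exponential factor costs only O(k). *)
lemma group_size:
  assumes "2 \<le> k"
  obtains K q :: nat where "0 < K" "0 < q" "k \<le> q * K" "real q \<le> 4 * (real k / ln (real k))"
    "real K ^ 2 * 2 ^ K \<le> 8 * real k"
proof -
  \<comment> \<open>With \<open>4 ^ (K - 1) \<le> k < 4 ^ K\<close> one factor \<open>2 ^ K\<close>
    absorbs \<open>K\<^sup>2\<close> up to a constant, and \<open>2 ^ K * 2 ^ K\<close> is of order
    \<open>k\<close>.\<close>
  define K where "K = (LEAST K. k < 4 ^ K)"
  have "k < 4 ^ k"
    by (rule less_le_trans[OF less_exp power_mono]) auto
  then have K1: "k < 4 ^ K" unfolding K_def by (rule LeastI)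
  then have K0: "0 < K" using assms by (cases K) auto
  have K2: "4 ^ (K - 1) \<le> k" using not_less_Least[of "K - 1" "\<lambda>K. k < 4 ^ K"] K0 by (simp add: K_def)
  have "K - 1 < 4 ^ (K - 1)"
    by (rule less_le_trans[OF less_exp power_mono]) auto
  then have Kk: "K \<le> k" using K2 by linarith
  \<comment> \<open>This is \<open>k / K\<close> rounded up; as \<open>K \<le> k\<close>, rounding
    at most doubles the product \<open>q * K\<close>.\<close>
  define q where "q = (k + K - 1) div K"
  have "k \<le> q * K"
  proof -
    have "k + K - 1 = q * K + (k + K - 1) mod K" unfolding q_def by (rule div_mult_mod_eq[symmetric])
    moreover have "(k + K - 1) mod K < K" using K0 by simp
    ultimately show ?thesis by linarith
  qed
  moreover have "0 < q" using \<open>k \<le> q * K\<close> assms by (cases q) auto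
  moreover have "real q \<le> 4 * (real k / ln (real k))"
  proof -
    have "q * K \<le> k + K - 1" unfolding q_def by (rule div_times_less_eq_dividend)
    then have "q * K \<le> 2 * k" using Kk by linarith
    then have qK: "real q * real K \<le> 2 * real k" by (metis of_nat_le_iff of_nat_mult of_nat_numeral)
    have lpos: "0 < ln (real k)" using assms by simp
    have "ln (real k) \<le> ln (4 ^ K)"
    proof -
      have "real k \<le> 4 ^ K" using K1 by (metis less_imp_le of_nat_le_iff of_nat_numeral of_nat_power)
      then show ?thesis using assms by simp
    qed
    also have "\<dots> = 2 * real K * ln 2" using ln_realpow[of "2::real" "2 * K"] by (simp add: power_mult)
    also have "\<dots> \<le> 2 * real K" using mult_left_mono[of "ln 2" 1 "2 * real K"] ln_2_less_1 by simp
    finally have "real q * ln (real k) \<le> real q * (2 * real K)" by (intro mult_left_mono) auto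
    also have "\<dots> = 2 * (real q * real K)" by simp
    also have "\<dots> \<le> 4 * real k" using qK by linarith
    finally show ?thesis using lpos by (simp add: field_simps)
  qed
  moreover have "real K ^ 2 * 2 ^ K \<le> 8 * real k"
  proof -
    have "K ^ 2 * 2 ^ K \<le> 2 * 2 ^ K * 2 ^ K" using square_le_power by (intro mult_right_mono) auto
    also have "\<dots> = 2 * 4 ^ K" by (simp flip: power_mult_distrib)
    also have "\<dots> = 8 * 4 ^ (K - 1)" using K0 by (cases K) auto
    also have "\<dots> \<le> 8 * k" using K2 by simp
    finally have "real (K ^ 2 * 2 ^ K) \<le> real (8 * k)" by (rule of_nat_mono)
    then show ?thesis by simp
  qed
  ultimately show ?thesis using that K0 by blast
qed

theorem theorem3:
  shows
    "(\<exists>C::real. \<forall>k::nat. k \<ge> 1 \<longrightarrow>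
        (\<exists>A. is_algorithm A \<and>
          (\<forall>T. rooted_tree T \<longrightarrow>
            explores_in_at_most k A T
              (2 * real (card T) + C * real k ^ 2 * 2 ^ k * real (depth T))))) \<and>
     (\<exists>C::real. \<forall>k::nat. k \<ge> 2 \<longrightarrow>
        (\<exists>A. is_algorithm A \<and>
          (\<forall>T. rooted_tree T \<longrightarrow>
            explores_in_at_most k A T
              (C * (real k / ln (real k)) * (real (card T) + real k * real (depth T))))))"
proof (rule conjI, goal_cases)
  case 1
  show ?case
  \<comment> \<open>Groups of one robot: every robot simulates a robot of its own.\<close>
  proof (intro exI[of _ "96 :: real"] allI impI)
    fix k :: nat assume "1 \<le> k"
    then have "explores_in_at_most k (anonymous 1 (guarded (balancing.act k)) None (balancing.wall_init k)) T
        (2 * real (card T) + 96 * real k ^ 2 * 2 ^ k * real (depth T))" if "rooted_tree T" for T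
      using grouped_exploration[of k 1 k T] that by simp
    then show "\<exists>A. is_algorithm A \<and> (\<forall>T. rooted_tree T \<longrightarrow>
        explores_in_at_most k A T (2 * real (card T) + 96 * real k ^ 2 * 2 ^ k * real (depth T)))"
      using is_algorithm_anonymous by blast
  qed
next
  case 2
  show ?case
  \<comment> \<open>The constant is \<open>4 * 8 * 96\<close>: 4 from the group size, 8 from
    \<open>K\<^sup>2 * 2 ^ K \<le> 8 * k\<close>, and 96 from the bound for groups.\<close>
  proof (intro exI[of _ "3072 :: real"] allI impI)
    fix k :: nat assume k: "2 \<le> k"
    obtain K q where Kq: "0 < K" "0 < q" "k \<le> q * K" "real q \<le> 4 * (real k / ln (real k))"
      "real K ^ 2 * 2 ^ K \<le> 8 * real k"
      using group_size[OF k] .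
    let ?A = "anonymous q (guarded (balancing.act K)) None (balancing.wall_init K)"
    have "is_algorithm ?A" by (rule is_algorithm_anonymous)
    moreover have "explores_in_at_most k ?A T
        (3072 * (real k / ln (real k)) * (real (card T) + real k * real (depth T)))"
      if T: "rooted_tree T" for T
    proof (rule explores_mono[OF grouped_exploration[OF Kq(1-3) T]])
      have "96 * real K ^ 2 * 2 ^ K * real (depth T) = 96 * (real K ^ 2 * 2 ^ K) * real (depth T)" by simp
      also have "\<dots> \<le> 96 * (8 * real k) * real (depth T)"
        using Kq(5) by (intro mult_right_mono mult_left_mono) auto
      also have "\<dots> = 768 * (real k * real (depth T))" by simp
      finally have "2 * real (card T) + 96 * real K ^ 2 * 2 ^ K * real (depth T) \<le>
          768 * real (card T) + 768 * (real k * real (depth T))" by (intro add_mono) auto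
      then have "2 * real (card T) + 96 * real K ^ 2 * 2 ^ K * real (depth T) \<le>
          768 * (real (card T) + real k * real (depth T))" by (simp only: distrib_left)
      then have "real q * (2 * real (card T) + 96 * real K ^ 2 * 2 ^ K * real (depth T)) \<le>
          4 * (real k / ln (real k)) * (768 * (real (card T) + real k * real (depth T)))"
        using Kq(4) by (intro mult_mono) (auto intro: order_trans[of _ "real q"])
      note bound = this
      have eq: "4 * x * (768 * y) = 3072 * x * y" for x y :: real by simp
      show "real q * (2 * real (card T) + 96 * real K ^ 2 * 2 ^ K * real (depth T)) \<le>
          3072 * (real k / ln (real k)) * (real (card T) + real k * real (depth T))"
        using bound unfolding eq .
    qed
    ultimately show "\<exists>A. is_algorithm A \<and> (\<forall>T. rooted_tree T \<longrightarrow> explores_in_at_most k A T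
        (3072 * (real k / ln (real k)) * (real (card T) + real k * real (depth T))))" by blast
  qed
qed

end
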